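(* Fix an integer $d$. Let $R$ be the class of permutations whose expanded decomposition tree has all prime nodes of arity smaller than $d$. Then the following problem can be solved in polynomial time: given $\sigma\in R$ and an arbitrary permutation $\tau$, compute a longest common pattern of $\sigma$ and $\tau$.
   Context: A permutation $\pi$ is a pattern of $\sigma$ if some subsequence of $\sigma$ is order-isomorphic to $\pi$; a longest common pattern of $\sigma$ and $\tau$ is a permutation of maximum length that is a pattern of both. A common interval of $\sigma=\sigma_1\cdots\sigma_k$ is a factor $\sigma_j\cdots\sigma_l$ whose set of values is an interval of integers; it is strong if it overlaps no other common interval ($I,J$ overlap if $I\setminus J$, $J\setminus I$, $I\cap J$ are all nonempty). Strong intervals ordered by inclusion form an ordered tree with leaves $\sigma_1,\dots,\sigma_k$ (the common interval decomposition tree), each internal node being the union of its children. An internal node with children $V_1,\dots,V_m$ is linear if every union of consecutive children is a common interval, and prime if no union $V_p\cup\dots\cup V_q$ with $p<q$, $(p,q)\ne(1,m)$, is a common interval; nodes of arity $2$ are considered linear. Linear nodes are labeled $+$ or $-$ according as the children's value intervals increase or decrease left to right. The expanded decomposition tree replaces each linear node with children $V_1,\dots,V_m$ and sign $s$ by the left comb $(\cdots((V_1,V_2),V_3),\dots,V_m)$ of $m-1$ binary nodes of sign $s$, and keeps prime nodes with their children. *)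

theory Defs
  imports Main
begin

definition is_perm :: "nat list \<Rightarrow> bool" where
  "is_perm xs \<longleftrightarrow> distinct xs \<and> set xs = {1..length xs}"

definition order_iso :: "nat list \<Rightarrow> nat list \<Rightarrow> bool" where
  "order_iso xs ys \<longleftrightarrow> length xs = length ys \<and>
     (\<forall>i<length xs. \<forall>j<length xs. xs ! i < xs ! j \<longleftrightarrow> ys ! i < ys ! j)"

definition is_pattern :: "nat list \<Rightarrow> nat list \<Rightarrow> bool" where
  "is_pattern \<pi> \<sigma> \<longleftrightarrow> is_perm \<pi> \<and> (\<exists>I. order_iso \<pi> (nths \<sigma> I))"

definition longest_common_pattern :: "nat list \<Rightarrow> nat list \<Rightarrow> nat list \<Rightarrow> bool" where
  "longest_common_pattern \<pi> \<sigma> \<tau> \<longleftrightarrow>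
     is_pattern \<pi> \<sigma> \<and> is_pattern \<pi> \<tau> \<and>
     (\<forall>\<pi>'. is_pattern \<pi>' \<sigma> \<and> is_pattern \<pi>' \<tau> \<longrightarrow> length \<pi>' \<le> length \<pi>)"

definition factor :: "nat list \<Rightarrow> nat set \<Rightarrow> bool" where
  "factor \<sigma> I \<longleftrightarrow> (\<exists>j l. j \<le> l \<and> l < length \<sigma> \<and> I = {j..l})"

definition vals :: "nat list \<Rightarrow> nat set \<Rightarrow> nat set" where
  "vals \<sigma> I = (\<lambda>i. \<sigma> ! i) ` I"

definition common_interval :: "nat list \<Rightarrow> nat set \<Rightarrow> bool" where
  "common_interval \<sigma> I \<longleftrightarrow> factor \<sigma> I \<and> (\<exists>a b. vals \<sigma> I = {a..b})"

definition overlap :: "nat set \<Rightarrow> nat set \<Rightarrow> bool" where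
  "overlap I J \<longleftrightarrow> I - J \<noteq> {} \<and> J - I \<noteq> {} \<and> I \<inter> J \<noteq> {}"

definition strong_interval :: "nat list \<Rightarrow> nat set \<Rightarrow> bool" where
  "strong_interval \<sigma> I \<longleftrightarrow> common_interval \<sigma> I \<and> (\<forall>J. common_interval \<sigma> J \<longrightarrow> \<not> overlap I J)"

definition children :: "nat list \<Rightarrow> nat set \<Rightarrow> nat set set" where
  "children \<sigma> V = {W. strong_interval \<sigma> W \<and> W \<subset> V \<and>
      \<not> (\<exists>U. strong_interval \<sigma> U \<and> W \<subset> U \<and> U \<subset> V)}"

definition children_list :: "nat list \<Rightarrow> nat set \<Rightarrow> nat set list \<Rightarrow> bool" where
  "children_list \<sigma> V Vs \<longleftrightarrow> set Vs = children \<sigma> V \<and> sorted_wrt (\<lambda>A B. Max A < Min B) Vs"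

definition cons_union :: "nat set list \<Rightarrow> nat \<Rightarrow> nat \<Rightarrow> nat set" where
  "cons_union Vs p q = \<Union> (set (drop p (take (Suc q) Vs)))"

definition linear_node :: "nat list \<Rightarrow> nat set list \<Rightarrow> bool" where
  "linear_node \<sigma> Vs \<longleftrightarrow> length Vs = 2 \<or>
     (\<forall>p q. p \<le> q \<and> q < length Vs \<longrightarrow> common_interval \<sigma> (cons_union Vs p q))"

text \<open>Nodes of arity 2 are considered linear, hence not prime.\<close>
definition prime_node :: "nat list \<Rightarrow> nat set list \<Rightarrow> bool" where
  "prime_node \<sigma> Vs \<longleftrightarrow> length Vs \<noteq> 2 \<and>
     (\<forall>p q. p < q \<and> q < length Vs \<and> (p, q) \<noteq> (0, length Vs - 1) \<longrightarrow>
        \<not> common_interval \<sigma> (cons_union Vs p q))"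

text \<open>Sign of a linear node: True = '+' (value intervals increase left to right),
  False = '-' (they decrease).\<close>
definition node_sign :: "nat list \<Rightarrow> nat set list \<Rightarrow> bool \<Rightarrow> bool" where
  "node_sign \<sigma> Vs s \<longleftrightarrow> (\<forall>i. Suc i < length Vs \<longrightarrow>
     (if s then Max (vals \<sigma> (Vs ! i)) < Min (vals \<sigma> (Vs ! Suc i))
      else Min (vals \<sigma> (Vs ! i)) > Max (vals \<sigma> (Vs ! Suc i))))"

datatype etree = ELeaf nat | ELin bool etree etree | EPrime "etree list"

inductive exp_tree :: "nat list \<Rightarrow> nat set \<Rightarrow> etree \<Rightarrow> bool" for \<sigma> where
  leaf: "i < length \<sigma> \<Longrightarrow> exp_tree \<sigma> {i} (ELeaf (\<sigma> ! i))"
| lin: "\<lbrakk> strong_interval \<sigma> V; card V \<ge> 2; children_list \<sigma> V Vs; linear_node \<sigma> Vs;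
          node_sign \<sigma> Vs s; length ts = length Vs;
          \<forall>i<length Vs. exp_tree \<sigma> (Vs ! i) (ts ! i) \<rbrakk>
        \<Longrightarrow> exp_tree \<sigma> V (foldl (\<lambda>a b. ELin s a b) (hd ts) (tl ts))"
| prime: "\<lbrakk> strong_interval \<sigma> V; card V \<ge> 2; children_list \<sigma> V Vs; prime_node \<sigma> Vs;
          length ts = length Vs;
          \<forall>i<length Vs. exp_tree \<sigma> (Vs ! i) (ts ! i) \<rbrakk>
        \<Longrightarrow> exp_tree \<sigma> V (EPrime ts)"

fun primes_below :: "int \<Rightarrow> etree \<Rightarrow> bool" where
  "primes_below d (ELeaf _) = True"
| "primes_below d (ELin s a b) = (primes_below d a \<and> primes_below d b)"
| "primes_below d (EPrime ts) = (int (length ts) < d \<and> (\<forall>t\<in>set ts. primes_below d t))"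

definition class_R :: "int \<Rightarrow> nat list \<Rightarrow> bool" where
  "class_R d \<sigma> \<longleftrightarrow> is_perm \<sigma> \<and>
     (\<forall>t. exp_tree \<sigma> {0..<length \<sigma>} t \<longrightarrow> primes_below d t)"

text \<open>Registers hold naturals; the only arithmetic is +1 / -1 (truncated), so after t steps
  all values are bounded by (max input value + t); this model is polynomially equivalent
  to Turing machines for the inputs considered here.\<close>
datatype instr =
    CLR nat
  | INC nat
  | DEC nat
  | CPY nat nat
  | LOADI nat nat
  | STOREI nat nat
  | JZ nat nat

type_synonym config = "nat \<times> (nat \<Rightarrow> nat)"

fun step :: "instr list \<Rightarrow> config \<Rightarrow> config" where
  "step prog (pc, m) =
    (if length prog \<le> pc then (pc, m) else
     (case prog ! pc of
        CLR r \<Rightarrow> (Suc pc, m(r := 0))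
      | INC r \<Rightarrow> (Suc pc, m(r := Suc (m r)))
      | DEC r \<Rightarrow> (Suc pc, m(r := m r - 1))
      | CPY r s \<Rightarrow> (Suc pc, m(r := m s))
      | LOADI r s \<Rightarrow> (Suc pc, m(r := m (m s)))
      | STOREI r s \<Rightarrow> (Suc pc, m(m r := m s))
      | JZ r l \<Rightarrow> (if m r = 0 then (l, m) else (Suc pc, m))))"

definition run :: "instr list \<Rightarrow> nat \<Rightarrow> config \<Rightarrow> config" where
  "run prog t c = (step prog ^^ t) c"

definition halted :: "instr list \<Rightarrow> config \<Rightarrow> bool" where
  "halted prog c \<longleftrightarrow> length prog \<le> fst c"

definition init_config :: "nat list \<Rightarrow> nat list \<Rightarrow> config" where
  "init_config \<sigma> \<tau> = (0, \<lambda>r.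
     if r = 0 then length \<sigma>
     else if r = 1 then length \<tau>
     else if r < 2 + length \<sigma> then \<sigma> ! (r - 2)
     else if r < 2 + length \<sigma> + length \<tau> then \<tau> ! (r - 2 - length \<sigma>)
     else 0)"

definition output_of :: "config \<Rightarrow> nat list" where
  "output_of c = map (\<lambda>i. snd c (Suc i)) [0..<snd c 0]"

end

theory Submission
  imports Defs
begin

text \<open>
  The algorithm is a dynamic program over pairs of boxes, a box being a range of positions and a
  range of values in \<open>\<sigma>\<close> together with such a box in \<open>\<tau>\<close>. Every pair stores a common pattern found
  inside it. One round of the program tries to improve each pair by concatenating the patterns of
  \<open>D = max 2 d\<close> smaller pairs that are ordered left to right and whose values are ordered the same way
  in both permutations; this is always sound. If \<open>\<sigma>\<close> is in the class, its index set splits recursively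
  into at most \<open>D\<close> parts that are consecutive in position and separated in value, namely the children of
  a prime node or the two arguments of a binary node, so after as many rounds as there are
  elements the pair of boxes spanned by any common pattern stores a pattern that is at least as long.

  That the expanded tree exists at all (otherwise membership in the class would be vacuous) follows
  from the decomposition theorem: if a strong interval splits into a prefix and a suffix of
  separated values, all boundaries between its children are such cuts and the node is linear; if it
  does not, a maximal proper union of children that is a common interval, joined with an interval that
  overlaps it, would yield such a split, so the node is prime.
\<close>

section \<open>The decomposition tree\<close>

definition separated :: "nat list \<Rightarrow> nat set \<Rightarrow> nat set \<Rightarrow> bool" where
  "separated \<sigma> X Y \<longleftrightarrow>
    (\<forall>i\<in>X. \<forall>j\<in>Y. \<sigma> ! i < \<sigma> ! j) \<or> (\<forall>i\<in>X. \<forall>j\<in>Y. \<sigma> ! j < \<sigma> ! i)"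

inductive decomposable :: "nat \<Rightarrow> nat list \<Rightarrow> nat set \<Rightarrow> bool" for D \<sigma> where
  point: "i < length \<sigma> \<Longrightarrow> decomposable D \<sigma> {i}"
| split: "\<lbrakk> length Vs \<le> D; V = \<Union>(set Vs); \<forall>W\<in>set Vs. W \<subset> V \<and> decomposable D \<sigma> W;
            sorted_wrt (\<lambda>A B. (\<forall>i\<in>A. \<forall>j\<in>B. i < j) \<and> separated \<sigma> A B) Vs \<rbrakk>
          \<Longrightarrow> decomposable D \<sigma> V"

definition ordered :: "bool \<Rightarrow> nat \<Rightarrow> nat \<Rightarrow> bool" where
  "ordered s x y = (if s then x < y else y < x)"

definition cut :: "nat list \<Rightarrow> bool \<Rightarrow> nat \<Rightarrow> nat \<Rightarrow> nat \<Rightarrow> bool" where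
  "cut \<sigma> s lo hi c \<longleftrightarrow> lo < c \<and> c \<le> hi \<and>
    (\<forall>i\<in>{lo..<c}. \<forall>j\<in>{c..hi}. ordered s (\<sigma> ! i) (\<sigma> ! j))"

lemma common_interval_iff:
  assumes "is_perm \<sigma>"
  shows "common_interval \<sigma> I \<longleftrightarrow> (\<exists>a b. a \<le> b \<and> b < length \<sigma> \<and> I = {a..b}) \<and>
    (\<forall>k<length \<sigma>. k \<notin> I \<longrightarrow> (\<forall>i\<in>I. \<sigma> ! k < \<sigma> ! i) \<or> (\<forall>i\<in>I. \<sigma> ! i < \<sigma> ! k))"
    (is "?L \<longleftrightarrow> ?F \<and> ?S")
proof
  assume L: ?L
  then have F: ?F by (auto simp: common_interval_def factor_def)
  then have lt: "i < length \<sigma>" if "i \<in> I" for i using that by auto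
  from L obtain x y where xy: "vals \<sigma> I = {x..y}" by (auto simp: common_interval_def)
  have ?S
  proof (intro allI impI)
    fix k assume k: "k < length \<sigma>" "k \<notin> I"
    have "\<sigma> ! k \<noteq> \<sigma> ! i" if "i \<in> I" for i
      using assms k lt[OF that] that unfolding is_perm_def by (metis nth_eq_iff_index_eq)
    then have "\<sigma> ! k \<notin> vals \<sigma> I" by (auto simp: vals_def)
    then have out: "\<sigma> ! k < x \<or> y < \<sigma> ! k" using xy by auto
    have *: "x \<le> \<sigma> ! i \<and> \<sigma> ! i \<le> y" if "i \<in> I" for i
    proof -
      have "\<sigma> ! i \<in> vals \<sigma> I" using that by (simp add: vals_def)
      then show ?thesis using xy by simp
    qed
    from out show "(\<forall>i\<in>I. \<sigma> ! k < \<sigma> ! i) \<or> (\<forall>i\<in>I. \<sigma> ! i < \<sigma> ! k)"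
    proof
      assume "\<sigma> ! k < x"
      then have "\<sigma> ! k < \<sigma> ! i" if "i \<in> I" for i using *[OF that] by simp
      then show ?thesis by blast
    next
      assume "y < \<sigma> ! k"
      then have "\<sigma> ! i < \<sigma> ! k" if "i \<in> I" for i using *[OF that] by simp
      then show ?thesis by blast
    qed
  qed
  with F show "?F \<and> ?S" by blast
next
  assume FS: "?F \<and> ?S"
  then have lt: "i < length \<sigma>" if "i \<in> I" for i using that by auto
  have fin: "finite (vals \<sigma> I)" "vals \<sigma> I \<noteq> {}" using FS by (auto simp: vals_def)
  have "v \<in> vals \<sigma> I" if v: "Min (vals \<sigma> I) \<le> v" "v \<le> Max (vals \<sigma> I)" for v
  proof -
    obtain i where i: "i \<in> I" "\<sigma> ! i = Min (vals \<sigma> I)"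
      using Min_in[OF fin] by (auto simp: vals_def)
    obtain j where j: "j \<in> I" "\<sigma> ! j = Max (vals \<sigma> I)"
      using Max_in[OF fin] by (auto simp: vals_def)
    have "\<sigma> ! i \<in> set \<sigma>" "\<sigma> ! j \<in> set \<sigma>" using lt i(1) j(1) by (blast intro: nth_mem)+
    then have "1 \<le> \<sigma> ! i" "\<sigma> ! j \<le> length \<sigma>"
      using assms unfolding is_perm_def by (blast dest: atLeastAtMost_iff[THEN iffD1])+
    then have "v \<in> {1..length \<sigma>}" using v unfolding i(2) j(2) by auto
    then have "v \<in> set \<sigma>" using assms unfolding is_perm_def by blast
    then obtain k where k: "k < length \<sigma>" "\<sigma> ! k = v" by (auto simp: in_set_conv_nth)
    have "k \<in> I"
    proof (rule ccontr)
      assume "k \<notin> I"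
      then have "\<sigma> ! k < \<sigma> ! i \<or> \<sigma> ! j < \<sigma> ! k" using FS k(1) i(1) j(1) by blast
      then show False using v i(2) j(2) k(2) by linarith
    qed
    then show ?thesis using k by (auto simp: vals_def)
  qed
  moreover have "x \<in> {Min (vals \<sigma> I)..Max (vals \<sigma> I)}" if "x \<in> vals \<sigma> I" for x
    using Min_le[OF fin(1) that] Max_ge[OF fin(1) that] by simp
  ultimately have "vals \<sigma> I = {Min (vals \<sigma> I)..Max (vals \<sigma> I)}"
    by (meson atLeastAtMost_iff subsetI subset_antisym)
  then show ?L using FS unfolding common_interval_def factor_def by blast
qed

context
  fixes \<sigma> :: "nat list"
  assumes perm: "is_perm \<sigma>"
begin

lemma side_above:
  assumes "(\<forall>i\<in>J. \<sigma> ! k < \<sigma> ! i) \<or> (\<forall>i\<in>J. \<sigma> ! i < \<sigma> ! k)" "\<sigma> ! k < \<sigma> ! x" "x \<in> J" "i \<in> J"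
  shows "\<sigma> ! k < \<sigma> ! i"
proof -
  have "\<not> (\<sigma> ! k < \<sigma> ! i) \<Longrightarrow> \<not> (\<sigma> ! k < \<sigma> ! x)" using assms(1,3,4) by (metis order.asym)
  then show ?thesis using assms(2) by blast
qed

lemma side_below:
  assumes "(\<forall>i\<in>J. \<sigma> ! k < \<sigma> ! i) \<or> (\<forall>i\<in>J. \<sigma> ! i < \<sigma> ! k)" "\<sigma> ! x < \<sigma> ! k" "x \<in> J" "i \<in> J"
  shows "\<sigma> ! i < \<sigma> ! k"
proof -
  have "\<not> (\<sigma> ! i < \<sigma> ! k) \<Longrightarrow> \<not> (\<sigma> ! x < \<sigma> ! k)" using assms(1,3,4) by (metis order.asym)
  then show ?thesis using assms(2) by blast
qed

lemma common_interval_side: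
  "common_interval \<sigma> I \<Longrightarrow> k < length \<sigma> \<Longrightarrow> k \<notin> I \<Longrightarrow>
    (\<forall>i\<in>I. \<sigma> ! k < \<sigma> ! i) \<or> (\<forall>i\<in>I. \<sigma> ! i < \<sigma> ! k)"
  using common_interval_iff[OF perm, of I] by simp

lemma common_interval_bounds:
  assumes "common_interval \<sigma> I"
  obtains lo hi where "I = {lo..hi}" "lo \<le> hi" "hi < length \<sigma>"
  using common_interval_iff[OF perm, THEN iffD1, THEN conjunct1, OF assms] by blast

lemma common_intervalI:
  assumes "I = {a..b}" "a \<le> b" "b < length \<sigma>"
    and "\<And>k. k < length \<sigma> \<Longrightarrow> k \<notin> I \<Longrightarrow>
      (\<forall>i\<in>I. \<sigma> ! k < \<sigma> ! i) \<or> (\<forall>i\<in>I. \<sigma> ! i < \<sigma> ! k)"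
  shows "common_interval \<sigma> I"
proof (rule common_interval_iff[OF perm, THEN iffD2], rule conjI)
  show "\<exists>a b. a \<le> b \<and> b < length \<sigma> \<and> I = {a..b}" using assms(1-3) by blast
  show "\<forall>k<length \<sigma>. k \<notin> I \<longrightarrow> (\<forall>i\<in>I. \<sigma> ! k < \<sigma> ! i) \<or> (\<forall>i\<in>I. \<sigma> ! i < \<sigma> ! k)"
    using assms(4) by simp
qed

lemma common_interval_lt: "common_interval \<sigma> I \<Longrightarrow> i \<in> I \<Longrightarrow> i < length \<sigma>"
  by (elim common_interval_bounds) auto

lemma common_interval_disjoint_separated:
  assumes "common_interval \<sigma> I" "common_interval \<sigma> J" "I \<inter> J = {}"
  shows "separated \<sigma> I J"
proof -
  have I: "(\<forall>i\<in>I. \<sigma> ! j < \<sigma> ! i) \<or> (\<forall>i\<in>I. \<sigma> ! i < \<sigma> ! j)" if "j \<in> J" for j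
    using common_interval_side[OF assms(1) common_interval_lt[OF assms(2) that]] assms(3) that
    by blast
  have J: "(\<forall>j\<in>J. \<sigma> ! i < \<sigma> ! j) \<or> (\<forall>j\<in>J. \<sigma> ! j < \<sigma> ! i)" if "i \<in> I" for i
    using common_interval_side[OF assms(2) common_interval_lt[OF assms(1) that]] assms(3) that
    by blast
  have "I \<noteq> {}" using assms(1) by (elim common_interval_bounds) auto
  then obtain x where x: "x \<in> I" by blast
  from J[OF x] show ?thesis
  proof
    assume *: "\<forall>j\<in>J. \<sigma> ! x < \<sigma> ! j"
    then have "\<sigma> ! i < \<sigma> ! j" if "i \<in> I" "j \<in> J" for i j
      using side_below[OF I[OF that(2)] _ x that(1)] that(2) by blast
    then show ?thesis by (simp add: separated_def)
  next
    assume *: "\<forall>j\<in>J. \<sigma> ! j < \<sigma> ! x"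
    then have "\<sigma> ! j < \<sigma> ! i" if "i \<in> I" "j \<in> J" for i j
      using side_above[OF I[OF that(2)] _ x that(1)] that(2) by blast
    then show ?thesis by (simp add: separated_def)
  qed
qed

lemma common_interval_Un:
  assumes "common_interval \<sigma> I" "common_interval \<sigma> J" "I \<inter> J \<noteq> {}"
  shows "common_interval \<sigma> (I \<union> J)"
proof -
  obtain a b where ab: "a \<le> b" "b < length \<sigma>" "I = {a..b}"
    using assms(1) by (elim common_interval_bounds)
  obtain c d where cd: "c \<le> d" "d < length \<sigma>" "J = {c..d}"
    using assms(2) by (elim common_interval_bounds)
  have "I \<union> J = {min a c..max b d}" using ab cd assms(3) by auto
  moreover have "min a c \<le> max b d" "max b d < length \<sigma>" using ab cd by auto
  ultimately have F: "\<exists>a b. a \<le> b \<and> b < length \<sigma> \<and> I \<union> J = {a..b}" by blast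
  obtain x where x: "x \<in> I" "x \<in> J" using assms(3) by blast
  have "(\<forall>i\<in>I \<union> J. \<sigma> ! k < \<sigma> ! i) \<or> (\<forall>i\<in>I \<union> J. \<sigma> ! i < \<sigma> ! k)"
    if k: "k < length \<sigma>" "k \<notin> I \<union> J" for k
  proof -
    have I: "(\<forall>i\<in>I. \<sigma> ! k < \<sigma> ! i) \<or> (\<forall>i\<in>I. \<sigma> ! i < \<sigma> ! k)"
      and J: "(\<forall>i\<in>J. \<sigma> ! k < \<sigma> ! i) \<or> (\<forall>i\<in>J. \<sigma> ! i < \<sigma> ! k)"
      using common_interval_side assms(1,2) k by blast+
    from I show ?thesis
    proof
      assume "\<forall>i\<in>I. \<sigma> ! k < \<sigma> ! i"
      then show ?thesis using side_above[OF J _ x(2)] x(1) by blast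
    next
      assume "\<forall>i\<in>I. \<sigma> ! i < \<sigma> ! k"
      then show ?thesis using side_below[OF J _ x(2)] x(1) by blast
    qed
  qed
  with F show ?thesis unfolding common_interval_iff[OF perm] by blast
qed

lemma common_interval_Diff:
  assumes "common_interval \<sigma> I" "common_interval \<sigma> J" "overlap I J"
  shows "common_interval \<sigma> (J - I)"
proof -
  obtain a b where ab: "a \<le> b" "b < length \<sigma>" "I = {a..b}"
    using assms(1) by (elim common_interval_bounds)
  obtain c d where cd: "c \<le> d" "d < length \<sigma>" "J = {c..d}"
    using assms(2) by (elim common_interval_bounds)
  have "a < c \<and> c \<le> b \<and> b < d \<or> c < a \<and> a \<le> d \<and> d < b"
    using assms(3) ab cd by (auto simp: overlap_def)
  then have "J - I = {Suc b..d} \<and> Suc b \<le> d \<or> J - I = {c..a - 1} \<and> c \<le> a - 1 \<and> a - 1 < length \<sigma>"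
    using ab cd by (elim disjE) auto
  then have F: "\<exists>x y. x \<le> y \<and> y < length \<sigma> \<and> J - I = {x..y}" using cd by blast
  obtain e where e: "e \<in> I" "e \<notin> J" using assms(3) unfolding overlap_def by blast
  then have e_lt: "e < length \<sigma>" using ab by auto
  have J: "(\<forall>i\<in>J. \<sigma> ! k < \<sigma> ! i) \<or> (\<forall>i\<in>J. \<sigma> ! i < \<sigma> ! k)" if "k < length \<sigma>" "k \<notin> J" for k
    using common_interval_side[OF assms(2) that] .
  have I: "(\<forall>i\<in>I. \<sigma> ! k < \<sigma> ! i) \<or> (\<forall>i\<in>I. \<sigma> ! i < \<sigma> ! k)" if "k < length \<sigma>" "k \<notin> I" for k
    using common_interval_side[OF assms(1) that] .
  have "(\<forall>i\<in>J - I. \<sigma> ! k < \<sigma> ! i) \<or> (\<forall>i\<in>J - I. \<sigma> ! i < \<sigma> ! k)"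
    if k: "k < length \<sigma>" "k \<notin> J - I" for k
  proof (cases "k \<in> J")
    case False
    then show ?thesis using J k by blast
  next
    case True
    then have kI: "k \<in> I" using k by blast
    have lt: "i < length \<sigma>" if "i \<in> J" for i using cd that by auto
    from J[OF e_lt e(2)] show ?thesis
    proof
      assume "\<forall>i\<in>J. \<sigma> ! e < \<sigma> ! i"
      then have "\<sigma> ! k < \<sigma> ! i" if "i \<in> J - I" for i
        using side_below[OF I[of i] _ e(1) kI] lt[of i] that by blast
      then show ?thesis by blast
    next
      assume "\<forall>i\<in>J. \<sigma> ! i < \<sigma> ! e"
      then have "\<sigma> ! i < \<sigma> ! k" if "i \<in> J - I" for i
        using side_above[OF I[of i] _ e(1) kI] lt[of i] that by blast
      then show ?thesis by blast
    qed
  qed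
  with F show ?thesis unfolding common_interval_iff[OF perm] by blast
qed

lemma ordered_separated:
  "k < length \<sigma> \<Longrightarrow> common_interval \<sigma> I \<Longrightarrow> k \<notin> I \<Longrightarrow> i \<in> I \<Longrightarrow> j \<in> I \<Longrightarrow>
    (ordered s (\<sigma> ! k) (\<sigma> ! i) \<longleftrightarrow> ordered s (\<sigma> ! k) (\<sigma> ! j)) \<and>
    (ordered s (\<sigma> ! i) (\<sigma> ! k) \<longleftrightarrow> ordered s (\<sigma> ! j) (\<sigma> ! k))"
proof -
  assume k: "k < length \<sigma>" "common_interval \<sigma> I" "k \<notin> I" and ij: "i \<in> I" "j \<in> I"
  then consider "\<forall>i\<in>I. \<sigma> ! k < \<sigma> ! i" | "\<forall>i\<in>I. \<sigma> ! i < \<sigma> ! k"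
    using common_interval_side by blast
  then show ?thesis using ij by cases (use ij in \<open>force simp: ordered_def\<close>)+
qed

lemma segment_common_interval:
  assumes V: "common_interval \<sigma> {lo..hi}"
    and p: "p = lo \<or> cut \<sigma> s lo hi p" and q: "q = Suc hi \<or> cut \<sigma> s lo hi q" and "p < q"
  shows "common_interval \<sigma> {p..<q}"
proof -
  have lq: "lo \<le> p" "q \<le> Suc hi" using p q by (auto simp: cut_def)
  have hi: "hi < length \<sigma>"
    using V lq \<open>p < q\<close> by (auto intro: common_interval_lt)
  have F: "{p..<q} = {p..q - 1}" "p \<le> q - 1" "q - 1 < length \<sigma>" using lq hi \<open>p < q\<close> by auto
  have "(\<forall>i\<in>{p..<q}. \<sigma> ! k < \<sigma> ! i) \<or> (\<forall>i\<in>{p..<q}. \<sigma> ! i < \<sigma> ! k)"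
    if k: "k < length \<sigma>" "k \<notin> {p..<q}" for k
  proof (cases "k \<in> {lo..hi}")
    case False
    then have "(\<forall>i\<in>{lo..hi}. \<sigma> ! k < \<sigma> ! i) \<or> (\<forall>i\<in>{lo..hi}. \<sigma> ! i < \<sigma> ! k)"
      using common_interval_side[OF V k(1)] by blast
    moreover have "{p..<q} \<subseteq> {lo..hi}" using lq by auto
    ultimately show ?thesis by blast
  next
    case True
    show ?thesis
    proof (cases "k < p")
      case True
      then have c: "cut \<sigma> s lo hi p" using p \<open>k \<in> {lo..hi}\<close> by auto
      have "ordered s (\<sigma> ! k) (\<sigma> ! i)" if "i \<in> {p..<q}" for i
        using c that True \<open>k \<in> {lo..hi}\<close> lq unfolding cut_def by auto
      then show ?thesis by (cases s) (simp_all add: ordered_def)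
    next
      case False
      then have "q \<le> k" using k by auto
      then have c: "cut \<sigma> s lo hi q" using q \<open>k \<in> {lo..hi}\<close> by auto
      have "ordered s (\<sigma> ! i) (\<sigma> ! k)" if "i \<in> {p..<q}" for i
        using c that \<open>q \<le> k\<close> \<open>k \<in> {lo..hi}\<close> lq unfolding cut_def by auto
      then show ?thesis by (cases s) (simp_all add: ordered_def)
    qed
  qed
  then show ?thesis by (rule common_intervalI[OF F])
qed

lemma block_strong:
  assumes V: "strong_interval \<sigma> {lo..hi}"
    and p: "p = lo \<or> cut \<sigma> s lo hi p" and q: "q = Suc hi \<or> cut \<sigma> s lo hi q" and "p < q"
    and nocut: "\<And>c. p < c \<Longrightarrow> c < q \<Longrightarrow> \<not> cut \<sigma> s lo hi c"
  shows "strong_interval \<sigma> {p..<q}"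
proof -
  have V': "common_interval \<sigma> {lo..hi}" using V by (simp add: strong_interval_def)
  have lq: "lo \<le> p" "q \<le> Suc hi" using p q by (auto simp: cut_def)
  have "\<not> overlap {p..<q} J" if J: "common_interval \<sigma> J" for J
  proof
    assume o: "overlap {p..<q} J"
    obtain c d where cd: "c \<le> d" "d < length \<sigma>" "J = {c..d}"
      using J by (elim common_interval_bounds)
    have "{p..<q} \<subseteq> {lo..hi}" using lq by auto
    then have "J \<subseteq> {lo..hi}" using V J o unfolding strong_interval_def overlap_def by blast
    then have cd': "lo \<le> c" "d \<le> hi" using cd by auto
    have "hi < length \<sigma>" using V' cd' cd(1) by (auto intro: common_interval_lt)
    consider "c < p" "p \<le> d" "Suc d < q" | "p < c" "c < q" "q \<le> d"
    proof -
      obtain x where "x \<in> {p..<q}" "x \<in> J" using o unfolding overlap_def by blast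
      moreover obtain y where "y \<in> {p..<q}" "y \<notin> J" using o unfolding overlap_def by blast
      moreover obtain z where "z \<notin> {p..<q}" "z \<in> J" using o unfolding overlap_def by blast
      ultimately have "c < p \<and> p \<le> d \<and> Suc d < q \<or> p < c \<and> c < q \<and> q \<le> d"
        unfolding cd(3) atLeastAtMost_iff atLeastLessThan_iff by linarith
      then show thesis using that by blast
    qed
    then show False
    proof cases
      case 1
      have "ordered s (\<sigma> ! i) (\<sigma> ! j)" if ij: "i \<in> {lo..<Suc d}" "j \<in> {Suc d..hi}" for i j
      proof -
        consider "q \<le> j" | "i < p" | "p \<le> i" "j < q" by linarith
        then show ?thesis
        proof cases
          case a: 1
          then have "cut \<sigma> s lo hi q" using q ij by auto
          then show ?thesis using a ij 1 by (auto simp: cut_def)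
        next
          case a: 2
          then have "cut \<sigma> s lo hi p" using p ij by auto
          then show ?thesis using a ij 1 by (auto simp: cut_def)
        next
          case a: 3
          have "cut \<sigma> s lo hi p" using p 1 cd' by auto
          then have "ordered s (\<sigma> ! c) (\<sigma> ! j)" using 1 cd' ij by (auto simp: cut_def)
          then show ?thesis
            using ordered_separated[OF _ J, of j c i s] ij a cd 1 \<open>hi < length \<sigma>\<close> by auto
        qed
      qed
      then have "cut \<sigma> s lo hi (Suc d)" using 1 lq by (auto simp: cut_def)
      then show False using nocut[of "Suc d"] 1 by auto
    next
      case 2
      have "ordered s (\<sigma> ! i) (\<sigma> ! j)" if ij: "i \<in> {lo..<c}" "j \<in> {c..hi}" for i j
      proof -
        consider "q \<le> j" | "i < p" | "p \<le> i" "j < q" by linarith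
        then show ?thesis
        proof cases
          case a: 1
          then have "cut \<sigma> s lo hi q" using q ij by auto
          then show ?thesis using a ij 2 by (auto simp: cut_def)
        next
          case a: 2
          then have "cut \<sigma> s lo hi p" using p ij by auto
          then show ?thesis using a ij 2 by (auto simp: cut_def)
        next
          case a: 3
          have "cut \<sigma> s lo hi q" using q 2 cd' by auto
          then have "ordered s (\<sigma> ! i) (\<sigma> ! d)" using 2 cd' ij by (auto simp: cut_def)
          then show ?thesis
            using ordered_separated[OF _ J, of i d j s] ij a cd 2 \<open>hi < length \<sigma>\<close> by auto
        qed
      qed
      then have "cut \<sigma> s lo hi c" using 2 lq by (auto simp: cut_def)
      then show False using nocut[of c] 2 by auto
    qed
  qed
  then show ?thesis
    using segment_common_interval[OF V' p q \<open>p < q\<close>] by (simp add: strong_interval_def)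
qed

lemma strong_interval_bounds:
  assumes "strong_interval \<sigma> V"
  obtains lo hi where "V = {lo..hi}" "lo \<le> hi" "hi < length \<sigma>" "Min V = lo" "Max V = hi"
proof -
  have "common_interval \<sigma> V" using assms by (simp add: strong_interval_def)
  then obtain a b where "V = {a..b}" "a \<le> b" "b < length \<sigma>" by (rule common_interval_bounds)
  moreover from this have "Min V = a" "Max V = b" by (auto intro: Min_eqI Max_eqI)
  ultimately show thesis using that by blast
qed

lemma strong_singleton: "i < length \<sigma> \<Longrightarrow> strong_interval \<sigma> {i}"
proof -
  assume i: "i < length \<sigma>"
  have "{i} = {i..i}" "vals \<sigma> {i} = {\<sigma> ! i..\<sigma> ! i}" by (auto simp: vals_def)
  then have "common_interval \<sigma> {i}" using i unfolding common_interval_def factor_def by blast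
  moreover have "\<not> overlap {i} J" for J by (auto simp: overlap_def)
  ultimately show ?thesis by (simp add: strong_interval_def)
qed

lemma finite_strong_subsets: "finite {W. strong_interval \<sigma> W \<and> P W}"
proof -
  have "{W. strong_interval \<sigma> W \<and> P W} \<subseteq> Pow {..<length \<sigma>}"
    by (auto simp: strong_interval_def intro: common_interval_lt)
  then show ?thesis by (rule finite_subset) simp
qed

lemma strong_in_child:
  assumes "strong_interval \<sigma> W" "W \<subset> V"
  shows "\<exists>C\<in>children \<sigma> V. W \<subseteq> C"
proof -
  define F where "F = {U. strong_interval \<sigma> U \<and> (W \<subseteq> U \<and> U \<subset> V)}"
  have "W \<in> F" using assms by (simp add: F_def)
  moreover have "finite F" unfolding F_def by (rule finite_strong_subsets)
  ultimately have "\<exists>C\<in>F. \<forall>U\<in>F. C \<subseteq> U \<longrightarrow> C = U"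
    by (intro finite_has_maximal) auto
  then obtain C where C: "C \<in> F" and max: "\<forall>U\<in>F. C \<subseteq> U \<longrightarrow> C = U" ..
  have "\<not> (C \<subset> U \<and> U \<subset> V)" if "strong_interval \<sigma> U" for U
  proof
    assume "C \<subset> U \<and> U \<subset> V"
    then have "U \<in> F" "C \<subseteq> U" using that C by (auto simp: F_def)
    then have "C = U" using max by simp
    with \<open>C \<subset> U \<and> U \<subset> V\<close> show False by simp
  qed
  then have "C \<in> children \<sigma> V" using C unfolding children_def F_def mem_Collect_eq by (metis (no_types))
  moreover have "W \<subseteq> C" using C by (simp add: F_def)
  ultimately show ?thesis by (rule rev_bexI)
qed

lemma child_strong: "W \<in> children \<sigma> V \<Longrightarrow> strong_interval \<sigma> W"
  and child_psubset: "W \<in> children \<sigma> V \<Longrightarrow> W \<subset> V"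
  by (simp_all add: children_def)

lemma children_disjoint:
  assumes "A \<in> children \<sigma> V" "B \<in> children \<sigma> V" "A \<noteq> B"
  shows "A \<inter> B = {}"
proof -
  have *: "\<not> X \<subset> Y" if "X \<in> children \<sigma> V" "Y \<in> children \<sigma> V" for X Y
    using that unfolding children_def mem_Collect_eq by (metis (no_types))
  have "\<not> overlap A B" using assms by (simp add: children_def strong_interval_def)
  then have "A \<subseteq> B \<or> B \<subseteq> A \<or> A \<inter> B = {}" unfolding overlap_def by blast
  then show ?thesis using *[OF assms(1,2)] *[OF assms(2,1)] assms(3) by (simp add: psubset_eq)
qed

lemma children_list_exists: "\<exists>Vs. children_list \<sigma> V Vs"
proof -
  have "\<exists>Vs. set Vs = F \<and> sorted_wrt (\<lambda>A B. Max A < Min B) Vs"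
    if "finite F" "F \<subseteq> children \<sigma> V" for F
    using that
  proof (induction rule: finite_ranking_induct[where f = Max])
    case empty
    then show ?case by (intro exI[of _ "[]"]) simp
  next
    case (insert A F)
    then obtain Vs where Vs: "set Vs = F" "sorted_wrt (\<lambda>A B. Max A < Min B) Vs" by auto
    show ?case
    proof (cases "A \<in> F")
      case True
      then show ?thesis using Vs by (intro exI[of _ Vs]) (simp add: insert_absorb)
    next
      case False
      have "Max B < Min A" if "B \<in> F" for B
      proof -
        have "A \<in> children \<sigma> V" "B \<in> children \<sigma> V" using insert.prems that by blast+
        moreover have "A \<noteq> B" using that False by blast
        ultimately have "strong_interval \<sigma> A" "strong_interval \<sigma> B" and "A \<inter> B = {}"
          using child_strong children_disjoint by blast+
        moreover have "Max B \<le> Max A" using insert.hyps(2)[OF that] .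
        ultimately show ?thesis
        proof (elim strong_interval_bounds)
          fix lo hi lo' hi'
          assume *: "A \<inter> B = {}" "Max B \<le> Max A" "A = {lo..hi}" "lo \<le> hi" "Min A = lo" "Max A = hi"
            "B = {lo'..hi'}" "lo' \<le> hi'" "Max B = hi'"
          have "hi' \<notin> A" using *(1,7,8) by auto
          with * show "Max B < Min A" by auto
        qed
      qed
      with Vs have "sorted_wrt (\<lambda>A B. Max A < Min B) (Vs @ [A])"
        by (auto simp: sorted_wrt_append)
      then show ?thesis using Vs(1) by (intro exI[of _ "Vs @ [A]"]) simp
    qed
  qed
  moreover have "finite (children \<sigma> V)" using finite_strong_subsets unfolding children_def by simp
  ultimately show ?thesis unfolding children_list_def by simp
qed


lemma mem_cons_union:
  assumes "q < length Vs"
  shows "x \<in> cons_union Vs p q \<longleftrightarrow> (\<exists>k. p \<le> k \<and> k \<le> q \<and> x \<in> Vs ! k)"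
proof -
  have "set (drop p (take (Suc q) Vs)) = {Vs ! k | k. p \<le> k \<and> k \<le> q}"
  proof (intro set_eqI iffI)
    fix W assume "W \<in> set (drop p (take (Suc q) Vs))"
    then obtain i where "i < length (drop p (take (Suc q) Vs))" "W = drop p (take (Suc q) Vs) ! i"
      unfolding in_set_conv_nth by blast
    then have "p + i \<le> q" "W = Vs ! (p + i)" using assms by auto
    then show "W \<in> {Vs ! k | k. p \<le> k \<and> k \<le> q}" by auto
  next
    fix W assume "W \<in> {Vs ! k | k. p \<le> k \<and> k \<le> q}"
    then obtain k where k: "p \<le> k" "k \<le> q" "W = Vs ! k" by blast
    then have "k - p < length (drop p (take (Suc q) Vs))" "drop p (take (Suc q) Vs) ! (k - p) = W"
      using assms by auto
    then show "W \<in> set (drop p (take (Suc q) Vs))" by (metis nth_mem)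
  qed
  also have "{Vs ! k | k. p \<le> k \<and> k \<le> q} = (!) Vs ` {p..q}" by auto
  finally have "cons_union Vs p q = (\<Union>k\<in>{p..q}. Vs ! k)" unfolding cons_union_def by simp
  then show ?thesis by auto
qed

lemma strong_interval_finite:
  assumes "strong_interval \<sigma> V"
  shows "finite V \<and> V \<noteq> {}"
proof -
  obtain lo hi where "V = {lo..hi}" "lo \<le> hi" using assms by (rule strong_interval_bounds)
  then show ?thesis by simp
qed

context
  fixes V :: "nat set" and Vs :: "nat set list"
  assumes strong: "strong_interval \<sigma> V" and card: "card V \<ge> 2" and cl: "children_list \<sigma> V Vs"
begin

lemma child_nth: "i < length Vs \<Longrightarrow> Vs ! i \<in> children \<sigma> V"
  using nth_mem[of i Vs] cl unfolding children_list_def by metis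

lemma child_nth_bounds:
  assumes "i < length Vs" "x \<in> Vs ! i"
  shows "Min (Vs ! i) \<le> x" "x \<le> Max (Vs ! i)"
  using strong_interval_finite[OF child_strong[OF child_nth[OF assms(1)]]] assms(2) by auto

lemma child_nth_less:
  assumes "i < j" "j < length Vs" "x \<in> Vs ! i" "y \<in> Vs ! j"
  shows "x < y"
proof -
  have "Max (Vs ! i) < Min (Vs ! j)"
    using cl assms unfolding children_list_def sorted_wrt_iff_nth_less by blast
  then show ?thesis using child_nth_bounds[of i x] child_nth_bounds[of j y] assms by simp
qed

lemma in_child_nth:
  assumes "x \<in> V"
  shows "\<exists>i<length Vs. x \<in> Vs ! i"
proof -
  have "common_interval \<sigma> V" using strong by (simp add: strong_interval_def)
  then have "strong_interval \<sigma> {x}" using assms by (intro strong_singleton common_interval_lt)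
  moreover have "{x} \<subset> V" using assms card by auto
  ultimately have "\<exists>C\<in>children \<sigma> V. {x} \<subseteq> C" by (rule strong_in_child)
  then obtain C where C: "C \<in> children \<sigma> V" "{x} \<subseteq> C" ..
  then have "C \<in> set Vs" using cl by (simp add: children_list_def)
  with C(2) show ?thesis by (auto simp: in_set_conv_nth)
qed

lemma child_nth_subset: "i < length Vs \<Longrightarrow> Vs ! i \<subset> V"
  using child_nth child_psubset by blast

lemma length_children: "length Vs \<ge> 2"
proof (rule ccontr)
  assume "\<not> 2 \<le> length Vs"
  then have l: "length Vs = 0 \<or> length Vs = 1" by linarith
  obtain x where x: "x \<in> V" using strong_interval_finite[OF strong] by blast
  obtain i where "i < length Vs" using in_child_nth[OF x] by blast
  then have 1: "length Vs = 1" using l by linarith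
  have "V \<subseteq> Vs ! 0"
  proof
    fix y assume "y \<in> V"
    then obtain j where "j < length Vs" "y \<in> Vs ! j" using in_child_nth by blast
    then show "y \<in> Vs ! 0" using 1 by simp
  qed
  moreover have "Vs ! 0 \<subset> V" using child_nth_subset[of 0] 1 by simp
  ultimately show False by blast
qed

lemma cons_union_eq:
  assumes "p \<le> q" "q < length Vs"
  shows "cons_union Vs p q = {Min (Vs ! p)..Max (Vs ! q)}"
proof -
  obtain lo hi where V: "V = {lo..hi}" using strong by (rule strong_interval_bounds)
  have fin: "finite (Vs ! k)" "Vs ! k \<noteq> {}" if "k < length Vs" for k
    using strong_interval_finite[OF child_strong[OF child_nth[OF that]]] by auto
  have MP: "Min (Vs ! p) \<in> Vs ! p" and MQ: "Max (Vs ! q) \<in> Vs ! q"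
    using fin[of p] fin[of q] assms by (auto intro: Min_in Max_in)
  have lo: "lo \<le> Min (Vs ! p)" and hi: "Max (Vs ! q) \<le> hi"
    using MP MQ child_nth_subset[of p] child_nth_subset[of q] assms V by auto
  show ?thesis
  proof (intro set_eqI iffI)
    fix x assume "x \<in> cons_union Vs p q"
    then obtain k where k: "p \<le> k" "k \<le> q" "x \<in> Vs ! k" using mem_cons_union[OF assms(2)] by blast
    have "Min (Vs ! p) \<le> x"
      using child_nth_less[of p k _ x] child_nth_bounds[of k x] MP k assms by (cases "p = k") (auto intro: less_imp_le)
    moreover have "x \<le> Max (Vs ! q)"
      using child_nth_less[of k q x] child_nth_bounds[of k x] MQ k assms by (cases "q = k") (auto intro: less_imp_le)
    ultimately show "x \<in> {Min (Vs ! p)..Max (Vs ! q)}" by simp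
  next
    fix x assume x: "x \<in> {Min (Vs ! p)..Max (Vs ! q)}"
    then have "x \<in> V" using V lo hi by auto
    then obtain k where k: "k < length Vs" "x \<in> Vs ! k" using in_child_nth by blast
    have "p \<le> k"
    proof (rule ccontr)
      assume "\<not> p \<le> k"
      then have "x < Min (Vs ! p)" using child_nth_less[of k p x] MP k assms by auto
      with x show False by simp
    qed
    moreover have "k \<le> q"
    proof (rule ccontr)
      assume "\<not> k \<le> q"
      then have "Max (Vs ! q) < x" using child_nth_less[of q k _ x] MQ k assms by auto
      with x show False by simp
    qed
    ultimately show "x \<in> cons_union Vs p q" using mem_cons_union[OF assms(2)] k by blast
  qed
qed

lemma cons_union_all: "cons_union Vs 0 (length Vs - 1) = V"
proof -
  have L: "length Vs - 1 < length Vs" using length_children by linarith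
  show ?thesis
  proof (intro set_eqI iffI)
    fix x assume "x \<in> cons_union Vs 0 (length Vs - 1)"
    then obtain k where k: "k \<le> length Vs - 1" "x \<in> Vs ! k"
      using mem_cons_union[OF L, of x 0] by blast
    then have "Vs ! k \<subset> V" using L by (intro child_nth_subset) linarith
    then show "x \<in> V" using k(2) by blast
  next
    fix x assume "x \<in> V"
    then obtain i where "i < length Vs" "x \<in> Vs ! i" using in_child_nth by blast
    moreover from this have "i \<le> length Vs - 1" by linarith
    ultimately show "x \<in> cons_union Vs 0 (length Vs - 1)"
      using mem_cons_union[OF L, of x 0] by blast
  qed
qed

lemma child_ci: "i < length Vs \<Longrightarrow> common_interval \<sigma> (Vs ! i)"
  using child_strong[OF child_nth] by (simp add: strong_interval_def)

lemma boundary: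
  assumes "Suc i < length Vs"
  shows "Min (Vs ! Suc i) = Suc (Max (Vs ! i))"
proof -
  have fin: "finite (Vs ! k)" "Vs ! k \<noteq> {}" if "k < length Vs" for k
    using strong_interval_finite[OF child_strong[OF child_nth[OF that]]] by auto
  have MP: "Max (Vs ! i) \<in> Vs ! i" and MQ: "Min (Vs ! Suc i) \<in> Vs ! Suc i"
    using fin[of i] fin[of "Suc i"] assms by (auto intro: Min_in Max_in)
  have lt: "Max (Vs ! i) < Min (Vs ! Suc i)" using child_nth_less[of i "Suc i"] MP MQ assms by simp
  have "Min (Vs ! i) \<le> Max (Vs ! i)" using fin[of i] assms by simp
  moreover have "Min (Vs ! Suc i) \<le> Max (Vs ! Suc i)" using fin[of "Suc i"] assms by simp
  ultimately have "Suc (Max (Vs ! i)) \<in> cons_union Vs i (Suc i)"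
    using lt assms by (subst cons_union_eq) auto
  then obtain k where "k = i \<or> k = Suc i" "Suc (Max (Vs ! i)) \<in> Vs ! k"
    using mem_cons_union[of "Suc i" Vs _ i] assms le_Suc_eq by (metis le_antisym)
  then show ?thesis using child_nth_bounds[of k "Suc (Max (Vs ! i))"] lt assms by auto
qed


lemma child_nth_finite: "i < length Vs \<Longrightarrow> finite (Vs ! i) \<and> Vs ! i \<noteq> {}"
  using strong_interval_finite[OF child_strong[OF child_nth]] .

lemma first_child_finite: "finite (Vs ! 0) \<and> Vs ! 0 \<noteq> {}"
  using length_children by (intro child_nth_finite) linarith

lemma child_unique:
  assumes "C \<in> children \<sigma> V" "i < length Vs" "x \<in> C" "x \<in> Vs ! i"
  shows "C = Vs ! i"
  using children_disjoint[OF assms(1) child_nth[OF assms(2)]] assms(3,4) by blast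

context
  fixes lo hi :: nat
  assumes V: "V = {lo..hi}"
begin

lemma lo_le_hi: "lo \<le> hi"
  using strong_interval_finite[OF strong] V by simp

lemma Min_first: "Min (Vs ! 0) = lo" and Max_last: "Max (Vs ! (length Vs - 1)) = hi"
proof -
  have L: "0 \<le> length Vs - 1" "length Vs - 1 < length Vs" using length_children by linarith+
  have "{Min (Vs ! 0)..Max (Vs ! (length Vs - 1))} = {lo..hi}"
    using cons_union_eq[OF L] cons_union_all V by simp
  then show "Min (Vs ! 0) = lo" "Max (Vs ! (length Vs - 1)) = hi"
    using lo_le_hi by (simp_all add: Icc_eq_Icc)
qed

lemma boundary_in: "i < length Vs \<Longrightarrow> lo \<le> Min (Vs ! i) \<and> Max (Vs ! i) \<le> hi"
  using child_nth_subset[of i] V child_nth_finite[of i] by (auto dest: Min_in Max_in)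

lemma boundary_cut:
  assumes c0: "cut \<sigma> s lo hi c0" and i: "Suc i < length Vs"
  shows "cut \<sigma> s lo hi (Min (Vs ! Suc i))"
proof (rule ccontr)
  let ?c = "Min (Vs ! Suc i)"
  assume no: "\<not> cut \<sigma> s lo hi ?c"
  have c: "?c = Suc (Max (Vs ! i))" using boundary[OF i] .
  have m: "Max (Vs ! i) \<in> Vs ! i" "?c \<in> Vs ! Suc i"
    using child_nth_finite[of i] child_nth_finite[of "Suc i"] i by auto
  have mV: "lo < ?c" "?c \<le> hi"
    using m child_nth_subset[of i] child_nth_subset[of "Suc i"] i V c by auto
  define P where "P = {p. (p = lo \<or> cut \<sigma> s lo hi p) \<and> p \<le> ?c}"
  define Q where "Q = {q. (q = Suc hi \<or> cut \<sigma> s lo hi q) \<and> ?c \<le> q}"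
  have P: "finite P" "lo \<in> P" using mV unfolding P_def by auto
  have "Q \<subseteq> {..Suc hi}" unfolding Q_def by (auto simp: cut_def)
  then have Q: "finite Q" "Suc hi \<in> Q"
    using mV by (auto intro: finite_subset simp: Q_def)
  define p where "p = Max P"
  define q where "q = Min Q"
  have pP: "p \<in> P" and qQ: "q \<in> Q"
    unfolding p_def q_def using P Q by (auto intro!: Max_in Min_in)
  have p: "p = lo \<or> cut \<sigma> s lo hi p" "p \<le> ?c" using pP unfolding P_def by auto
  have q: "q = Suc hi \<or> cut \<sigma> s lo hi q" "?c \<le> q" using qQ unfolding Q_def by auto
  have pc: "p < ?c" using p no mV by (metis le_neq_implies_less less_irrefl)
  have qc: "?c < q" using q no mV by (metis le_neq_implies_less not_less_eq_eq)
  have nocut: "\<not> cut \<sigma> s lo hi x" if "p < x" "x < q" for x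
  proof
    assume x: "cut \<sigma> s lo hi x"
    show False
    proof (cases "x \<le> ?c")
      case True
      then have "x \<in> P" using x by (simp add: P_def)
      then have "x \<le> p" unfolding p_def using P by simp
      with that show False by simp
    next
      case False
      then have "x \<in> Q" using x by (simp add: Q_def)
      then have "q \<le> x" unfolding q_def using Q by simp
      with that show False by simp
    qed
  qed
  have "strong_interval \<sigma> {p..<q}"
    using block_strong[OF strong[unfolded V] p(1) q(1) _ nocut] pc qc by simp
  moreover have "{p..<q} \<subset> V"
  proof -
    have "lo \<le> p" "q \<le> Suc hi" using p q by (auto simp: cut_def)
    moreover have "lo < p \<or> q \<le> hi"
    proof (cases "c0 \<le> ?c")
      case True
      then have "c0 \<in> P" using c0 by (simp add: P_def)
      then have "c0 \<le> p" unfolding p_def using P by simp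
      with c0 show ?thesis by (auto simp: cut_def)
    next
      case False
      then have "c0 \<in> Q" using c0 by (simp add: Q_def)
      then have "q \<le> c0" unfolding q_def using Q by simp
      with c0 show ?thesis by (auto simp: cut_def)
    qed
    ultimately have "{p..<q} \<subseteq> {lo..hi}" "lo \<notin> {p..<q} \<or> hi \<notin> {p..<q}" by auto
    moreover have "lo \<in> {lo..hi}" "hi \<in> {lo..hi}" using lo_le_hi by auto
    ultimately show ?thesis unfolding V by blast
  qed
  ultimately have "\<exists>C\<in>children \<sigma> V. {p..<q} \<subseteq> C" by (rule strong_in_child)
  then obtain C where C: "C \<in> children \<sigma> V" "{p..<q} \<subseteq> C" ..
  have "Max (Vs ! i) \<in> {p..<q}" "?c \<in> {p..<q}" using pc qc c by auto
  then have "Max (Vs ! i) \<in> C" "?c \<in> C" using C(2) by blast+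
  then have "C = Vs ! i" "C = Vs ! Suc i"
    using child_unique[OF C(1), of i "Max (Vs ! i)"] child_unique[OF C(1), of "Suc i" ?c] m i by simp_all
  then have "?c < ?c" using child_nth_less[of i "Suc i" ?c ?c] m i by simp
  then show False by simp
qed

lemma cut_linear:
  assumes c0: "cut \<sigma> s lo hi c0"
  shows "linear_node \<sigma> Vs" "node_sign \<sigma> Vs s"
proof -
  have "common_interval \<sigma> (cons_union Vs p q)" if pq: "p \<le> q" "q < length Vs" for p q
  proof -
    have "Min (Vs ! p) = lo \<or> cut \<sigma> s lo hi (Min (Vs ! p))"
      using boundary_cut[OF c0, of "p - 1"] Min_first pq by (cases p) auto
    moreover have "Suc (Max (Vs ! q)) = Suc hi \<or> cut \<sigma> s lo hi (Suc (Max (Vs ! q)))"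
    proof (cases "Suc q < length Vs")
      case True
      then show ?thesis using boundary_cut[OF c0 True] boundary[OF True] by simp
    next
      case False
      then have "q = length Vs - 1" using pq by simp
      then show ?thesis using Max_last by simp
    qed
    moreover have "common_interval \<sigma> {lo..hi}" using strong V by (simp add: strong_interval_def)
    moreover have "Min (Vs ! p) < Suc (Max (Vs ! q))"
    proof (cases "p = q")
      case True
      then show ?thesis
        using child_nth_bounds(1)[of q "Max (Vs ! q)"] child_nth_finite[of q] pq by (simp add: less_Suc_eq_le)
    next
      case False
      then show ?thesis
        using child_nth_less[of p q "Min (Vs ! p)" "Max (Vs ! q)"] pq child_nth_finite[of p]
          child_nth_finite[of q] by auto
    qed
    ultimately have "common_interval \<sigma> {Min (Vs ! p)..<Suc (Max (Vs ! q))}"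
      using segment_common_interval by blast
    then show ?thesis using cons_union_eq[OF pq] by (simp add: atLeastLessThanSuc_atLeastAtMost)
  qed
  then show "linear_node \<sigma> Vs" unfolding linear_node_def by simp
  show "node_sign \<sigma> Vs s" unfolding node_sign_def
  proof (intro allI impI)
    fix i assume i: "Suc i < length Vs"
    have o: "ordered s (\<sigma> ! x) (\<sigma> ! y)" if "x \<in> Vs ! i" "y \<in> Vs ! Suc i" for x y
    proof -
      have "Max (Vs ! i) < Min (Vs ! Suc i)" using boundary[OF i] by simp
      then have "x \<in> {lo..<Min (Vs ! Suc i)}" "y \<in> {Min (Vs ! Suc i)..hi}"
        using that child_nth_bounds[of i x] child_nth_bounds[of "Suc i" y] i
          boundary_in[of i] boundary_in[of "Suc i"] by auto
      then show ?thesis using boundary_cut[OF c0 i] unfolding cut_def by blast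
    qed
    have f: "finite (vals \<sigma> (Vs ! i))" "vals \<sigma> (Vs ! i) \<noteq> {}"
      "finite (vals \<sigma> (Vs ! Suc i))" "vals \<sigma> (Vs ! Suc i) \<noteq> {}"
      using child_nth_finite[of i] child_nth_finite[of "Suc i"] i by (auto simp: vals_def)
    have m: "Max (vals \<sigma> (Vs ! i)) \<in> (!) \<sigma> ` (Vs ! i)" "Min (vals \<sigma> (Vs ! i)) \<in> (!) \<sigma> ` (Vs ! i)"
      "Max (vals \<sigma> (Vs ! Suc i)) \<in> (!) \<sigma> ` (Vs ! Suc i)" "Min (vals \<sigma> (Vs ! Suc i)) \<in> (!) \<sigma> ` (Vs ! Suc i)"
      using Max_in[OF f(1,2)] Min_in[OF f(1,2)] Max_in[OF f(3,4)] Min_in[OF f(3,4)]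
      unfolding vals_def by blast+
    show "if s then Max (vals \<sigma> (Vs ! i)) < Min (vals \<sigma> (Vs ! Suc i))
        else Max (vals \<sigma> (Vs ! Suc i)) < Min (vals \<sigma> (Vs ! i))"
    proof (cases s)
      case True
      obtain x y where "x \<in> Vs ! i" "y \<in> Vs ! Suc i"
        "Max (vals \<sigma> (Vs ! i)) = \<sigma> ! x" "Min (vals \<sigma> (Vs ! Suc i)) = \<sigma> ! y"
        using m(1,4) by (elim imageE)
      then show ?thesis using o True by (simp add: ordered_def)
    next
      case False
      obtain x y where "x \<in> Vs ! i" "y \<in> Vs ! Suc i"
        "Min (vals \<sigma> (Vs ! i)) = \<sigma> ! x" "Max (vals \<sigma> (Vs ! Suc i)) = \<sigma> ! y"
        using m(2,3) by (elim imageE)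
      then show ?thesis using o False by (simp add: ordered_def)
    qed
  qed
qed

lemma cut_of_split:
  assumes X: "common_interval \<sigma> X" and Y: "common_interval \<sigma> Y"
    and XY: "X \<union> Y = V" "X \<inter> Y = {}" and lo: "lo \<in> X"
  shows "\<exists>s c. cut \<sigma> s lo hi c"
proof -
  obtain a b where ab: "X = {a..b}" "a \<le> b" using X by (rule common_interval_bounds)
  obtain c d where cd: "Y = {c..d}" "c \<le> d" using Y by (rule common_interval_bounds)
  have "a \<in> V" "c \<in> V" "c \<notin> X" using ab cd XY by auto
  then have "a = lo" and bc: "b < c" "c \<le> hi" using ab cd lo V by auto
  have Xe: "X = {lo..<Suc b}" using ab \<open>a = lo\<close> by auto
  have Ye: "Y = {Suc b..hi}"
  proof -
    have "Y = {lo..hi} - X" using XY V by blast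
    then show ?thesis using ab \<open>a = lo\<close> bc by auto
  qed
  from common_interval_disjoint_separated[OF X Y XY(2)] show ?thesis
    unfolding separated_def
  proof
    assume "\<forall>i\<in>X. \<forall>j\<in>Y. \<sigma> ! i < \<sigma> ! j"
    then have "cut \<sigma> True lo hi (Suc b)"
      using bc ab(2) \<open>a = lo\<close> unfolding cut_def Xe Ye ordered_def by simp
    then show ?thesis by blast
  next
    assume "\<forall>i\<in>X. \<forall>j\<in>Y. \<sigma> ! j < \<sigma> ! i"
    then have "cut \<sigma> False lo hi (Suc b)"
      using bc ab(2) \<open>a = lo\<close> unfolding cut_def Xe Ye ordered_def by simp
    then show ?thesis by blast
  qed
qed

lemma cut_of_split':
  assumes "common_interval \<sigma> X" "common_interval \<sigma> Y" "X \<union> Y = V" "X \<inter> Y = {}"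
  shows "\<exists>s c. cut \<sigma> s lo hi c"
proof (cases "lo \<in> X")
  case True
  then show ?thesis using cut_of_split assms by blast
next
  case False
  have "lo \<in> V" using V lo_le_hi by simp
  with False have "lo \<in> Y" using assms(3) by blast
  moreover have "Y \<union> X = V" "Y \<inter> X = {}" using assms(3,4) by blast+
  ultimately show ?thesis using cut_of_split[OF assms(2,1)] by blast
qed

lemma no_cut_prime:
  assumes no: "\<nexists>s c. cut \<sigma> s lo hi c"
  shows "prime_node \<sigma> Vs"
proof -
  have "length Vs \<noteq> 2"
  proof
    assume l: "length Vs = 2"
    have "cons_union Vs 0 1 = Vs ! 0 \<union> Vs ! 1"
      using mem_cons_union[of 1 Vs _ 0] l by (auto simp: le_Suc_eq)
    then have "Vs ! 0 \<union> Vs ! 1 = V" using cons_union_all l by simp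
    moreover have "Vs ! 0 \<inter> Vs ! 1 = {}" using child_nth_less[of 0 1] l by fastforce
    ultimately show False using cut_of_split'[of "Vs ! 0" "Vs ! 1"] child_ci l no by simp
  qed
  moreover have False
    if pq: "p < q" "q < length Vs" "(p, q) \<noteq> (0, length Vs - 1)"
      and ci: "common_interval \<sigma> (cons_union Vs p q)" for p q
  proof -
    define F where "F = {U. common_interval \<sigma> U \<and> U \<subset> V \<and> (\<forall>C\<in>children \<sigma> V. \<not> U \<subseteq> C)}"
    have "F \<subseteq> Pow V" by (auto simp: F_def)
    then have finF: "finite F" using V by (auto intro: finite_subset)
    let ?U = "cons_union Vs p q"
    have Ue: "?U = {Min (Vs ! p)..Max (Vs ! q)}" using cons_union_eq pq by simp
    have fp: "Min (Vs ! p) \<in> Vs ! p" "Max (Vs ! q) \<in> Vs ! q"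
      using child_nth_finite[of p] child_nth_finite[of q] pq by auto
    have lt: "Min (Vs ! p) < Max (Vs ! q)" using child_nth_less[OF pq(1,2)] fp by blast
    have "?U \<subseteq> V" using boundary_in[of p] boundary_in[of q] pq Ue V by auto
    moreover have "?U \<noteq> V"
    proof
      assume "?U = V"
      then have eq: "Min (Vs ! p) = lo" "Max (Vs ! q) = hi"
        using Ue V lt by (simp_all add: Icc_eq_Icc)
      have "p = 0"
      proof (rule ccontr)
        assume "p \<noteq> 0"
        moreover have "Min (Vs ! 0) \<in> Vs ! 0" using first_child_finite by (intro Min_in) auto
        ultimately have "Min (Vs ! 0) < Min (Vs ! p)"
          using child_nth_less[of 0 p "Min (Vs ! 0)" "Min (Vs ! p)"] fp pq by simp
        then show False using eq Min_first by simp
      qed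
      moreover have "q = length Vs - 1"
      proof (rule ccontr)
        assume "q \<noteq> length Vs - 1"
        moreover have "Max (Vs ! (length Vs - 1)) \<in> Vs ! (length Vs - 1)"
          using child_nth_finite[of "length Vs - 1"] pq by (intro Max_in) auto
        ultimately have "Max (Vs ! q) < Max (Vs ! (length Vs - 1))"
          using child_nth_less[of q "length Vs - 1" "Max (Vs ! q)" "Max (Vs ! (length Vs - 1))"] fp pq
          by simp
        then show False using eq Max_last by simp
      qed
      ultimately show False using pq by simp
    qed
    moreover have "\<not> ?U \<subseteq> C" if C: "C \<in> children \<sigma> V" for C
    proof
      assume "?U \<subseteq> C"
      moreover have "Min (Vs ! p) \<in> ?U" "Max (Vs ! q) \<in> ?U" using Ue lt by auto
      ultimately have "C = Vs ! p" "C = Vs ! q"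
        using child_unique[OF C, of p "Min (Vs ! p)"] child_unique[OF C, of q "Max (Vs ! q)"] fp pq by auto
      then show False using child_nth_less[OF pq(1,2), of "Min (Vs ! p)" "Min (Vs ! p)"] fp by simp
    qed
    ultimately have "?U \<in> F" using ci by (auto simp: F_def)
    then have "\<exists>U\<in>F. \<forall>W\<in>F. U \<subseteq> W \<longrightarrow> U = W" using finF by (intro finite_has_maximal) auto
    then obtain U where UF: "U \<in> F" and max: "\<forall>W\<in>F. U \<subseteq> W \<longrightarrow> U = W" ..
    from UF have U: "common_interval \<sigma> U" "U \<subset> V" "\<forall>C\<in>children \<sigma> V. \<not> U \<subseteq> C"
      by (auto simp: F_def)
    have "\<not> strong_interval \<sigma> U" using strong_in_child[OF _ U(2)] U(3) by (metis (no_types))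
    then obtain J where J: "common_interval \<sigma> J" "overlap U J"
      using U(1) unfolding strong_interval_def by metis
    have "\<not> overlap V J" using strong J(1) unfolding strong_interval_def by metis
    then have "J \<subseteq> V" using J(2) U(2) unfolding overlap_def by auto
    have UJ: "common_interval \<sigma> (U \<union> J)"
      using common_interval_Un[OF U(1) J(1)] J(2) by (simp add: overlap_def)
    have "U \<union> J = V"
    proof (rule ccontr)
      assume "U \<union> J \<noteq> V"
      then have "U \<union> J \<subset> V" using U(2) \<open>J \<subseteq> V\<close> by auto
      then have "U \<union> J \<in> F" using UJ U(3) by (simp add: F_def)
      then have "U = U \<union> J" using max by (metis Un_upper1)
      then show False using J(2) unfolding overlap_def by auto
    qed
    then have "U \<union> (J - U) = V" "U \<inter> (J - U) = {}" by auto
    then show False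
      using cut_of_split'[OF U(1) common_interval_Diff[OF U(1) J]] no by simp
  qed
  ultimately show ?thesis unfolding prime_node_def by metis
qed

end

lemma linear_or_prime: "(\<exists>s. linear_node \<sigma> Vs \<and> node_sign \<sigma> Vs s) \<or> prime_node \<sigma> Vs"
proof -
  obtain lo hi where V: "V = {lo..hi}" using strong by (rule strong_interval_bounds)
  show ?thesis
  proof (cases "\<exists>s c. cut \<sigma> s lo hi c")
    case True
    then show ?thesis using cut_linear[OF V] by metis
  next
    case False
    then show ?thesis using no_cut_prime[OF V] by metis
  qed
qed

end

lemma exp_tree_exists: "strong_interval \<sigma> V \<Longrightarrow> \<exists>t. exp_tree \<sigma> V t"
proof (induction "card V" arbitrary: V rule: less_induct)
  case less
  obtain lo hi where V: "V = {lo..hi}" "lo \<le> hi" "hi < length \<sigma>"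
    using less.prems by (rule strong_interval_bounds)
  show ?case
  proof (cases "lo = hi")
    case True
    then have "V = {lo}" using V by simp
    moreover have "exp_tree \<sigma> {lo} (ELeaf (\<sigma> ! lo))" using V by (intro exp_tree.leaf) simp
    ultimately show ?thesis by metis
  next
    case False
    then have card: "card V \<ge> 2" using V by simp
    obtain Vs where cl: "children_list \<sigma> V Vs" using children_list_exists by metis
    have "\<forall>i<length Vs. \<exists>t. exp_tree \<sigma> (Vs ! i) t"
    proof (intro allI impI)
      fix i assume i: "i < length Vs"
      have "Vs ! i \<subset> V" using child_nth_subset[OF less.prems card cl i] .
      then have "card (Vs ! i) < card V" using V by (intro psubset_card_mono) auto
      then show "\<exists>t. exp_tree \<sigma> (Vs ! i) t"
        using less.hyps child_strong[OF child_nth[OF less.prems card cl i]] by metis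
    qed
    then obtain f where f: "\<forall>i<length Vs. exp_tree \<sigma> (Vs ! i) (f i)" by metis
    let ?ts = "map f [0..<length Vs]"
    have ts: "length ?ts = length Vs" "\<forall>i<length Vs. exp_tree \<sigma> (Vs ! i) (?ts ! i)"
      using f by simp_all
    from linear_or_prime[OF less.prems card cl] show ?thesis
      using exp_tree.lin[OF less.prems card cl _ _ ts] exp_tree.prime[OF less.prems card cl _ ts]
      by metis
  qed
qed

lemma primes_below_foldl:
  "primes_below d (foldl (\<lambda>a b. ELin s a b) t ts) \<longleftrightarrow>
    primes_below d t \<and> (\<forall>u\<in>set ts. primes_below d u)"
  by (induction ts arbitrary: t) auto

lemma exp_tree_decomposable:
  assumes D: "D \<ge> 2" "d \<le> int D"
  shows "exp_tree \<sigma> V t \<Longrightarrow> primes_below d t \<Longrightarrow> decomposable D \<sigma> V"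
proof (induction rule: exp_tree.induct)
  case (leaf i)
  then show ?case by (simp add: decomposable.point)
next
  case (lin V Vs s ts)
  note cl = lin.hyps(1,2,3)
  have len: "length Vs \<ge> 2" using length_children[OF cl] .
  then obtain t ts' where ts: "ts = t # ts'" using lin.hyps(6) by (cases ts) auto
  have all: "\<forall>u\<in>set ts. primes_below d u"
    using lin.prems by (simp add: ts primes_below_foldl)
  have dec: "decomposable D \<sigma> (Vs ! i)" if "i < length Vs" for i
  proof -
    have "ts ! i \<in> set ts" using that lin.hyps(6) by simp
    then show ?thesis using lin.IH that all by blast
  qed
  have "decomposable D \<sigma> (cons_union Vs 0 k)" if "k < length Vs" for k
    using that
  proof (induction k)
    case 0
    have "cons_union Vs 0 0 = Vs ! 0" using mem_cons_union[of 0 Vs _ 0] 0 by auto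
    then show ?case using dec[OF 0] by simp
  next
    case (Suc k)
    let ?A = "cons_union Vs 0 k" and ?B = "Vs ! Suc k"
    have mA: "x \<in> ?A \<longleftrightarrow> (\<exists>i\<le>k. x \<in> Vs ! i)" for x
      using mem_cons_union[of k Vs x 0] Suc.prems by auto
    have U: "cons_union Vs 0 (Suc k) = ?A \<union> ?B"
      using mem_cons_union[of "Suc k" Vs _ 0] Suc.prems mA by (auto simp: le_Suc_eq)
    have lt: "x < y" if "x \<in> ?A" "y \<in> ?B" for x y
    proof -
      obtain i where "i \<le> k" "x \<in> Vs ! i" using mA \<open>x \<in> ?A\<close> by blast
      then show ?thesis using child_nth_less[OF cl, of i "Suc k" x y] Suc.prems that by simp
    qed
    have disj: "?A \<inter> ?B = {}" using lt by fastforce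
    have ne: "?B \<noteq> {}" "Vs ! 0 \<noteq> {}"
      using child_nth_finite[OF cl Suc.prems] first_child_finite[OF cl] by auto
    have "common_interval \<sigma> ?A"
    proof (cases "length Vs = 2")
      case True
      then have "k = 0" using Suc.prems by simp
      then have "?A = Vs ! 0" using mA by auto
      moreover have "0 < length Vs" using len by linarith
      ultimately show ?thesis using child_ci[OF cl, of 0] by simp
    next
      case False
      then show ?thesis using lin.hyps(4) Suc.prems unfolding linear_node_def by auto
    qed
    then have sep: "separated \<sigma> ?A ?B"
      using common_interval_disjoint_separated[OF _ child_ci[OF cl Suc.prems] disj] by simp
    show ?case
    proof (rule decomposable.split)
      show "length [?A, ?B] \<le> D" using D by simp
      show "cons_union Vs 0 (Suc k) = \<Union>(set [?A, ?B])" using U by simp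
      have "?A \<noteq> {}" using mA ne by blast
      then have "?A \<subset> ?A \<union> ?B" "?B \<subset> ?A \<union> ?B" using ne disj by blast+
      then show "\<forall>W\<in>set [?A, ?B]. W \<subset> cons_union Vs 0 (Suc k) \<and> decomposable D \<sigma> W"
        using U Suc.IH Suc.prems dec by simp
      show "sorted_wrt (\<lambda>A B. (\<forall>i\<in>A. \<forall>j\<in>B. i < j) \<and> separated \<sigma> A B) [?A, ?B]"
        using lt sep by simp
    qed
  qed
  from this[of "length Vs - 1"] show ?case using cons_union_all[OF cl] len by simp
next
  case (prime V Vs ts)
  note cl = prime.hyps(1,2,3)
  have dec: "decomposable D \<sigma> (Vs ! i)" if "i < length Vs" for i
  proof -
    have "ts ! i \<in> set ts" using that prime.hyps(5) by simp
    then show ?thesis using prime.IH that prime.prems by simp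
  qed
  show ?case
  proof (rule decomposable.split)
    show "length Vs \<le> D" using prime.prems prime.hyps(5) D by simp
    show "V = \<Union>(set Vs)"
    proof
      show "V \<subseteq> \<Union>(set Vs)" using in_child_nth[OF cl] by (meson UnionI nth_mem subsetI)
      show "\<Union>(set Vs) \<subseteq> V" using child_nth_subset[OF cl] by (metis Union_least in_set_conv_nth psubset_imp_subset)
    qed
    show "\<forall>W\<in>set Vs. W \<subset> V \<and> decomposable D \<sigma> W"
      using child_nth_subset[OF cl] dec by (metis in_set_conv_nth)
    show "sorted_wrt (\<lambda>A B. (\<forall>i\<in>A. \<forall>j\<in>B. i < j) \<and> separated \<sigma> A B) Vs"
      unfolding sorted_wrt_iff_nth_less
    proof (intro allI impI conjI)
      fix i j assume ij: "i < j" "j < length Vs"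
      show lt: "\<forall>x\<in>Vs ! i. \<forall>y\<in>Vs ! j. x < y" using child_nth_less[OF cl ij] by simp
      then have "Vs ! i \<inter> Vs ! j = {}" by fastforce
      then show "separated \<sigma> (Vs ! i) (Vs ! j)"
        using common_interval_disjoint_separated child_ci[OF cl] ij by simp
    qed
  qed
qed

lemma root_strong:
  assumes "\<sigma> \<noteq> []"
  shows "strong_interval \<sigma> {0..<length \<sigma>}"
proof -
  have "common_interval \<sigma> {0..<length \<sigma>}"
    using assms by (intro common_intervalI[of _ 0 "length \<sigma> - 1"])
      (auto simp: atLeastLessThanSuc_atLeastAtMost[symmetric])
  moreover have "\<not> overlap {0..<length \<sigma>} J" if "common_interval \<sigma> J" for J
    using common_interval_lt[OF that] by (auto simp: overlap_def)
  ultimately show ?thesis by (simp add: strong_interval_def)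
qed

end

lemma class_R_decomposable:
  assumes "class_R d \<sigma>" "\<sigma> \<noteq> []" "D \<ge> 2" "d \<le> int D"
  shows "decomposable D \<sigma> {0..<length \<sigma>}"
proof -
  have perm: "is_perm \<sigma>" using assms(1) by (simp add: class_R_def)
  obtain t where t: "exp_tree \<sigma> {0..<length \<sigma>} t"
    using exp_tree_exists[OF perm root_strong[OF perm assms(2)]] ..
  moreover have "primes_below d t" using assms(1) t by (simp add: class_R_def)
  ultimately show ?thesis by (rule exp_tree_decomposable[OF perm assms(3,4)])
qed

section \<open>Common patterns as boxes in both permutations\<close>

text \<open>A match is a list of pairs (position in sigma, position in tau) witnessing a common
  pattern. A key \<open>[l, r, a, b, l', r', c, d]\<close> describes the box of positions \<open>l..<r\<close> and values
  \<open>a..<b\<close> of sigma together with the box of positions \<open>l'..<r'\<close> and values \<open>c..<d\<close> of tau.\<close>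

definition match :: "nat list \<Rightarrow> nat list \<Rightarrow> (nat \<times> nat) list \<Rightarrow> bool" where
  "match \<sigma> \<tau> ps \<longleftrightarrow>
    sorted_wrt (\<lambda>p q. fst p < fst q \<and> snd p < snd q \<and>
      (\<sigma> ! fst p < \<sigma> ! fst q \<longleftrightarrow> \<tau> ! snd p < \<tau> ! snd q)) ps \<and>
    (\<forall>p\<in>set ps. fst p < length \<sigma> \<and> snd p < length \<tau>)"

definition in_box :: "nat list \<Rightarrow> nat list \<Rightarrow> nat list \<Rightarrow> nat \<times> nat \<Rightarrow> bool" where
  "in_box \<sigma> \<tau> K p \<longleftrightarrow> K ! 0 \<le> fst p \<and> fst p < K ! 1 \<and> K ! 2 \<le> \<sigma> ! fst p \<and> \<sigma> ! fst p < K ! 3 \<and>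
    K ! 4 \<le> snd p \<and> snd p < K ! 5 \<and> K ! 6 \<le> \<tau> ! snd p \<and> \<tau> ! snd p < K ! 7"

definition valid :: "nat list \<Rightarrow> nat list \<Rightarrow> nat list \<Rightarrow> nat list \<Rightarrow> bool" where
  "valid \<sigma> \<tau> K xs \<longleftrightarrow>
    (\<exists>ps. match \<sigma> \<tau> ps \<and> (\<forall>p\<in>set ps. in_box \<sigma> \<tau> K p) \<and> xs = map (\<lambda>p. \<sigma> ! fst p) ps)"

definition contains :: "nat list \<Rightarrow> nat list \<Rightarrow> bool" where
  "contains K L \<longleftrightarrow> K ! 0 \<le> L ! 0 \<and> L ! 1 \<le> K ! 1 \<and> K ! 2 \<le> L ! 2 \<and> L ! 3 \<le> K ! 3 \<and>
    K ! 4 \<le> L ! 4 \<and> L ! 5 \<le> K ! 5 \<and> K ! 6 \<le> L ! 6 \<and> L ! 7 \<le> K ! 7"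

definition compat :: "nat list \<Rightarrow> nat list \<Rightarrow> bool" where
  "compat K L \<longleftrightarrow> K ! 1 \<le> L ! 0 \<and> K ! 5 \<le> L ! 4 \<and>
    (K ! 3 \<le> L ! 2 \<and> K ! 7 \<le> L ! 6 \<or> L ! 3 \<le> K ! 2 \<and> L ! 7 \<le> K ! 6)"

lemma valid_Nil: "valid \<sigma> \<tau> K []"
  unfolding valid_def match_def by (intro exI[of _ "[]"]) simp

lemma sorted_wrt_concat:
  assumes "sorted_wrt (\<lambda>xs ys. \<forall>x\<in>set xs. \<forall>y\<in>set ys. R x y) xss" "\<forall>xs\<in>set xss. sorted_wrt R xs"
  shows "sorted_wrt R (concat xss)"
  using assms by (induction xss) (auto simp: sorted_wrt_append)

lemma valid_concat:
  assumes len: "length xss = length Ks"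
    and v: "\<And>i. i < length Ks \<Longrightarrow> valid \<sigma> \<tau> (Ks ! i) (xss ! i)"
    and c: "\<And>L. L \<in> set Ks \<Longrightarrow> contains K L" and s: "sorted_wrt compat Ks"
  shows "valid \<sigma> \<tau> K (concat xss)"
proof -
  let ?R = "\<lambda>p q. fst p < fst q \<and> snd p < snd q \<and> (\<sigma> ! fst p < \<sigma> ! fst q \<longleftrightarrow> \<tau> ! snd p < \<tau> ! snd q)"
  obtain f where f: "\<And>i. i < length Ks \<Longrightarrow> match \<sigma> \<tau> (f i)"
    "\<And>i. i < length Ks \<Longrightarrow> (\<forall>p\<in>set (f i). in_box \<sigma> \<tau> (Ks ! i) p)"
    "\<And>i. i < length Ks \<Longrightarrow> xss ! i = map (\<lambda>p. \<sigma> ! fst p) (f i)"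
    using v unfolding valid_def by metis
  define pss where "pss = map f [0..<length Ks]"
  have "?R p q" if "i < j" "j < length Ks" "p \<in> set (f i)" "q \<in> set (f j)" for i j p q
  proof -
    have b: "in_box \<sigma> \<tau> (Ks ! i) p" "in_box \<sigma> \<tau> (Ks ! j) q" using f(2)[of i] f(2)[of j] that by auto
    have "compat (Ks ! i) (Ks ! j)" using s that by (simp add: sorted_wrt_iff_nth_less)
    then show ?thesis using b unfolding compat_def in_box_def by linarith
  qed
  then have "sorted_wrt (\<lambda>xs ys. \<forall>x\<in>set xs. \<forall>y\<in>set ys. ?R x y) pss"
    unfolding sorted_wrt_iff_nth_less pss_def by auto
  then have "sorted_wrt ?R (concat pss)"
    using f(1) by (intro sorted_wrt_concat) (auto simp: pss_def match_def)
  moreover have "\<forall>p\<in>set (concat pss). fst p < length \<sigma> \<and> snd p < length \<tau>"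
    using f(1) by (auto simp: pss_def match_def)
  moreover have "\<forall>p\<in>set (concat pss). in_box \<sigma> \<tau> K p"
  proof
    fix p assume "p \<in> set (concat pss)"
    then obtain i where i: "i < length Ks" "p \<in> set (f i)" by (auto simp: pss_def)
    then have "in_box \<sigma> \<tau> (Ks ! i) p" "contains K (Ks ! i)" using f(2) c by auto
    then show "in_box \<sigma> \<tau> K p" unfolding in_box_def contains_def by linarith
  qed
  moreover have "concat xss = map (\<lambda>p. \<sigma> ! fst p) (concat pss)"
  proof -
    have "xss = map (map (\<lambda>p. \<sigma> ! fst p)) pss"
      using f(3) len by (intro nth_equalityI) (auto simp: pss_def)
    then show ?thesis by (simp add: map_concat)
  qed
  ultimately show ?thesis unfolding valid_def match_def by blast
qed

lemma match_distinct_fst: "match \<sigma> \<tau> ps \<Longrightarrow> distinct (map fst ps)"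
  unfolding match_def
  by (metis (mono_tags, lifting) sorted_wrt_map sorted_wrt_mono_rel strict_sorted_iff)

lemma match_length: "match \<sigma> \<tau> ps \<Longrightarrow> length ps \<le> length \<sigma>"
proof -
  assume m: "match \<sigma> \<tau> ps"
  have "length (map fst ps) = card (set (map fst ps))"
    using distinct_card[OF match_distinct_fst[OF m]] by simp
  also have "\<dots> \<le> card {..<length \<sigma>}" using m by (intro card_mono) (auto simp: match_def)
  finally show ?thesis by simp
qed

lemma valid_length: "valid \<sigma> \<tau> K xs \<Longrightarrow> length xs \<le> length \<sigma>"
  unfolding valid_def using match_length by fastforce

definition tight :: "nat list \<Rightarrow> nat list \<Rightarrow> (nat \<times> nat) list \<Rightarrow> nat list" where
  "tight \<sigma> \<tau> ps = concat (map (\<lambda>f. [Min (f ` set ps), Suc (Max (f ` set ps))])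
     [fst, \<lambda>p. \<sigma> ! fst p, snd, \<lambda>p. \<tau> ! snd p])"

lemma tight_nth:
  "tight \<sigma> \<tau> ps ! 0 = Min (fst ` set ps)"
  "tight \<sigma> \<tau> ps ! 1 = Suc (Max (fst ` set ps))"
  "tight \<sigma> \<tau> ps ! 2 = Min ((\<lambda>p. \<sigma> ! fst p) ` set ps)"
  "tight \<sigma> \<tau> ps ! 3 = Suc (Max ((\<lambda>p. \<sigma> ! fst p) ` set ps))"
  "tight \<sigma> \<tau> ps ! 4 = Min (snd ` set ps)"
  "tight \<sigma> \<tau> ps ! 5 = Suc (Max (snd ` set ps))"
  "tight \<sigma> \<tau> ps ! 6 = Min ((\<lambda>p. \<tau> ! snd p) ` set ps)"
  "tight \<sigma> \<tau> ps ! 7 = Suc (Max ((\<lambda>p. \<tau> ! snd p) ` set ps))"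
  by (simp_all add: tight_def eval_nat_numeral)

text \<open>The key of the empty box in the upper right corner of another one, used for padding.\<close>

definition corner :: "nat list \<Rightarrow> nat list" where
  "corner K = [K ! 1, K ! 1, K ! 3, K ! 3, K ! 5, K ! 5, K ! 7, K ! 7]"

lemma corner_nth:
  "corner K ! 0 = K ! 1" "corner K ! 1 = K ! 1" "corner K ! 2 = K ! 3" "corner K ! 3 = K ! 3"
  "corner K ! 4 = K ! 5" "corner K ! 5 = K ! 5" "corner K ! 6 = K ! 7" "corner K ! 7 = K ! 7"
  by (simp_all add: corner_def eval_nat_numeral)

lemma Suc_Max_le_Min:
  assumes "ps \<noteq> []" "qs \<noteq> []" "\<And>p q. p \<in> set ps \<Longrightarrow> q \<in> set qs \<Longrightarrow> (f p :: nat) < f q"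
  shows "Suc (Max (f ` set ps)) \<le> Min (f ` set qs)"
  using assms by (simp add: Suc_le_eq)

lemma Min_subset_le: "ps \<noteq> [] \<Longrightarrow> set ps \<subseteq> set qs \<Longrightarrow> (Min (f ` set qs) :: nat) \<le> Min (f ` set ps)"
  by (intro Min_antimono image_mono) auto

lemma Max_subset_le: "ps \<noteq> [] \<Longrightarrow> set ps \<subseteq> set qs \<Longrightarrow> (Max (f ` set ps) :: nat) \<le> Max (f ` set qs)"
  by (intro Max_mono image_mono) auto

lemma contains_tight:
  assumes "ps \<noteq> []" "set ps \<subseteq> set qs"
  shows "contains (tight \<sigma> \<tau> qs) (tight \<sigma> \<tau> ps)"
  unfolding contains_def tight_nth
  using Min_subset_le[OF assms] Max_subset_le[OF assms] by simp

lemma contains_corner: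
  assumes "ps \<noteq> []"
  shows "contains (tight \<sigma> \<tau> ps) (corner (tight \<sigma> \<tau> ps))"
proof -
  have "Min (f ` set ps) \<le> Suc (Max (f ` set ps))" for f :: "nat \<times> nat \<Rightarrow> nat"
  proof -
    have m: "f (hd ps) \<in> f ` set ps" using assms by simp
    show ?thesis using Min_le[OF _ m] Max_ge[OF _ m] by simp
  qed
  then show ?thesis unfolding contains_def corner_nth tight_nth by simp
qed

lemma compat_corner: "contains K L \<Longrightarrow> compat L (corner K)"
  unfolding contains_def compat_def corner_nth by simp

lemma compat_corner_self: "compat (corner K) (corner K)"
  unfolding compat_def corner_nth by simp

lemma contains_trans: "contains K L \<Longrightarrow> contains L M \<Longrightarrow> contains K M"
  unfolding contains_def by linarith

text \<open>What a round of the dynamic program achieves: \<open>recs\<close> is the finite set of records,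
  \<open>key\<close> their (constant) keys, and \<open>len r\<close> the lengths stored after \<open>r\<close> rounds.\<close>

locale rounds =
  fixes \<sigma> \<tau> :: "nat list" and D :: nat and recs :: "'a set" and key :: "'a \<Rightarrow> nat list"
    and len :: "nat \<Rightarrow> 'a \<Rightarrow> nat" and R :: nat
  assumes D: "1 \<le> D" and perm: "is_perm \<sigma>" "is_perm \<tau>"
    and mono: "\<And>r p. r < R \<Longrightarrow> p \<in> recs \<Longrightarrow> len r p \<le> len (Suc r) p"
    and update: "\<And>r p cs. r < R \<Longrightarrow> p \<in> recs \<Longrightarrow> set cs \<subseteq> recs \<Longrightarrow> length cs = D \<Longrightarrow>
      (\<forall>c\<in>set cs. contains (key p) (key c)) \<Longrightarrow> sorted_wrt compat (map key cs) \<Longrightarrow>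
      (\<Sum>c\<leftarrow>cs. len r c) \<le> len (Suc r) p"
    and keys: "\<And>K. length K = 8 \<Longrightarrow> set K \<subseteq> {..length \<sigma> + length \<tau> + 1} \<Longrightarrow> \<exists>p\<in>recs. key p = K"
    and units: "\<And>i j. i < length \<sigma> \<Longrightarrow> j < length \<tau> \<Longrightarrow>
      \<exists>p\<in>recs. key p = tight \<sigma> \<tau> [(i, j)] \<and> 1 \<le> len 0 p"
begin

lemma combine:
  assumes r: "r < R" and p: "p \<in> recs" and cs: "set cs \<subseteq> recs" "length cs \<le> D"
    and c: "\<forall>c\<in>set cs. contains (key p) (key c)" and s: "sorted_wrt compat (map key cs)"
    and e: "e \<in> recs" "contains (key p) (key e)" "compat (key e) (key e)"
      "\<forall>c\<in>set cs. compat (key c) (key e)"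
  shows "(\<Sum>c\<leftarrow>cs. len r c) \<le> len (Suc r) p"
proof -
  let ?cs = "cs @ replicate (D - length cs) e"
  have "sorted_wrt compat (replicate n (key e))" for n using e(3) by (induction n) auto
  then have "sorted_wrt compat (map key ?cs)"
    using s e(4) by (auto simp: sorted_wrt_append)
  moreover have "set ?cs \<subseteq> recs" "length ?cs = D" "\<forall>c\<in>set ?cs. contains (key p) (key c)"
    using cs c e by auto
  ultimately have "(\<Sum>c\<leftarrow>?cs. len r c) \<le> len (Suc r) p" by (intro update[OF r p])
  then show ?thesis by simp
qed

lemma perm_nth:
  "i < length \<sigma> \<Longrightarrow> \<sigma> ! i \<le> length \<sigma>" "j < length \<tau> \<Longrightarrow> \<tau> ! j \<le> length \<tau>"
  using perm nth_mem[of i \<sigma>] nth_mem[of j \<tau>] by (auto simp: is_perm_def)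

lemma tight_bounded:
  assumes "match \<sigma> \<tau> ps" "ps \<noteq> []"
  shows "set (tight \<sigma> \<tau> ps) \<subseteq> {..length \<sigma> + length \<tau> + 1}"
proof -
  have b: "fst p < length \<sigma>" "snd p < length \<tau>" "\<sigma> ! fst p \<le> length \<sigma>" "\<tau> ! snd p \<le> length \<tau>"
    if "p \<in> set ps" for p
    using assms that perm_nth by (auto simp: match_def)
  have "Min (f ` set ps) \<le> n \<and> Suc (Max (f ` set ps)) \<le> Suc n"
    if "\<And>p. p \<in> set ps \<Longrightarrow> f p \<le> n" for f and n :: nat
  proof -
    have m: "f (hd ps) \<in> f ` set ps" using assms(2) by simp
    moreover have "Max (f ` set ps) \<le> n" using that assms(2) by auto
    moreover have "Min (f ` set ps) \<le> n"
      using le_trans[OF Min_le[OF _ m] that[OF hd_in_set[OF assms(2)]]] by simp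
    ultimately show ?thesis by simp
  qed
  from this[of fst "length \<sigma>"] this[of snd "length \<tau>"] this[of "\<lambda>p. \<sigma> ! fst p" "length \<sigma>"]
    this[of "\<lambda>p. \<tau> ! snd p" "length \<tau>"] b
  show ?thesis by (auto simp: tight_def less_imp_le)
qed

lemma record_exists:
  assumes "match \<sigma> \<tau> ps" "ps \<noteq> []"
  shows "\<exists>p\<in>recs. key p = tight \<sigma> \<tau> ps" "\<exists>p\<in>recs. key p = corner (tight \<sigma> \<tau> ps)"
proof -
  let ?K = "tight \<sigma> \<tau> ps"
  have l: "length ?K = 8" by (simp add: tight_def)
  then show "\<exists>p\<in>recs. key p = ?K" by (rule keys) (rule tight_bounded[OF assms])
  have "set (corner ?K) \<subseteq> set ?K"
    using l by (auto simp: corner_def)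
  then show "\<exists>p\<in>recs. key p = corner ?K"
    using tight_bounded[OF assms] by (intro keys) (auto simp: corner_def)
qed

lemma len_mono: "r \<le> r' \<Longrightarrow> r' \<le> R \<Longrightarrow> p \<in> recs \<Longrightarrow> len r p \<le> len r' p"
proof (induction r' rule: dec_induct)
  case (step n)
  then show ?case using mono[of n p] by simp
qed simp

lemma complete:
  assumes "decomposable D \<sigma> V" "finite V" "match \<sigma> \<tau> ps" "ps \<noteq> []" "fst ` set ps \<subseteq> V"
    "card V - 1 \<le> r" "r \<le> R"
  shows "\<exists>p\<in>recs. key p = tight \<sigma> \<tau> ps \<and> length ps \<le> len r p"
  using assms
proof (induction arbitrary: ps r rule: decomposable.induct)
  case (point i ps r)
  have d: "distinct (map fst ps)" using match_distinct_fst point.prems by blast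
  have "length ps = card (set (map fst ps))" using distinct_card[OF d] by simp
  also have "\<dots> \<le> card {i}" using point.prems by (intro card_mono) auto
  finally have "length ps \<le> 1" by simp
  then obtain q where q: "ps = [q]" using point.prems(3) by (cases ps) auto
  then obtain j where j: "ps = [(i, j)]" "j < length \<tau>"
    using point.prems by (cases q) (auto simp: match_def)
  then obtain p where p: "p \<in> recs" "key p = tight \<sigma> \<tau> ps" "1 \<le> len 0 p"
    using units[OF point.hyps j(2)] by auto
  then show ?case using len_mono[of 0 r p] point.prems j by auto
next
  case (split Vs V ps r)
  let ?R = "\<lambda>p q. fst p < fst q \<and> snd p < snd q \<and> (\<sigma> ! fst p < \<sigma> ! fst q \<longleftrightarrow> \<tau> ! snd p < \<tau> ! snd q)"
  define Ws where "Ws = filter (\<lambda>W. \<exists>p\<in>set ps. fst p \<in> W) Vs"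
  define g where "g = (\<lambda>W. filter (\<lambda>p. fst p \<in> W) ps)"
  have sWs: "sorted_wrt (\<lambda>A B. (\<forall>i\<in>A. \<forall>j\<in>B. i < j) \<and> separated \<sigma> A B) Ws"
    unfolding Ws_def using split.hyps(3) by (rule sorted_wrt_filter)
  have gne: "g W \<noteq> []" if "W \<in> set Ws" for W
    using that by (auto simp: Ws_def g_def filter_empty_conv)
  have gm: "match \<sigma> \<tau> (g W)" for W
    using split.prems(2) unfolding match_def g_def by (auto intro: sorted_wrt_filter)
  have finV: "finite W" "card W < card V" if "W \<in> set Ws" for W
  proof -
    have "W \<subset> V" using split.IH that by (auto simp: Ws_def)
    then show "finite W" "card W < card V"
      using split.prems(1) by (auto intro: finite_subset psubset_card_mono)
  qed
  obtain q where q: "q \<in> set ps" using split.prems(3) by (cases ps) auto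
  have cover: "\<exists>W\<in>set Ws. fst p \<in> W" if "p \<in> set ps" for p
    using split.prems(4) split.hyps(2) that by (auto simp: Ws_def)
  then obtain W0 where "W0 \<in> set Ws" using q by blast
  then have "card V \<ge> 2" using finV[of W0] gne[of W0] by (cases "card W0") (auto simp: g_def Ws_def)
  then obtain r' where r': "r = Suc r'" "r' < R" using split.prems(5,6) by (cases r) auto
  have "\<exists>p\<in>recs. key p = tight \<sigma> \<tau> (g W) \<and> length (g W) \<le> len r' p" if W: "W \<in> set Ws" for W
  proof -
    have "W \<in> set Vs" using W by (simp add: Ws_def)
    moreover have "fst ` set (g W) \<subseteq> W" by (auto simp: g_def)
    moreover have "card W - 1 \<le> r'" using finV(2)[OF W] split.prems(5) r' by linarith
    ultimately show ?thesis
      using split.IH finV(1)[OF W] gm gne[OF W] r' by auto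
  qed
  then obtain c where c: "\<And>W. W \<in> set Ws \<Longrightarrow> c W \<in> recs"
    "\<And>W. W \<in> set Ws \<Longrightarrow> key (c W) = tight \<sigma> \<tau> (g W)"
    "\<And>W. W \<in> set Ws \<Longrightarrow> length (g W) \<le> len r' (c W)" by metis
  obtain p where p: "p \<in> recs" "key p = tight \<sigma> \<tau> ps"
    using record_exists(1) split.prems(2,3) by blast
  obtain e where e: "e \<in> recs" "key e = corner (tight \<sigma> \<tau> ps)"
    using record_exists(2) split.prems(2,3) by blast
  have ct: "contains (key p) (key (c W))" if "W \<in> set Ws" for W
    unfolding p c(2)[OF that] using gne[OF that] by (intro contains_tight) (auto simp: g_def)
  have "compat (tight \<sigma> \<tau> (g A)) (tight \<sigma> \<tau> (g B))"
    if AB: "A \<in> set Ws" "B \<in> set Ws" and o: "\<forall>i\<in>A. \<forall>j\<in>B. i < j" and sep: "separated \<sigma> A B" for A B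
  proof -
    have R: "?R x y" if "x \<in> set (g A)" "y \<in> set (g B)" for x y
    proof -
      have xy: "x \<in> set ps" "y \<in> set ps" "fst x < fst y" using that o by (auto simp: g_def)
      then obtain i j where ij: "i < length ps" "j < length ps" "x = ps ! i" "y = ps ! j"
        by (metis in_set_conv_nth)
      have s: "\<forall>i j. i < j \<longrightarrow> j < length ps \<longrightarrow> ?R (ps ! i) (ps ! j)"
        using split.prems(2) unfolding match_def sorted_wrt_iff_nth_less by simp
      have "i \<noteq> j" using xy ij by auto
      moreover have "\<not> j < i" using s xy ij by (meson not_less_iff_gr_or_eq)
      ultimately show ?thesis using s ij by simp
    qed
    note ne = gne[OF AB(1)] gne[OF AB(2)]
    have inj: "\<tau> ! snd x \<noteq> \<tau> ! snd y" if "x \<in> set (g A)" "y \<in> set (g B)" for x y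
    proof -
      have "snd x < snd y" "snd y < length \<tau>" using R[OF that] gm[of B] that by (auto simp: match_def)
      then show ?thesis using perm(2) by (simp add: is_perm_def nth_eq_iff_index_eq)
    qed
    have "Suc (Max (fst ` set (g A))) \<le> Min (fst ` set (g B))"
      "Suc (Max (snd ` set (g A))) \<le> Min (snd ` set (g B))"
      using R by (auto intro!: Suc_Max_le_Min[OF ne])
    moreover have "Suc (Max ((\<lambda>p. \<sigma> ! fst p) ` set (g A))) \<le> Min ((\<lambda>p. \<sigma> ! fst p) ` set (g B)) \<and>
        Suc (Max ((\<lambda>p. \<tau> ! snd p) ` set (g A))) \<le> Min ((\<lambda>p. \<tau> ! snd p) ` set (g B)) \<or>
      Suc (Max ((\<lambda>p. \<sigma> ! fst p) ` set (g B))) \<le> Min ((\<lambda>p. \<sigma> ! fst p) ` set (g A)) \<and>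
        Suc (Max ((\<lambda>p. \<tau> ! snd p) ` set (g B))) \<le> Min ((\<lambda>p. \<tau> ! snd p) ` set (g A))"
      using sep unfolding separated_def
    proof
      assume *: "\<forall>i\<in>A. \<forall>j\<in>B. \<sigma> ! i < \<sigma> ! j"
      have "\<sigma> ! fst x < \<sigma> ! fst y \<and> \<tau> ! snd x < \<tau> ! snd y" if "x \<in> set (g A)" "y \<in> set (g B)" for x y
      proof -
        have "\<sigma> ! fst x < \<sigma> ! fst y" using * that by (simp add: g_def)
        then show ?thesis using R[OF that] by simp
      qed
      then show ?thesis by (intro disjI1 conjI Suc_Max_le_Min ne) auto
    next
      assume *: "\<forall>i\<in>A. \<forall>j\<in>B. \<sigma> ! j < \<sigma> ! i"
      have "\<sigma> ! fst y < \<sigma> ! fst x \<and> \<tau> ! snd y < \<tau> ! snd x" if "x \<in> set (g A)" "y \<in> set (g B)" for x y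
      proof -
        have "\<sigma> ! fst y < \<sigma> ! fst x" using * that by (simp add: g_def)
        then have "\<not> \<tau> ! snd x < \<tau> ! snd y" using R[OF that] by simp
        then show ?thesis using inj[OF that] \<open>\<sigma> ! fst y < \<sigma> ! fst x\<close> by simp
      qed
      then show ?thesis by (intro disjI2 conjI Suc_Max_le_Min ne) auto
    qed
    ultimately show ?thesis unfolding compat_def tight_nth by blast
  qed
  then have "sorted_wrt (\<lambda>A B. compat (key (c A)) (key (c B))) Ws"
    using sWs c(2) by (auto intro: sorted_wrt_mono_rel[rotated])
  then have srt: "sorted_wrt compat (map key (map c Ws))" by (simp add: sorted_wrt_map)
  have "(\<Sum>x\<leftarrow>map c Ws. len r' x) \<le> len (Suc r') p"
  proof (rule combine[OF r'(2) p(1) _ _ _ srt e(1)])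
    show "set (map c Ws) \<subseteq> recs" using c(1) by auto
    show "length (map c Ws) \<le> D"
      using le_trans[OF length_filter_le split.hyps(1)] by (simp add: Ws_def)
    show "\<forall>x\<in>set (map c Ws). contains (key p) (key x)" using ct by auto
    show "contains (key p) (key e)" using contains_corner split.prems(3) p e by simp
    show "compat (key e) (key e)" using compat_corner_self e by simp
    show "\<forall>x\<in>set (map c Ws). compat (key x) (key e)" using compat_corner ct p e by auto
  qed
  moreover have "length ps \<le> (\<Sum>W\<leftarrow>Ws. length (g W))"
  proof -
    have "set ps \<subseteq> set (concat (map g Ws))" using cover by (auto simp: g_def)
    then have "card (set ps) \<le> card (set (concat (map g Ws)))" by (intro card_mono) auto
    also have "\<dots> \<le> length (concat (map g Ws))" by (rule card_length)
    also have "card (set ps) = length ps"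
      using match_distinct_fst[OF split.prems(2)] by (intro distinct_card) (simp add: distinct_map)
    finally show ?thesis by (simp add: length_concat o_def)
  qed
  moreover have "(\<Sum>W\<leftarrow>Ws. length (g W)) \<le> (\<Sum>W\<leftarrow>Ws. len r' (c W))"
    using c(3) by (intro sum_list_mono) auto
  ultimately have "length ps \<le> len r p" using r' by (simp add: o_def)
  with p show ?case by blast
qed

lemma complete_containing:
  assumes "decomposable D \<sigma> V" "finite V" "match \<sigma> \<tau> ps" "ps \<noteq> []" "fst ` set ps \<subseteq> V"
    and R: "card V - 1 < R" and p: "p \<in> recs" "contains (key p) (tight \<sigma> \<tau> ps)"
  shows "length ps \<le> len R p"
proof -
  obtain r where r: "R = Suc r" using R by (cases R) auto
  obtain c where c: "c \<in> recs" "key c = tight \<sigma> \<tau> ps" "length ps \<le> len r c"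
    using complete[OF assms(1-5), of r] R r by auto
  obtain e where e: "e \<in> recs" "key e = corner (tight \<sigma> \<tau> ps)"
    using record_exists(2) assms(3,4) by blast
  have ce: "contains (tight \<sigma> \<tau> ps) (key e)" using contains_corner assms(4) e by simp
  have "(\<Sum>x\<leftarrow>[c]. len r x) \<le> len (Suc r) p"
  proof (rule combine[OF _ p(1) _ _ _ _ e(1)])
    show "compat (key e) (key e)" using compat_corner_self e by simp
    show "contains (key p) (key e)" using contains_trans p(2) ce by blast
    have "contains (tight \<sigma> \<tau> ps) (tight \<sigma> \<tau> ps)" unfolding contains_def by simp
    then show "\<forall>x\<in>set [c]. compat (key x) (key e)" using compat_corner c e by simp
  qed (use r c p D in auto)
  then show ?thesis using c(3) r by simp
qed

end


definition ranks :: "nat list \<Rightarrow> nat list" where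
  "ranks xs = map (\<lambda>x. length (filter (\<lambda>y. y \<le> x) xs)) xs"

lemma rank_less:
  assumes "x < y" "y \<in> set xs"
  shows "length (filter (\<lambda>z. z \<le> x) xs) < length (filter (\<lambda>z. z \<le> (y::nat)) xs)"
proof -
  obtain us vs where "xs = us @ y # vs" using split_list[OF assms(2)] by blast
  moreover have "length (filter (\<lambda>z. z \<le> x) ws) \<le> length (filter (\<lambda>z. z \<le> y) ws)" for ws
    using assms(1) by (induction ws) auto
  from this[of us] this[of vs] have "length (filter (\<lambda>z. z \<le> x) us) + length (filter (\<lambda>z. z \<le> x) vs)
      \<le> length (filter (\<lambda>z. z \<le> y) us) + length (filter (\<lambda>z. z \<le> y) vs)" by simp
  ultimately show ?thesis using assms(1) by simp
qed

lemma order_iso_ranks: "order_iso (ranks xs) xs"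
  unfolding order_iso_def ranks_def
  by (simp, metis linorder_neqE_nat nth_mem order_less_asym order_less_irrefl rank_less)

lemma is_perm_ranks:
  assumes "distinct xs"
  shows "is_perm (ranks xs)"
proof -
  let ?f = "\<lambda>x. length (filter (\<lambda>y. y \<le> x) xs)"
  have "inj_on ?f (set xs)"
    using rank_less[of _ _ xs] by (intro inj_onI) (metis less_irrefl linorder_neqE_nat)
  then have d: "distinct (ranks xs)" using assms by (simp add: ranks_def distinct_map)
  have "?f x \<in> {1..length xs}" if "x \<in> set xs" for x
    using that by (auto simp: Suc_le_eq filter_empty_conv)
  then have "set (ranks xs) \<subseteq> {1..length xs}" by (auto simp: ranks_def)
  moreover have "card (set (ranks xs)) = card {1..length xs}"
    using distinct_card[OF d] by (simp add: ranks_def)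
  ultimately have "set (ranks xs) = {1..length xs}" by (intro card_subset_eq) auto
  with d show ?thesis by (simp add: is_perm_def ranks_def)
qed

lemma nths_eq_map: "nths xs I = map ((!) xs) (filter (\<lambda>i. i \<in> I) [0..<length xs])"
proof -
  have "zip xs [0..<length xs] = map (\<lambda>i. (xs ! i, i)) [0..<length xs]"
    by (intro nth_equalityI) auto
  then show ?thesis by (simp add: nths_def filter_map o_def)
qed

lemma nths_set:
  assumes "sorted_wrt (<) is" "\<forall>i\<in>set is. i < length xs"
  shows "nths xs (set is) = map ((!) xs) is"
proof -
  have "filter (\<lambda>i. i \<in> set is) [0..<length xs] = is"
    using assms by (intro sorted_distinct_set_unique) (auto simp: strict_sorted_iff sorted_wrt_filter)
  then show ?thesis by (simp add: nths_eq_map)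
qed

lemma order_iso_trans: "order_iso xs ys \<Longrightarrow> order_iso ys zs \<Longrightarrow> order_iso xs zs"
  by (simp add: order_iso_def)

lemma match_is_pattern:
  assumes m: "match \<sigma> \<tau> ps" and perm: "is_perm \<sigma>" "is_perm \<tau>"
  defines "xs \<equiv> map (\<lambda>p. \<sigma> ! fst p) ps"
  shows "is_pattern (ranks xs) \<sigma>" "is_pattern (ranks xs) \<tau>"
proof -
  have lt: "\<And>p. p \<in> set ps \<Longrightarrow> fst p < length \<sigma> \<and> snd p < length \<tau>" using m by (simp add: match_def)
  have sorted: "sorted_wrt (<) (map fst ps)" "sorted_wrt (<) (map snd ps)"
    using m by (auto simp: match_def sorted_wrt_map elim: sorted_wrt_mono_rel[rotated])
  have "inj_on ((!) \<sigma>) {..<length \<sigma>}"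
    using perm(1) by (simp add: is_perm_def inj_on_nth)
  then have "inj_on ((!) \<sigma>) (set (map fst ps))" by (rule inj_on_subset) (use lt in auto)
  then have "distinct (map ((!) \<sigma>) (map fst ps))"
    unfolding distinct_map using match_distinct_fst[OF m] by (simp add: distinct_map)
  then have d: "distinct xs" by (simp add: xs_def o_def)
  have n1: "nths \<sigma> (set (map fst ps)) = xs"
    using nths_set[OF sorted(1), of \<sigma>] lt by (auto simp: xs_def o_def)
  have n2: "nths \<tau> (set (map snd ps)) = map (\<lambda>p. \<tau> ! snd p) ps"
    using nths_set[OF sorted(2), of \<tau>] lt by (auto simp: o_def)
  show "is_pattern (ranks xs) \<sigma>"
    unfolding is_pattern_def using is_perm_ranks[OF d] order_iso_ranks n1 by metis
  have "order_iso xs (map (\<lambda>p. \<tau> ! snd p) ps)"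
    unfolding order_iso_def
  proof (intro conjI allI impI)
    fix i j assume "i < length xs" "j < length xs"
    then have ij: "i < length ps" "j < length ps" by (simp_all add: xs_def)
    have R: "\<sigma> ! fst (ps ! i) < \<sigma> ! fst (ps ! j) \<longleftrightarrow> \<tau> ! snd (ps ! i) < \<tau> ! snd (ps ! j)"
      and lt_snd: "snd (ps ! i) < snd (ps ! j)" and lt_fst: "fst (ps ! i) < fst (ps ! j)"
      if "i < j" "j < length ps" for i j
      using m that unfolding match_def sorted_wrt_iff_nth_less by auto
    have neq: "\<sigma> ! fst (ps ! i) \<noteq> \<sigma> ! fst (ps ! j)" "\<tau> ! snd (ps ! i) \<noteq> \<tau> ! snd (ps ! j)"
      if "i < j" "j < length ps" for i j
      using that lt_fst[OF that] lt_snd[OF that] lt nth_mem[of i ps] nth_mem[of j ps] perm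
      by (auto simp: is_perm_def nth_eq_iff_index_eq)
    consider "i < j" | "i = j" | "j < i" by linarith
    then have "\<sigma> ! fst (ps ! i) < \<sigma> ! fst (ps ! j) \<longleftrightarrow> \<tau> ! snd (ps ! i) < \<tau> ! snd (ps ! j)"
    proof cases
      case 3
      then show ?thesis using R[OF 3 ij(1)] neq[OF 3 ij(1)] by linarith
    qed (use R ij in auto)
    then show "xs ! i < xs ! j \<longleftrightarrow> map (\<lambda>p. \<tau> ! snd p) ps ! i < map (\<lambda>p. \<tau> ! snd p) ps ! j"
      using ij by (simp add: xs_def)
  qed (simp add: xs_def)
  then show "is_pattern (ranks xs) \<tau>"
    unfolding is_pattern_def using is_perm_ranks[OF d] order_iso_trans[OF order_iso_ranks] n2 by metis
qed

lemma pattern_match: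
  assumes "is_pattern \<pi> \<sigma>" "is_pattern \<pi> \<tau>"
  obtains ps where "match \<sigma> \<tau> ps" "length ps = length \<pi>"
proof -
  obtain I J where o: "order_iso \<pi> (nths \<sigma> I)" "order_iso \<pi> (nths \<tau> J)"
    using assms by (auto simp: is_pattern_def)
  define xs where "xs = filter (\<lambda>i. i \<in> I) [0..<length \<sigma>]"
  define ys where "ys = filter (\<lambda>i. i \<in> J) [0..<length \<tau>]"
  have n: "nths \<sigma> I = map ((!) \<sigma>) xs" "nths \<tau> J = map ((!) \<tau>) ys"
    by (simp_all add: nths_eq_map xs_def ys_def)
  have l: "length xs = length \<pi>" "length ys = length \<pi>" using o n by (simp_all add: order_iso_def)
  have s: "sorted_wrt (<) xs" "sorted_wrt (<) ys" by (auto simp: xs_def ys_def sorted_wrt_filter)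
  have b: "\<forall>i\<in>set xs. i < length \<sigma>" "\<forall>i\<in>set ys. i < length \<tau>" by (auto simp: xs_def ys_def)
  have "match \<sigma> \<tau> (zip xs ys)"
    unfolding match_def sorted_wrt_iff_nth_less
  proof (intro conjI allI impI)
    fix i j assume ij: "i < j" "j < length (zip xs ys)"
    then have ij': "i < length \<pi>" "j < length \<pi>" using l by auto
    then show "fst (zip xs ys ! i) < fst (zip xs ys ! j)" "snd (zip xs ys ! i) < snd (zip xs ys ! j)"
      using s ij l by (auto simp: sorted_wrt_iff_nth_less)
    show "\<sigma> ! fst (zip xs ys ! i) < \<sigma> ! fst (zip xs ys ! j) \<longleftrightarrow>
        \<tau> ! snd (zip xs ys ! i) < \<tau> ! snd (zip xs ys ! j)"
    proof -
      have "\<pi> ! i < \<pi> ! j \<longleftrightarrow> map ((!) \<sigma>) xs ! i < map ((!) \<sigma>) xs ! j"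
        using o(1)[unfolded n order_iso_def] ij' by blast
      moreover have "\<pi> ! i < \<pi> ! j \<longleftrightarrow> map ((!) \<tau>) ys ! i < map ((!) \<tau>) ys ! j"
        using o(2)[unfolded n order_iso_def] ij' by blast
      ultimately show ?thesis using ij' l by simp
    qed
  next
    show "\<forall>p\<in>set (zip xs ys). fst p < length \<sigma> \<and> snd p < length \<tau>"
      using b by (auto dest: set_zip_leftD set_zip_rightD)
  qed
  then show thesis using that l by simp
qed

lemma longest_common_pattern_ranks:
  assumes "is_perm \<sigma>" "is_perm \<tau>" "valid \<sigma> \<tau> K xs"
    and max: "\<And>ps. match \<sigma> \<tau> ps \<Longrightarrow> length ps \<le> length xs"
  shows "longest_common_pattern (ranks xs) \<sigma> \<tau>"
proof -
  obtain ps where ps: "match \<sigma> \<tau> ps" "xs = map (\<lambda>p. \<sigma> ! fst p) ps"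
    using assms(3) by (auto simp: valid_def)
  have "length \<pi> \<le> length (ranks xs)" if \<pi>: "is_pattern \<pi> \<sigma>" "is_pattern \<pi> \<tau>" for \<pi>
  proof -
    obtain qs where "match \<sigma> \<tau> qs" "length qs = length \<pi>" by (rule pattern_match[OF \<pi>])
    then show ?thesis using max[of qs] by (simp add: ranks_def)
  qed
  then show ?thesis
    using match_is_pattern[OF ps(1) assms(1,2)] ps(2) by (simp add: longest_common_pattern_def)
qed

section \<open>Structured programs\<close>

type_synonym mem = "nat \<Rightarrow> nat"

datatype com = Ops "instr list" | Seq com com (infixr ";;" 60) | IfNZ nat com | While nat com

fun jump_free :: "instr \<Rightarrow> bool" where
  "jump_free (JZ _ _) = False"
| "jump_free _ = True"

fun eff :: "instr \<Rightarrow> mem \<Rightarrow> mem" where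
  "eff (CLR r) m = m(r := 0)"
| "eff (INC r) m = m(r := Suc (m r))"
| "eff (DEC r) m = m(r := m r - 1)"
| "eff (CPY r s) m = m(r := m s)"
| "eff (LOADI r s) m = m(r := m (m s))"
| "eff (STOREI r s) m = m(m r := m s)"
| "eff (JZ r l) m = m"

text \<open>The machine has no unconditional jump, so the back jump of a loop clears register 2
  and tests it for zero.\<close>

inductive big :: "com \<Rightarrow> mem \<Rightarrow> nat \<Rightarrow> mem \<Rightarrow> bool" where
  Ops: "list_all jump_free is \<Longrightarrow> big (Ops is) m (length is) (fold eff is m)"
| Seq: "big c1 m t1 m1 \<Longrightarrow> big c2 m1 t2 m2 \<Longrightarrow> big (c1 ;; c2) m (t1 + t2) m2"
| IfZ: "m r = 0 \<Longrightarrow> big (IfNZ r c) m 1 m"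
| IfNZ: "m r \<noteq> 0 \<Longrightarrow> big c m t m' \<Longrightarrow> big (IfNZ r c) m (Suc t) m'"
| WhileZ: "m r = 0 \<Longrightarrow> big (While r c) m 1 m"
| WhileNZ: "m r \<noteq> 0 \<Longrightarrow> big c m t m' \<Longrightarrow> big (While r c) (m'(2 := 0)) t' m''
    \<Longrightarrow> big (While r c) m (t + 3 + t') m''"

fun compile :: "nat \<Rightarrow> com \<Rightarrow> instr list" where
  "compile b (Ops is) = is"
| "compile b (c1 ;; c2) = compile b c1 @ compile (b + length (compile b c1)) c2"
| "compile b (IfNZ r c) = JZ r (Suc b + length (compile (Suc b) c)) # compile (Suc b) c"
| "compile b (While r c) = JZ r (b + length (compile (Suc b) c) + 3) # compile (Suc b) c @ [CLR 2, JZ 2 b]"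

definition code_at :: "instr list \<Rightarrow> nat \<Rightarrow> instr list \<Rightarrow> bool" where
  "code_at prog b xs \<longleftrightarrow> b + length xs \<le> length prog \<and> (\<forall>i<length xs. prog ! (b + i) = xs ! i)"

lemma code_at_append:
  "code_at prog b (xs @ ys) \<longleftrightarrow> code_at prog b xs \<and> code_at prog (b + length xs) ys"
proof
  assume *: "code_at prog b (xs @ ys)"
  have "prog ! (b + length xs + i) = ys ! i" if "i < length ys" for i
    using * that unfolding code_at_def
    by (metis add.assoc add_less_cancel_left length_append nth_append_length_plus)
  moreover have "prog ! (b + i) = xs ! i" if "i < length xs" for i
    using * that unfolding code_at_def by (auto simp: nth_append dest: spec[of _ i])
  ultimately show "code_at prog b xs \<and> code_at prog (b + length xs) ys"
    using * by (auto simp: code_at_def)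
next
  assume *: "code_at prog b xs \<and> code_at prog (b + length xs) ys"
  have "prog ! (b + i) = (xs @ ys) ! i" if "i < length (xs @ ys)" for i
  proof (cases "i < length xs")
    case False
    then have "i - length xs < length ys" using that by auto
    then have "prog ! (b + length xs + (i - length xs)) = ys ! (i - length xs)"
      using * unfolding code_at_def by blast
    moreover have "b + length xs + (i - length xs) = b + i" using False by simp
    ultimately have "prog ! (b + i) = ys ! (i - length xs)" by metis
    with False show ?thesis by (simp add: nth_append)
  qed (use * in \<open>auto simp: code_at_def nth_append\<close>)
  with * show "code_at prog b (xs @ ys)" by (auto simp: code_at_def)
qed

lemma code_at_Cons:
  "code_at prog b (x # xs) \<longleftrightarrow> b < length prog \<and> prog ! b = x \<and> code_at prog (Suc b) xs"
  using code_at_append[of prog b "[x]" xs] by (auto simp: code_at_def)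

lemma run_add: "run prog (t + t') c = run prog t' (run prog t c)"
  by (simp add: run_def add.commute[of t] funpow_add)

lemma run_Suc: "run prog (Suc t) c = run prog t (step prog c)"
  by (simp add: run_def funpow_swap1)

lemma run_0 [simp]: "run prog 0 c = c"
  by (simp add: run_def)

lemma run_Ops:
  "code_at prog b is \<Longrightarrow> list_all jump_free is \<Longrightarrow>
    run prog (length is) (b, m) = (b + length is, fold eff is m)"
proof (induction "is" arbitrary: b m)
  case (Cons i js)
  have "step prog (b, m) = (Suc b, eff i m)"
    using Cons.prems by (cases i) (auto simp: code_at_Cons)
  then show ?case
    using Cons by (auto simp: code_at_Cons run_Suc)
qed simp

lemma run_compile:
  "big c m t m' \<Longrightarrow> code_at prog b (compile b c) \<Longrightarrow>
    run prog t (b, m) = (b + length (compile b c), m')"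
proof (induction arbitrary: b rule: big.induct)
  case (Ops "is" m)
  then show ?case by (simp add: run_Ops)
next
  case (Seq c1 m t1 m1 c2 t2 m2)
  then show ?case by (simp add: run_add code_at_append add.assoc)
next
  case (IfZ m r c)
  then show ?case by (simp add: run_Suc code_at_Cons)
next
  case (IfNZ m r c t m')
  then show ?case by (simp add: run_Suc code_at_Cons)
next
  case (WhileZ m r c)
  then show ?case by (simp add: run_Suc code_at_Cons)
next
  case (WhileNZ m r c t m' t' m'')
  let ?e = "Suc b + length (compile (Suc b) c)"
  have "t + 3 = Suc (t + 2)" by simp
  then have "run prog (t + 3) (b, m) = run prog 2 (run prog t (step prog (b, m)))"
    by (simp only: run_Suc run_add)
  also have "step prog (b, m) = (Suc b, m)"
    using WhileNZ by (simp add: code_at_Cons)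
  also have "run prog t (Suc b, m) = (?e, m')"
    using WhileNZ.IH(1)[of "Suc b"] WhileNZ.prems by (simp add: code_at_Cons code_at_append)
  also have "run prog 2 (?e, m') = (b, m'(2 := 0))"
    using WhileNZ.prems by (simp add: code_at_Cons code_at_append run_Suc eval_nat_numeral)
  finally show ?case using WhileNZ.IH(2)[OF WhileNZ.prems] by (simp only: run_add)
qed

definition wp :: "com \<Rightarrow> nat \<Rightarrow> (mem \<Rightarrow> bool) \<Rightarrow> mem \<Rightarrow> bool" where
  "wp c T Q m \<longleftrightarrow> (\<exists>t m'. t \<le> T \<and> big c m t m' \<and> Q m')"

lemma wp_conseq: "wp c T Q m \<Longrightarrow> T \<le> T' \<Longrightarrow> (\<And>m'. Q m' \<Longrightarrow> Q' m') \<Longrightarrow> wp c T' Q' m"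
  unfolding wp_def using le_trans by blast

lemma wp_Ops:
  "list_all jump_free is \<Longrightarrow> length is \<le> T \<Longrightarrow> Q (fold eff is m) \<Longrightarrow> wp (Ops is) T Q m"
  unfolding wp_def using big.Ops by blast

lemma wp_Seq:
  "wp c1 T1 (wp c2 T2 Q) m \<Longrightarrow> T1 + T2 \<le> T \<Longrightarrow> wp (c1 ;; c2) T Q m"
  unfolding wp_def by (meson add_mono big.Seq le_trans)

lemma wp_IfNZ:
  assumes "m r = 0 \<Longrightarrow> Q m" and "m r \<noteq> 0 \<Longrightarrow> wp c T Q m"
  shows "wp (IfNZ r c) (Suc T) Q m"
proof (cases "m r = 0")
  case True
  then show ?thesis unfolding wp_def using assms(1) big.IfZ[of m r c] by fastforce
next
  case False
  then obtain t m' where "t \<le> T" "big c m t m'" "Q m'" using assms(2) by (auto simp: wp_def)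
  then show ?thesis unfolding wp_def using big.IfNZ[of m r c t m'] False by (meson Suc_le_mono)
qed

lemma wp_While:
  assumes "I 0 m"
    and step: "\<And>j m. j < n \<Longrightarrow> I j m \<Longrightarrow> wp c C (\<lambda>m'. I (Suc j) (m'(2 := 0))) m"
    and guard: "\<And>j m. j \<le> n \<Longrightarrow> I j m \<Longrightarrow> m r = 0 \<longleftrightarrow> j = n"
  shows "wp (While r c) (n * (C + 3) + 1) (I n) m"
proof -
  have "I (n - k) m \<Longrightarrow> k \<le> n \<Longrightarrow> wp (While r c) (k * (C + 3) + 1) (I n) m" for k m
  proof (induction k arbitrary: m)
    case 0
    then have "m r = 0" using guard[of n m] by simp
    with 0 show ?case unfolding wp_def using big.WhileZ[of m r c] by fastforce
  next
    case (Suc k)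
    then have lt: "n - Suc k < n" and S: "Suc (n - Suc k) = n - k" by auto
    have "m r \<noteq> 0" using guard[of "n - Suc k" m] Suc.prems by auto
    moreover obtain t m' where t: "t \<le> C" "big c m t m'" and I: "I (n - k) (m'(2 := 0))"
      using step[OF lt Suc.prems(1)] by (auto simp: wp_def S)
    obtain t' m'' where t': "t' \<le> k * (C + 3) + 1" "big (While r c) (m'(2 := 0)) t' m''" "I n m''"
      using Suc.IH[OF I] Suc.prems unfolding wp_def by (meson Suc_leD)
    ultimately have "big (While r c) m (t + 3 + t') m''" using big.WhileNZ[of m r c t m'] t(2) by blast
    moreover have "t + 3 + t' \<le> Suc k * (C + 3) + 1" using t(1) t'(1) by (simp add: algebra_simps)
    ultimately show ?case unfolding wp_def using t'(3) by blast
  qed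
  from this[of n] assms(1) show ?thesis by simp
qed

section \<open>Records and the update step\<close>

lemma wp_SeqI:
  "wp c1 T1 P m \<Longrightarrow> (\<And>m1. P m1 \<Longrightarrow> wp c2 T2 Q m1) \<Longrightarrow> T1 + T2 \<le> T \<Longrightarrow> wp (c1 ;; c2) T Q m"
  by (rule wp_Seq[of c1 T1 c2 T2 Q]) (auto intro: wp_conseq)

definition agree :: "nat set \<Rightarrow> mem \<Rightarrow> mem \<Rightarrow> bool" where
  "agree X m m' \<longleftrightarrow> (\<forall>x. x \<notin> X \<longrightarrow> m' x = m x)"

lemma agreeD: "agree X m m' \<Longrightarrow> x \<notin> X \<Longrightarrow> m' x = m x"
  by (simp add: agree_def)

lemma agree_refl [simp]: "agree X m m"
  by (simp add: agree_def)

lemma agree_trans: "agree X m m' \<Longrightarrow> agree Y m' m'' \<Longrightarrow> X \<subseteq> Z \<Longrightarrow> Y \<subseteq> Z \<Longrightarrow> agree Z m m''"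
  unfolding agree_def subset_iff by metis

lemma agree_mono: "agree X m m' \<Longrightarrow> X \<subseteq> Y \<Longrightarrow> agree Y m m'"
  unfolding agree_def subset_iff by metis

lemma wp_drain_INC:
  assumes "m 2 = 0" "c \<noteq> 2" "x \<noteq> 2" "x \<noteq> c"
  shows "wp (While c (Ops [DEC c, INC x])) (5 * m c + 1) (\<lambda>m'. m' = m(c := 0, x := m x + m c)) m"
proof -
  have "wp (While c (Ops [DEC c, INC x])) (m c * (2 + 3) + 1)
      ((\<lambda>j m'. m' = m(c := m c - j, x := m x + j)) (m c)) m"
    by (rule wp_While) (use assms in \<open>auto intro!: wp_Ops simp: fun_eq_iff\<close>)
  then show ?thesis by (simp add: mult.commute)
qed

lemma wp_drain_DEC:
  assumes "m 2 = 0" "c \<noteq> 2" "x \<noteq> 2" "x \<noteq> c"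
  shows "wp (While c (Ops [DEC c, DEC x])) (5 * m c + 1) (\<lambda>m'. m' = m(c := 0, x := m x - m c)) m"
proof -
  have "wp (While c (Ops [DEC c, DEC x])) (m c * (2 + 3) + 1)
      ((\<lambda>j m'. m' = m(c := m c - j, x := m x - j)) (m c)) m"
    by (rule wp_While) (use assms in \<open>auto intro!: wp_Ops simp: fun_eq_iff\<close>)
  then show ?thesis by (simp add: mult.commute)
qed

definition ADD :: "nat \<Rightarrow> nat \<Rightarrow> com" where
  "ADD x s = Ops [CPY 3 s] ;; While 3 (Ops [DEC 3, INC x])"

lemma wp_ADD:
  assumes "m 2 = 0" "x \<notin> {2, 3}" "s \<noteq> 3" "5 * m s + 2 \<le> T"
  shows "wp (ADD x s) T (\<lambda>m'. m' = m(3 := 0, x := m x + m s)) m"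
  unfolding ADD_def
proof (rule wp_SeqI[of _ 1])
  show "wp (Ops [CPY 3 s]) 1 (\<lambda>m1. m1 = m(3 := m s)) m" by (rule wp_Ops) auto
next
  fix m1 assume m1: "m1 = m(3 := m s)"
  then show "wp (While 3 (Ops [DEC 3, INC x])) (5 * m s + 1) (\<lambda>m'. m' = m(3 := 0, x := m x + m s)) m1"
    using wp_drain_INC[of m1 3 x] assms by (auto intro: wp_conseq)
qed (use assms in simp)

definition SUB :: "nat \<Rightarrow> nat \<Rightarrow> com" where
  "SUB x s = Ops [CPY 3 s] ;; While 3 (Ops [DEC 3, DEC x])"

lemma wp_SUB:
  assumes "m 2 = 0" "x \<notin> {2, 3}" "s \<noteq> 3" "5 * m s + 2 \<le> T"
  shows "wp (SUB x s) T (\<lambda>m'. m' = m(3 := 0, x := m x - m s)) m"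
  unfolding SUB_def
proof (rule wp_SeqI[of _ 1])
  show "wp (Ops [CPY 3 s]) 1 (\<lambda>m1. m1 = m(3 := m s)) m" by (rule wp_Ops) auto
next
  fix m1 assume m1: "m1 = m(3 := m s)"
  then show "wp (While 3 (Ops [DEC 3, DEC x])) (5 * m s + 1) (\<lambda>m'. m' = m(3 := 0, x := m x - m s)) m1"
    using wp_drain_DEC[of m1 3 x] assms by (auto intro: wp_conseq)
qed (use assms in simp)

lemma fold_INC: "fold eff (replicate k (INC t)) m = m(t := m t + k)"
  by (induction k arbitrary: m) (auto simp: fun_eq_iff)

lemma jump_free_replicate: "list_all jump_free (replicate k (INC t))" "list_all jump_free (replicate k (DEC t))"
  by (induction k) auto

definition FLD :: "nat \<Rightarrow> nat \<Rightarrow> nat \<Rightarrow> instr list" where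
  "FLD t x k = CPY t x # replicate k (INC t) @ [LOADI t t]"

lemma fold_FLD: "m x + k \<noteq> t \<Longrightarrow> fold eff (FLD t x k) m = m(t := m (m x + k))"
  by (simp add: FLD_def fold_INC del: fold_replicate)

lemma jump_free_FLD: "list_all jump_free (FLD t x k)"
  by (simp add: FLD_def jump_free_replicate)

lemma length_FLD: "length (FLD t x k) = k + 2"
  by (simp add: FLD_def)

definition LEQ :: "nat \<Rightarrow> nat \<Rightarrow> nat \<Rightarrow> nat \<Rightarrow> nat \<Rightarrow> com" where
  "LEQ r k1 x1 k2 x2 = Ops (FLD 4 x1 k1 @ FLD 3 x2 k2) ;;
    While 3 (Ops [DEC 3, DEC 4]) ;; While 4 (Ops [DEC 4, INC r])"

lemma wp_LEQ:
  assumes "m 2 = 0" "r \<notin> {2, 3, 4}" "x1 \<notin> {3, 4}" "x2 \<notin> {3, 4}" "5 \<le> m x1" "5 \<le> m x2"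
    and "m (m x1 + k1) \<le> n" "m (m x2 + k2) \<le> n" "k1 < 8" "k2 < 8"
  shows "wp (LEQ r k1 x1 k2 x2) (10 * n + 20)
    (\<lambda>m'. m' = m(3 := 0, 4 := 0, r := m r + (m (m x1 + k1) - m (m x2 + k2)))) m"
proof -
  let ?u = "m (m x1 + k1)" and ?t = "m (m x2 + k2)"
  show ?thesis unfolding LEQ_def
  proof (rule wp_SeqI[of _ 18 "\<lambda>m1. m1 = m(4 := ?u, 3 := ?t)" _ _ "10 * n + 2"])
    have "m x1 + k1 \<noteq> 4" "m x2 + k2 \<noteq> 3" "m x2 + k2 \<noteq> 4" "x2 \<noteq> 4" using assms by auto
    then have "fold eff (FLD 4 x1 k1 @ FLD 3 x2 k2) m = m(4 := ?u, 3 := ?t)"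
      by (simp add: fold_FLD)
    then show "wp (Ops (FLD 4 x1 k1 @ FLD 3 x2 k2)) 18 (\<lambda>m1. m1 = m(4 := ?u, 3 := ?t)) m"
      using assms by (intro wp_Ops) (auto simp: jump_free_FLD length_FLD)
  next
    fix m1 assume m1: "m1 = m(4 := ?u, 3 := ?t)"
    show "wp (While 3 (Ops [DEC 3, DEC 4]) ;; While 4 (Ops [DEC 4, INC r])) (10 * n + 2)
        (\<lambda>m'. m' = m(3 := 0, 4 := 0, r := m r + (?u - ?t))) m1"
    proof (rule wp_SeqI[of _ "5 * n + 1" "\<lambda>m2. m2 = m(4 := ?u - ?t, 3 := 0)" _ _ "5 * n + 1"])
      show "wp (While 3 (Ops [DEC 3, DEC 4])) (5 * n + 1) (\<lambda>m2. m2 = m(4 := ?u - ?t, 3 := 0)) m1"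
        using assms m1 by (intro wp_conseq[OF wp_drain_DEC]) (auto simp: fun_eq_iff)
    next
      fix m2 assume "m2 = m(4 := ?u - ?t, 3 := 0)"
      then show "wp (While 4 (Ops [DEC 4, INC r])) (5 * n + 1)
          (\<lambda>m'. m' = m(3 := 0, 4 := 0, r := m r + (?u - ?t))) m2"
        using assms by (intro wp_conseq[OF wp_drain_INC]) (auto simp: fun_eq_iff)
    qed simp
  qed simp
qed

text \<open>A record at address \<open>p\<close>: eight cells for the key, one for the length of the stored list,
  then the list itself.\<close>

definition rkey :: "mem \<Rightarrow> nat \<Rightarrow> nat list" where
  "rkey m p = map (\<lambda>k. m (p + k)) [0..<8]"

definition rlist :: "mem \<Rightarrow> nat \<Rightarrow> nat list" where
  "rlist m p = map (\<lambda>i. m (p + 9 + i)) [0..<m (p + 8)]"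

lemma rkey_nth: "k < 8 \<Longrightarrow> rkey m p ! k = m (p + k)"
  by (simp add: rkey_def)

lemma rkey_nths:
  "rkey m p ! 0 = m (p + 0)" "rkey m p ! 1 = m (p + 1)" "rkey m p ! 2 = m (p + 2)"
  "rkey m p ! 3 = m (p + 3)" "rkey m p ! 4 = m (p + 4)" "rkey m p ! 5 = m (p + 5)"
  "rkey m p ! 6 = m (p + 6)" "rkey m p ! 7 = m (p + 7)"
  "rkey m p ! Suc 0 = m (p + 1)"
  by (simp_all add: rkey_nth)

lemma length_rlist [simp]: "length (rlist m p) = m (p + 8)"
  by (simp add: rlist_def)

text \<open>Checks of conditions increment a register at least once when a condition fails.\<close>

fun LEQS :: "nat \<Rightarrow> (nat \<times> nat \<times> nat \<times> nat) list \<Rightarrow> com" where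
  "LEQS r [] = Ops []"
| "LEQS r ((k1, x1, k2, x2) # cs) = LEQ r k1 x1 k2 x2 ;; LEQS r cs"

lemma wp_LEQS:
  assumes "m 2 = 0" "r \<notin> {2, 3, 4}"
    and pre: "\<forall>(k1, x1, k2, x2)\<in>set cs. k1 < 8 \<and> k2 < 8 \<and>
      x1 \<notin> {3, 4, r} \<and> x2 \<notin> {3, 4, r} \<and> max 5 (Suc r) \<le> m x1 \<and> max 5 (Suc r) \<le> m x2 \<and>
      m (m x1 + k1) \<le> n \<and> m (m x2 + k2) \<le> n"
  shows "wp (LEQS r cs) (length cs * (10 * n + 20)) (\<lambda>m'. agree {3, 4, r} m m' \<and>
    (m' r = 0 \<longleftrightarrow> m r = 0 \<and> (\<forall>(k1, x1, k2, x2)\<in>set cs. m (m x1 + k1) \<le> m (m x2 + k2)))) m"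
  using assms
proof (induction cs arbitrary: m)
  case Nil
  then show ?case by (auto intro!: wp_Ops)
next
  case (Cons c cs)
  obtain k1 x1 k2 x2 where c: "c = (k1, x1, k2, x2)" by (cases c)
  let ?d = "m (m x1 + k1) - m (m x2 + k2)"
  show ?case unfolding c LEQS.simps
  proof (rule wp_SeqI[OF wp_LEQ])
    fix m1 assume m1: "m1 = m(3 := 0, 4 := 0, r := m r + ?d)"
    have same: "m1 (m1 x + k) = m (m x + k)" if "x \<notin> {3, 4, r}" "max 5 (Suc r) \<le> m x" for x k
      using that m1 by auto
    have pre: "k < 8 \<and> k' < 8 \<and>
      x \<notin> {3, 4, r} \<and> x' \<notin> {3, 4, r} \<and> max 5 (Suc r) \<le> m x \<and> max 5 (Suc r) \<le> m x' \<and>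
      m (m x + k) \<le> n \<and> m (m x' + k') \<le> n" if "(k, x, k', x') \<in> set cs" for k x k' x'
      using bspec[OF Cons.prems(3), of "(k, x, k', x')"] that by auto
    have "wp (LEQS r cs) (length cs * (10 * n + 20)) (\<lambda>m'. agree {3, 4, r} m1 m' \<and>
      (m' r = 0 \<longleftrightarrow> m1 r = 0 \<and> (\<forall>(k1, x1, k2, x2)\<in>set cs. m1 (m1 x1 + k1) \<le> m1 (m1 x2 + k2)))) m1"
    proof (rule Cons.IH)
      have "k < 8 \<and> k' < 8 \<and>
        x \<notin> {3, 4, r} \<and> x' \<notin> {3, 4, r} \<and> max 5 (Suc r) \<le> m1 x \<and> max 5 (Suc r) \<le> m1 x' \<and>
        m1 (m1 x + k) \<le> n \<and> m1 (m1 x' + k') \<le> n" if "(k, x, k', x') \<in> set cs" for k x k' x'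
        using pre[OF that] same[of x k] same[of x' k'] m1 by auto
      then show "\<forall>(k1, x1, k2, x2)\<in>set cs. k1 < 8 \<and> k2 < 8 \<and>
        x1 \<notin> {3, 4, r} \<and> x2 \<notin> {3, 4, r} \<and> max 5 (Suc r) \<le> m1 x1 \<and> max 5 (Suc r) \<le> m1 x2 \<and>
        m1 (m1 x1 + k1) \<le> n \<and> m1 (m1 x2 + k2) \<le> n" by blast
    qed (use Cons.prems m1 in auto)
    then show "wp (LEQS r cs) (length cs * (10 * n + 20)) (\<lambda>m'. agree {3, 4, r} m m' \<and>
      (m' r = 0 \<longleftrightarrow> m r = 0 \<and> (\<forall>(k1, x1, k2, x2)\<in>set ((k1, x1, k2, x2) # cs).
        m (m x1 + k1) \<le> m (m x2 + k2)))) m1"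
    proof (rule wp_conseq)
      fix m'
      assume *: "agree {3, 4, r} m1 m' \<and>
        (m' r = 0 \<longleftrightarrow> m1 r = 0 \<and> (\<forall>(k1, x1, k2, x2)\<in>set cs. m1 (m1 x1 + k1) \<le> m1 (m1 x2 + k2)))"
      have "agree {3, 4, r} m m1" using m1 by (auto simp: agree_def)
      then have "agree {3, 4, r} m m'" using * by (auto intro: agree_trans)
      moreover have "(\<forall>(k1, x1, k2, x2)\<in>set cs. m1 (m1 x1 + k1) \<le> m1 (m1 x2 + k2)) \<longleftrightarrow>
      (\<forall>(k1, x1, k2, x2)\<in>set cs. m (m x1 + k1) \<le> m (m x2 + k2))"
      using pre same by (intro ball_cong) fastforce+
      moreover have "m1 r = m r + ?d" using m1 by simp
      ultimately show "agree {3, 4, r} m m' \<and> (m' r = 0 \<longleftrightarrow> m r = 0 \<and>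
          (\<forall>(k1, x1, k2, x2)\<in>set ((k1, x1, k2, x2) # cs). m (m x1 + k1) \<le> m (m x2 + k2)))"
        using * by auto
    qed simp
  qed (use Cons.prems(1,2) bspec[OF Cons.prems(3), of "(k1, x1, k2, x2)"] c in auto)
qed

definition CONTAINS :: "nat \<Rightarrow> nat \<Rightarrow> com" where
  "CONTAINS x y = LEQS 8 [(0, x, 0, y), (1, y, 1, x), (2, x, 2, y), (3, y, 3, x),
     (4, x, 4, y), (5, y, 5, x), (6, x, 6, y), (7, y, 7, x)]"

definition COMPAT :: "nat \<Rightarrow> nat \<Rightarrow> com" where
  "COMPAT x y = LEQS 8 [(1, x, 0, y), (5, x, 4, y)] ;; Ops [CLR 9, CLR 10] ;;
     LEQS 9 [(3, x, 2, y), (7, x, 6, y)] ;; LEQS 10 [(3, y, 2, x), (7, y, 6, x)] ;;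
     IfNZ 9 (IfNZ 10 (Ops [INC 8]))"

definition small_key :: "nat \<Rightarrow> mem \<Rightarrow> nat \<Rightarrow> bool" where
  "small_key n m p \<longleftrightarrow> 13 \<le> p \<and> (\<forall>k<8. m (p + k) \<le> n)"

lemma small_key_agree:
  assumes "agree X m m'" "X \<subseteq> {..<13}"
  shows "small_key n m' p \<longleftrightarrow> small_key n m p"
proof (cases "13 \<le> p")
  case True
  then have "m' (p + k) = m (p + k)" for k using assms by (intro agreeD) auto
  then show ?thesis by (simp add: small_key_def)
qed (simp add: small_key_def)

lemma small_keyD:
  assumes "small_key n m p"
  shows "13 \<le> p" "m p \<le> n" "m (Suc p) \<le> n" "m (p + 2) \<le> n" "m (p + 3) \<le> n" "m (p + 4) \<le> n"
    "m (p + 5) \<le> n" "m (p + 6) \<le> n" "m (p + 7) \<le> n"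
proof -
  have k: "m (p + k) \<le> n" if "k < 8" for k using assms that by (simp add: small_key_def)
  show "m p \<le> n" "m (Suc p) \<le> n" using k[of 0] k[of 1] by simp_all
  show "m (p + 2) \<le> n" "m (p + 3) \<le> n" "m (p + 4) \<le> n" "m (p + 5) \<le> n" "m (p + 6) \<le> n"
    "m (p + 7) \<le> n" by (rule k; simp)+
qed (use assms in \<open>simp add: small_key_def\<close>)

lemma wp_CONTAINS:
  assumes "m 2 = 0" "13 \<le> x" "13 \<le> y" "small_key n m (m x)" "small_key n m (m y)"
  shows "wp (CONTAINS x y) (8 * (10 * n + 20)) (\<lambda>m'. agree {3, 4, 8} m m' \<and>
    (m' 8 = 0 \<longleftrightarrow> m 8 = 0 \<and> contains (rkey m (m x)) (rkey m (m y)))) m"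
  unfolding CONTAINS_def
  by (rule wp_conseq[OF wp_LEQS[where n = n]])
    (use assms small_keyD[OF assms(4)] small_keyD[OF assms(5)] in \<open>simp_all add: contains_def rkey_nths\<close>)

lemma wp_COMPAT:
  assumes "m 2 = 0" "13 \<le> x" "13 \<le> y" "small_key n m (m x)" "small_key n m (m y)"
  shows "wp (COMPAT x y) (6 * (10 * n + 20) + 6) (\<lambda>m'. agree {3, 4, 8, 9, 10} m m' \<and>
    (m' 8 = 0 \<longleftrightarrow> m 8 = 0 \<and> compat (rkey m (m x)) (rkey m (m y)))) m"
proof -
  let ?X = "{3, 4, 8, 9, 10} :: nat set"
  have keep: "m' 2 = 0 \<and> m' x = m x \<and> m' y = m y \<and> small_key n m' (m x) \<and> small_key n m' (m y) \<and>
      m' (m x + k) = m (m x + k) \<and> m' (m y + k) = m (m y + k)" if "agree ?X m m'" for m' k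
  proof -
    have "m' z = m z" if "z \<notin> ?X" for z using \<open>agree ?X m m'\<close> that by (rule agreeD)
    moreover have "x \<notin> ?X" "y \<notin> ?X" "2 \<notin> ?X" "m x + k \<notin> ?X" "m y + k \<notin> ?X"
      using assms by (auto simp: small_key_def)
    moreover have "?X \<subseteq> {..<13}" by auto
    ultimately show ?thesis using assms small_key_agree[OF \<open>agree ?X m m'\<close>] by simp
  qed
  let ?c1 = "m (m x + 1) \<le> m (m y + 0) \<and> m (m x + 5) \<le> m (m y + 4)"
  let ?c2 = "m (m x + 3) \<le> m (m y + 2) \<and> m (m x + 7) \<le> m (m y + 6)"
  let ?c3 = "m (m y + 3) \<le> m (m x + 2) \<and> m (m y + 7) \<le> m (m x + 6)"
  have cc: "compat (rkey m (m x)) (rkey m (m y)) \<longleftrightarrow> ?c1 \<and> (?c2 \<or> ?c3)"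
    unfolding compat_def rkey_nths by (rule conj_assoc[symmetric])
  define I where "I = (\<lambda>m'. agree ?X m m' \<and> (m' 8 = 0 \<longleftrightarrow> m 8 = 0 \<and> ?c1))"
  note sk = small_keyD[OF assms(4)] small_keyD[OF assms(5)]
  have s1: "wp (LEQS 8 [(1, x, 0, y), (5, x, 4, y)]) (2 * (10 * n + 20)) I m"
  proof (rule wp_conseq[OF wp_LEQS[where n = n]])
    fix m' assume *: "agree {3, 4, 8} m m' \<and> (m' 8 = 0) = (m 8 = 0 \<and>
      (\<forall>(k1, x1, k2, x2)\<in>set [(1, x, 0, y), (5, x, 4, y)]. m (m x1 + k1) \<le> m (m x2 + k2)))"
    from conjunct1[OF *] have "agree ?X m m'" by (rule agree_mono) simp
    with * show "I m'" by (simp add: I_def)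
  qed (use assms sk in simp_all)
  have s2: "wp (Ops [CLR 9, CLR 10]) 2 (\<lambda>m'. I m' \<and> m' 9 = 0 \<and> m' 10 = 0) m1" if "I m1" for m1
    by (rule wp_Ops) (use that in \<open>auto simp: agree_def I_def\<close>)
  have s3: "wp (LEQS 9 [(3, x, 2, y), (7, x, 6, y)]) (2 * (10 * n + 20))
      (\<lambda>m'. I m' \<and> (m' 9 = 0 \<longleftrightarrow> ?c2) \<and> m' 10 = 0) m2" if m2: "I m2 \<and> m2 9 = 0 \<and> m2 10 = 0" for m2
  proof -
    have a2: "agree ?X m m2" using m2 by (simp add: I_def)
    show ?thesis
    proof (rule wp_conseq[OF wp_LEQS[where n = n]])
      fix m' assume *: "agree {3, 4, 9} m2 m' \<and> (m' 9 = 0) = (m2 9 = 0 \<and>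
        (\<forall>(k1, x1, k2, x2)\<in>set [(3, x, 2, y), (7, x, 6, y)]. m2 (m2 x1 + k1) \<le> m2 (m2 x2 + k2)))"
      have "agree ?X m m'" by (rule agree_trans[OF a2 conjunct1[OF *]]) simp_all
      moreover have "m' 8 = m2 8" "m' 10 = m2 10" using agreeD[OF conjunct1[OF *]] by simp_all
      ultimately show "I m' \<and> (m' 9 = 0 \<longleftrightarrow> ?c2) \<and> m' 10 = 0"
        using m2 * keep[OF a2] keep[OF a2, of 2] by (simp add: I_def)
    qed (use assms keep[OF a2] keep[OF a2, of 2] sk in simp_all)
  qed
  have s4: "wp (LEQS 10 [(3, y, 2, x), (7, y, 6, x)]) (2 * (10 * n + 20))
      (\<lambda>m'. I m' \<and> (m' 9 = 0 \<longleftrightarrow> ?c2) \<and> (m' 10 = 0 \<longleftrightarrow> ?c3)) m3"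
    if m3: "I m3 \<and> (m3 9 = 0 \<longleftrightarrow> ?c2) \<and> m3 10 = 0" for m3
  proof -
    have a3: "agree ?X m m3" using m3 by (simp add: I_def)
    show ?thesis
    proof (rule wp_conseq[OF wp_LEQS[where n = n]])
      fix m' assume *: "agree {3, 4, 10} m3 m' \<and> (m' 10 = 0) = (m3 10 = 0 \<and>
        (\<forall>(k1, x1, k2, x2)\<in>set [(3, y, 2, x), (7, y, 6, x)]. m3 (m3 x1 + k1) \<le> m3 (m3 x2 + k2)))"
      have "agree ?X m m'" by (rule agree_trans[OF a3 conjunct1[OF *]]) simp_all
      moreover have "m' 8 = m3 8" "m' 9 = m3 9" using agreeD[OF conjunct1[OF *]] by simp_all
      ultimately show "I m' \<and> (m' 9 = 0 \<longleftrightarrow> ?c2) \<and> (m' 10 = 0 \<longleftrightarrow> ?c3)"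
        using m3 * keep[OF a3] keep[OF a3, of 2] by (simp add: I_def)
    qed (use assms keep[OF a3] keep[OF a3, of 2] sk in simp_all)
  qed
  have s5: "wp (IfNZ 9 (IfNZ 10 (Ops [INC 8]))) (Suc (Suc 1)) (\<lambda>m'. agree ?X m m' \<and>
      (m' 8 = 0 \<longleftrightarrow> m 8 = 0 \<and> compat (rkey m (m x)) (rkey m (m y)))) m4"
    if "I m4 \<and> (m4 9 = 0 \<longleftrightarrow> ?c2) \<and> (m4 10 = 0 \<longleftrightarrow> ?c3)" for m4
    unfolding cc by (intro wp_IfNZ wp_Ops) (use that in \<open>auto simp: agree_def I_def\<close>)
  show ?thesis unfolding COMPAT_def
    by (rule wp_SeqI[OF s1], rule wp_SeqI[OF s2], assumption, rule wp_SeqI[OF s3], assumption,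
        rule wp_SeqI[OF s4], assumption, erule s5) auto
qed


definition tmp :: "nat set" where "tmp = {3..12}"

lemma agree_tmp: "agree tmp m m' \<Longrightarrow> 13 \<le> x \<Longrightarrow> m' x = m x"
  by (rule agreeD) (auto simp: tmp_def)

lemma agree_tmp2: "agree tmp m m' \<Longrightarrow> m' 2 = m 2"
  by (rule agreeD) (auto simp: tmp_def)

lemma agree_tmp_rkey: "agree tmp m m' \<Longrightarrow> 13 \<le> p \<Longrightarrow> rkey m' p = rkey m p"
  by (simp add: rkey_def agree_tmp)

lemma agree_tmp_rlist: "agree tmp m m' \<Longrightarrow> 13 \<le> p \<Longrightarrow> rlist m' p = rlist m p"
  by (simp add: rlist_def agree_tmp)

lemma agree_tmp_small_key: "agree tmp m m' \<Longrightarrow> small_key n m' p \<longleftrightarrow> small_key n m p"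
  by (rule small_key_agree) (auto simp: tmp_def)

fun COMPATS :: "nat \<Rightarrow> nat list \<Rightarrow> com" where
  "COMPATS x [] = Ops []"
| "COMPATS x (y # ys) = COMPAT x y ;; COMPATS x ys"

fun CHECKS :: "nat \<Rightarrow> nat list \<Rightarrow> com" where
  "CHECKS x [] = Ops []"
| "CHECKS x (y # ys) = CONTAINS x y ;; COMPATS y ys ;; CHECKS x ys"

lemma wp_COMPATS:
  assumes "m 2 = 0" "\<forall>y\<in>set (x # ys). 13 \<le> y \<and> small_key n m (m y)"
  shows "wp (COMPATS x ys) (length ys * (60 * n + 126)) (\<lambda>m'. agree tmp m m' \<and>
    (m' 8 = 0 \<longleftrightarrow> m 8 = 0 \<and> (\<forall>y\<in>set ys. compat (rkey m (m x)) (rkey m (m y))))) m"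
  using assms
proof (induction ys arbitrary: m)
  case Nil
  then show ?case by (auto intro!: wp_Ops)
next
  case (Cons y ys)
  have sx: "13 \<le> x" "small_key n m (m x)" "13 \<le> m x" and sy: "13 \<le> y" "small_key n m (m y)" "13 \<le> m y"
    using Cons.prems(2) small_keyD(1) by auto
  show ?case unfolding COMPATS.simps
  proof (rule wp_SeqI[OF wp_COMPAT[OF Cons.prems(1) sx(1) sy(1) sx(2) sy(2)]])
    fix m1 assume m1: "agree {3, 4, 8, 9, 10} m m1 \<and>
      (m1 8 = 0 \<longleftrightarrow> m 8 = 0 \<and> compat (rkey m (m x)) (rkey m (m y)))"
    have a: "agree tmp m m1" by (rule agree_mono[OF conjunct1[OF m1]]) (simp add: tmp_def)
    have pre: "\<forall>y\<in>set (x # ys). 13 \<le> y \<and> small_key n m1 (m1 y)"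
      using Cons.prems(2) by (auto simp: agree_tmp_small_key[OF a] agree_tmp[OF a])
    have m12: "m1 2 = 0" using Cons.prems(1) agree_tmp2[OF a] by simp
    show "wp (COMPATS x ys) (length ys * (60 * n + 126)) (\<lambda>m'. agree tmp m m' \<and>
      (m' 8 = 0 \<longleftrightarrow> m 8 = 0 \<and> (\<forall>z\<in>set (y # ys). compat (rkey m (m x)) (rkey m (m z))))) m1"
    proof (rule wp_conseq[OF Cons.IH[OF m12 pre]])
      fix m' assume *: "agree tmp m1 m' \<and>
        (m' 8 = 0 \<longleftrightarrow> m1 8 = 0 \<and> (\<forall>y\<in>set ys. compat (rkey m1 (m1 x)) (rkey m1 (m1 y))))"
      have r: "rkey m1 (m1 z) = rkey m (m z)" if "z \<in> set (x # ys)" for z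
      proof -
        have "13 \<le> z" "13 \<le> m z" using Cons.prems(2) that small_keyD(1) by auto
        then show ?thesis by (simp add: agree_tmp[OF a] agree_tmp_rkey[OF a])
      qed
      have "agree tmp m m'" by (rule agree_trans[OF a conjunct1[OF *]]) simp_all
      then show "agree tmp m m' \<and>
        (m' 8 = 0 \<longleftrightarrow> m 8 = 0 \<and> (\<forall>z\<in>set (y # ys). compat (rkey m (m x)) (rkey m (m z))))"
        using * m1 r by simp
    qed simp
  qed simp
qed

definition ok :: "mem \<Rightarrow> nat \<Rightarrow> nat list \<Rightarrow> bool" where
  "ok m p ps \<longleftrightarrow> (\<forall>q\<in>set ps. contains (rkey m p) (rkey m q)) \<and> sorted_wrt compat (map (rkey m) ps)"

lemma ok_agree:
  assumes "agree tmp m m'" "\<forall>q\<in>set (p # ps). 13 \<le> q"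
  shows "ok m' p ps \<longleftrightarrow> ok m p ps"
proof -
  have map: "map (rkey m') ps = map (rkey m) ps" using assms by (auto intro: agree_tmp_rkey)
  have "\<forall>q\<in>set (p # ps). rkey m' q = rkey m q" using assms by (auto intro: agree_tmp_rkey)
  then show ?thesis unfolding ok_def map by simp
qed

lemma wp_CHECKS:
  assumes "m 2 = 0" "\<forall>y\<in>set (x # ys). 13 \<le> y \<and> small_key n m (m y)"
  shows "wp (CHECKS x ys) (length ys * (80 * n + 160 + length ys * (60 * n + 126)))
    (\<lambda>m'. agree tmp m m' \<and> (m' 8 = 0 \<longleftrightarrow> m 8 = 0 \<and> ok m (m x) (map m ys))) m"
  using assms
proof (induction ys arbitrary: m)
  case Nil
  then show ?case by (auto intro!: wp_Ops simp: ok_def)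
next
  case (Cons y ys)
  let ?c = "60 * n + 126"
  have s: "13 \<le> z \<and> small_key n m (m z) \<and> 13 \<le> m z" if "z \<in> set (x # y # ys)" for z
    using Cons.prems(2) that small_keyD(1) by blast
  have keep: "m1 2 = 0 \<and> (\<forall>z\<in>set (x # y # ys). 13 \<le> z \<and> small_key n m1 (m z) \<and> m1 z = m z \<and>
      rkey m1 (m z) = rkey m (m z))" if a: "agree tmp m m1" for m1
    using s agree_tmp[OF a] agree_tmp2[OF a] agree_tmp_small_key[OF a] agree_tmp_rkey[OF a]
      Cons.prems(1) by simp
  have s1: "wp (CONTAINS x y) (80 * n + 160) (\<lambda>m'. agree tmp m m' \<and>
    (m' 8 = 0 \<longleftrightarrow> m 8 = 0 \<and> contains (rkey m (m x)) (rkey m (m y)))) m"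
  proof (rule wp_conseq[OF wp_CONTAINS[where m = m and n = n and x = x and y = y]])
    fix m' assume *: "agree {3, 4, 8} m m' \<and> (m' 8 = 0 \<longleftrightarrow> m 8 = 0 \<and> contains (rkey m (m x)) (rkey m (m y)))"
    have "agree tmp m m'" by (rule agree_mono[OF conjunct1[OF *]]) (simp add: tmp_def)
    with * show "agree tmp m m' \<and> (m' 8 = 0 \<longleftrightarrow> m 8 = 0 \<and> contains (rkey m (m x)) (rkey m (m y)))"
      by simp
  qed (use s Cons.prems(1) in simp_all)
  have s2: "wp (COMPATS y ys) (length ys * ?c) (\<lambda>m'. agree tmp m m' \<and>
    (m' 8 = 0 \<longleftrightarrow> m 8 = 0 \<and> contains (rkey m (m x)) (rkey m (m y)) \<and>
      (\<forall>z\<in>set ys. compat (rkey m (m y)) (rkey m (m z))))) m1"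
    if m1: "agree tmp m m1 \<and> (m1 8 = 0 \<longleftrightarrow> m 8 = 0 \<and> contains (rkey m (m x)) (rkey m (m y)))" for m1
  proof -
    note k = keep[OF conjunct1[OF m1]]
    show ?thesis
    proof (rule wp_conseq[OF wp_COMPATS[where n = n]])
      fix m' assume *: "agree tmp m1 m' \<and>
        (m' 8 = 0 \<longleftrightarrow> m1 8 = 0 \<and> (\<forall>z\<in>set ys. compat (rkey m1 (m1 y)) (rkey m1 (m1 z))))"
      have "agree tmp m m'" by (rule agree_trans[OF conjunct1[OF m1] conjunct1[OF *]]) simp_all
      then show "agree tmp m m' \<and> (m' 8 = 0 \<longleftrightarrow> m 8 = 0 \<and> contains (rkey m (m x)) (rkey m (m y)) \<and>
          (\<forall>z\<in>set ys. compat (rkey m (m y)) (rkey m (m z))))"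
        using * m1 k by simp
    qed (use k in simp_all)
  qed
  have s3: "wp (CHECKS x ys) (length ys * (80 * n + 160 + length ys * ?c)) (\<lambda>m'. agree tmp m m' \<and>
    (m' 8 = 0 \<longleftrightarrow> m 8 = 0 \<and> ok m (m x) (map m (y # ys)))) m2"
    if m2: "agree tmp m m2 \<and> (m2 8 = 0 \<longleftrightarrow> m 8 = 0 \<and> contains (rkey m (m x)) (rkey m (m y)) \<and>
      (\<forall>z\<in>set ys. compat (rkey m (m y)) (rkey m (m z))))" for m2
  proof -
    note k = keep[OF conjunct1[OF m2]]
    show ?thesis
    proof (rule wp_conseq[OF Cons.IH])
      fix m' assume *: "agree tmp m2 m' \<and> (m' 8 = 0 \<longleftrightarrow> m2 8 = 0 \<and> ok m2 (m2 x) (map m2 ys))"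
      have "agree tmp m m'" by (rule agree_trans[OF conjunct1[OF m2] conjunct1[OF *]]) simp_all
      moreover have mp: "map m2 ys = map m ys" using k by simp
      have "ok m2 (m2 x) (map m2 ys) \<longleftrightarrow> ok m (m x) (map m ys)"
        unfolding mp using ok_agree[OF conjunct1[OF m2], of "m x" "map m ys"] s k by simp
      ultimately show "agree tmp m m' \<and> (m' 8 = 0 \<longleftrightarrow> m 8 = 0 \<and> ok m (m x) (map m (y # ys)))"
        using * m2 by (auto simp: ok_def)
    qed (use k in simp_all)
  qed
  show ?case unfolding CHECKS.simps
    by (rule wp_SeqI[OF s1], rule wp_SeqI[OF s2], assumption, erule s3) (auto simp: algebra_simps)
qed

definition MEMCPY :: com where
  "MEMCPY = While 7 (Ops [DEC 7, LOADI 3 5, STOREI 6 3, INC 5, INC 6])"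

lemma wp_MEMCPY:
  assumes "m 2 = 0" and s: "13 \<le> s" "m 5 = s" and d: "13 \<le> d" "m 6 = d" and n: "m 7 = n"
    and dis: "s + n \<le> d \<or> d + n \<le> s"
  shows "wp MEMCPY (8 * n + 1) (\<lambda>m'. agree ({3, 5, 6, 7} \<union> {d..<d + n}) m m' \<and> m' 2 = 0 \<and>
    m' 6 = d + n \<and> (\<forall>i<n. m' (d + i) = m (s + i))) m"
proof -
  define I where "I = (\<lambda>j m'. m' 2 = 0 \<and> m' 7 = n - j \<and> m' 5 = s + j \<and> m' 6 = d + j \<and>
    agree ({3, 5, 6, 7} \<union> {d..<d + j}) m m' \<and> (\<forall>i<j. m' (d + i) = m (s + i)))"
  have "wp (While 7 (Ops [DEC 7, LOADI 3 5, STOREI 6 3, INC 5, INC 6])) (n * (5 + 3) + 1) (I n) m"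
  proof (rule wp_While[where I = I])
    show "I 0 m" using assms by (simp add: I_def)
    show "m' 7 = 0 \<longleftrightarrow> j = n" if "j \<le> n" "I j m'" for j m'
      using that by (auto simp: I_def)
    fix j m' assume j: "j < n" and I: "I j m'"
    then have m': "m' 2 = 0" "m' 7 = n - j" "m' 5 = s + j" "m' 6 = d + j"
      and ag: "agree ({3, 5, 6, 7} \<union> {d..<d + j}) m m'" and c: "\<And>i. i < j \<Longrightarrow> m' (d + i) = m (s + i)"
      by (simp_all add: I_def)
    have src: "m' (s + j) = m (s + j)"
      by (rule agreeD[OF ag]) (use s d dis j in auto)
    define m2 where "m2 = m'(7 := n - j - 1, 3 := m (s + j), d + j := m (s + j),
        5 := Suc (s + j), 6 := Suc (d + j))"
    have f: "fold eff [DEC 7, LOADI 3 5, STOREI 6 3, INC 5, INC 6] m' = m2"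
      using m' s d src by (simp add: m2_def)
    have "agree ({3, 5, 6, 7} \<union> {d..<d + Suc j}) m m2"
      unfolding agree_def
    proof (intro allI impI)
      fix x assume x: "x \<notin> {3, 5, 6, 7} \<union> {d..<d + Suc j}"
      then have "m2 x = m' x" by (auto simp: m2_def)
      also have "m' x = m x" by (rule agreeD[OF ag]) (use x in auto)
      finally show "m2 x = m x" .
    qed
    moreover have "m2 (d + i) = m (s + i)" if "i < Suc j" for i
      using that c[of i] d by (cases "i = j") (auto simp: m2_def)
    moreover have "m2 2 = 0" "m2 7 = n - Suc j" "m2 5 = s + Suc j" "m2 6 = d + Suc j"
      using m' d by (auto simp: m2_def)
    ultimately have "I (Suc j) m2" by (simp add: I_def)
    moreover have "m2(2 := 0) = m2" using \<open>m2 2 = 0\<close> by (simp add: fun_eq_iff)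
    ultimately show "wp (Ops [DEC 7, LOADI 3 5, STOREI 6 3, INC 5, INC 6]) 5
        (\<lambda>m'. I (Suc j) (m'(2 := 0))) m'"
      by (intro wp_Ops) (simp_all only: f, simp_all)
  qed
  then show ?thesis unfolding MEMCPY_def by (rule wp_conseq) (simp_all add: I_def)
qed

definition APPEND :: "nat \<Rightarrow> com" where
  "APPEND y = Ops (FLD 7 y 8) ;; ADD 12 7 ;; Ops (CPY 5 y # replicate 9 (INC 5)) ;; MEMCPY"

lemma wp_APPEND:
  assumes m: "m 2 = 0" "13 \<le> y" "13 \<le> m y" and L: "m (m y + 8) = L" "m y + 9 + L \<le> m 6" "L \<le> l"
  shows "wp (APPEND y) (13 * l + 23) (\<lambda>m'. agree (tmp \<union> {m 6..<m 6 + L}) m m' \<and> m' 2 = 0 \<and>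
    m' 6 = m 6 + L \<and> m' 12 = m 12 + L \<and> (\<forall>i<L. m' (m 6 + i) = m (m y + 9 + i))) m"
proof -
  define m1 where "m1 = m(7 := L)"
  define m2 where "m2 = m(7 := L, 3 := 0, 12 := m 12 + L)"
  define m3 where "m3 = m(7 := L, 3 := 0, 12 := m 12 + L, 5 := m y + 9)"
  have s1: "wp (Ops (FLD 7 y 8)) 10 (\<lambda>m'. m' = m1) m"
    by (rule wp_Ops) (use assms in \<open>simp_all add: jump_free_FLD length_FLD fold_FLD m1_def\<close>)
  have s2: "wp (ADD 12 7) (5 * l + 2) (\<lambda>m'. m' = m2) m'" if "m' = m1" for m'
    by (rule wp_conseq[OF wp_ADD[where T = "5 * l + 2"]]) (use that assms in \<open>simp_all add: m1_def m2_def\<close>)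
  have s3: "wp (Ops (CPY 5 y # replicate 9 (INC 5))) 10 (\<lambda>m'. m' = m3) m'" if "m' = m2" for m'
    by (rule wp_Ops)
      (use that assms in \<open>simp_all add: jump_free_replicate fold_INC m2_def m3_def del: fold_replicate\<close>)
  have s4: "wp MEMCPY (8 * l + 1) (\<lambda>m'. agree (tmp \<union> {m 6..<m 6 + L}) m m' \<and> m' 2 = 0 \<and>
    m' 6 = m 6 + L \<and> m' 12 = m 12 + L \<and> (\<forall>i<L. m' (m 6 + i) = m (m y + 9 + i))) m'" if "m' = m3" for m'
    unfolding that
  proof (rule wp_conseq[OF wp_MEMCPY[where s = "m y + 9" and d = "m 6" and n = L]])
    fix m' assume *: "agree ({3, 5, 6, 7} \<union> {m 6..<m 6 + L}) m3 m' \<and> m' 2 = 0 \<and>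
      m' 6 = m 6 + L \<and> (\<forall>i<L. m' (m 6 + i) = m3 (m y + 9 + i))"
    have "agree tmp m m3" by (simp add: agree_def m3_def tmp_def)
    from agree_trans[OF this conjunct1[OF *], of "tmp \<union> {m 6..<m 6 + L}"]
    have "agree (tmp \<union> {m 6..<m 6 + L}) m m'" by (simp add: tmp_def)
    moreover have "m' 12 = m3 12" by (rule agreeD[OF conjunct1[OF *]]) (use assms in simp)
    moreover have "m3 12 = m 12 + L" by (simp add: m3_def)
    moreover have "m3 (m y + 9 + i) = m (m y + 9 + i)" for i using m by (simp add: m3_def)
    ultimately show "agree (tmp \<union> {m 6..<m 6 + L}) m m' \<and> m' 2 = 0 \<and>
      m' 6 = m 6 + L \<and> m' 12 = m 12 + L \<and> (\<forall>i<L. m' (m 6 + i) = m (m y + 9 + i))"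
      using * by simp
  qed (use assms in \<open>simp_all add: m3_def\<close>)
  show ?thesis unfolding APPEND_def
    by (rule wp_SeqI[OF s1], rule wp_SeqI[OF s2], assumption, rule wp_SeqI[OF s3], assumption, erule s4,
      (rule le_refl)+) simp
qed

fun APPENDS :: "nat list \<Rightarrow> com" where
  "APPENDS [] = Ops []"
| "APPENDS (y # ys) = APPEND y ;; APPENDS ys"

lemma wp_APPENDS:
  assumes "m 2 = 0" "13 \<le> m 6"
    and "\<forall>y\<in>set ys. 13 \<le> y \<and> 13 \<le> m y \<and> m (m y + 8) \<le> l \<and> m y + 9 + m (m y + 8) \<le> m 6 \<and> y < m 6"
  defines "cat \<equiv> concat (map (\<lambda>y. rlist m (m y)) ys)"
  shows "wp (APPENDS ys) (length ys * (13 * l + 23)) (\<lambda>m'. agree (tmp \<union> {m 6..}) m m' \<and> m' 2 = 0 \<and>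
    m' 6 = m 6 + length cat \<and> m' 12 = m 12 + length cat \<and>
    (\<forall>i<length cat. m' (m 6 + i) = cat ! i)) m"
  using assms(1-3) unfolding cat_def
proof (induction ys arbitrary: m)
  case Nil
  then show ?case by (auto intro!: wp_Ops)
next
  case (Cons y ys)
  let ?L = "m (m y + 8)"
  let ?cat = "concat (map (\<lambda>y. rlist m (m y)) ys)"
  show ?case unfolding APPENDS.simps
  proof (rule wp_SeqI[OF wp_APPEND[where m = m and y = y and L = ?L and l = l]])
    fix m1 assume *: "agree (tmp \<union> {m 6..<m 6 + ?L}) m m1 \<and> m1 2 = 0 \<and>
      m1 6 = m 6 + ?L \<and> m1 12 = m 12 + ?L \<and> (\<forall>i<?L. m1 (m 6 + i) = m (m y + 9 + i))"
    note a = agreeD[OF conjunct1[OF *]]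
    have low: "m1 x = m x" if "13 \<le> x" "x < m 6" for x by (rule a) (use that in \<open>simp add: tmp_def\<close>)
    have s: "13 \<le> z \<and> 13 \<le> m z \<and> m (m z + 8) \<le> l \<and> m z + 9 + m (m z + 8) \<le> m 6 \<and> z < m 6"
      if "z \<in> set ys" for z using Cons.prems(3) that by simp
    have s1: "m1 z = m z \<and> m1 (m z + 8) = m (m z + 8)" if "z \<in> set ys" for z
      using s[OF that] by (simp add: low)
    have rl: "rlist m1 (m1 z) = rlist m (m z)" if "z \<in> set ys" for z
      using s[OF that] s1[OF that] by (simp add: rlist_def low)
    have cat: "concat (map (\<lambda>y. rlist m1 (m1 y)) ys) = ?cat"
      using rl by (metis (mono_tags, lifting) map_eq_conv)
    have "wp (APPENDS ys) (length ys * (13 * l + 23)) (\<lambda>m'. agree (tmp \<union> {m1 6..}) m1 m' \<and> m' 2 = 0 \<and>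
      m' 6 = m1 6 + length ?cat \<and> m' 12 = m1 12 + length ?cat \<and>
      (\<forall>i<length ?cat. m' (m1 6 + i) = ?cat ! i)) m1"
      unfolding cat[symmetric]
    proof (rule Cons.IH)
      show "\<forall>y\<in>set ys. 13 \<le> y \<and> 13 \<le> m1 y \<and> m1 (m1 y + 8) \<le> l \<and>
          m1 y + 9 + m1 (m1 y + 8) \<le> m1 6 \<and> y < m1 6"
      proof
        fix z assume z: "z \<in> set ys"
        show "13 \<le> z \<and> 13 \<le> m1 z \<and> m1 (m1 z + 8) \<le> l \<and> m1 z + 9 + m1 (m1 z + 8) \<le> m1 6 \<and> z < m1 6"
          using s[OF z] s1[OF z] * by (simp add: trans_le_add1 trans_less_add1)
      qed
    qed (use * Cons.prems in simp_all)
    then show "wp (APPENDS ys) (length ys * (13 * l + 23)) (\<lambda>m'. agree (tmp \<union> {m 6..}) m m' \<and> m' 2 = 0 \<and>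
      m' 6 = m 6 + length (concat (map (\<lambda>y. rlist m (m y)) (y # ys))) \<and>
      m' 12 = m 12 + length (concat (map (\<lambda>y. rlist m (m y)) (y # ys))) \<and>
      (\<forall>i<length (concat (map (\<lambda>y. rlist m (m y)) (y # ys))).
        m' (m 6 + i) = concat (map (\<lambda>y. rlist m (m y)) (y # ys)) ! i)) m1"
    proof (rule wp_conseq)
      fix m' assume **: "agree (tmp \<union> {m1 6..}) m1 m' \<and> m' 2 = 0 \<and>
        m' 6 = m1 6 + length ?cat \<and> m' 12 = m1 12 + length ?cat \<and>
        (\<forall>i<length ?cat. m' (m1 6 + i) = ?cat ! i)"
      have "agree (tmp \<union> {m 6..}) m m'"
        by (rule agree_trans[OF conjunct1[OF *] conjunct1[OF **]]) (use * in auto)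
      moreover have "m' (m 6 + i) = (rlist m (m y) @ ?cat) ! i" if "i < ?L + length ?cat" for i
      proof (cases "i < ?L")
        case True
        have "m' (m 6 + i) = m1 (m 6 + i)"
          by (rule agreeD[OF conjunct1[OF **]]) (use True * Cons.prems(2) in \<open>simp add: tmp_def\<close>)
        then show ?thesis using * True by (simp add: nth_append rlist_def)
      next
        case False
        then have "i - ?L < length ?cat" using that by linarith
        then have "m' (m1 6 + (i - ?L)) = ?cat ! (i - ?L)" using ** by blast
        moreover have "m1 6 + (i - ?L) = m 6 + i" using * False by simp
        ultimately show ?thesis using False by (simp add: nth_append)
      qed
      ultimately show "agree (tmp \<union> {m 6..}) m m' \<and> m' 2 = 0 \<and>
        m' 6 = m 6 + length (concat (map (\<lambda>y. rlist m (m y)) (y # ys))) \<and>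
        m' 12 = m 12 + length (concat (map (\<lambda>y. rlist m (m y)) (y # ys))) \<and>
        (\<forall>i<length (concat (map (\<lambda>y. rlist m (m y)) (y # ys))).
          m' (m 6 + i) = concat (map (\<lambda>y. rlist m (m y)) (y # ys)) ! i)"
        using * ** by simp
    qed simp
  qed (use Cons.prems in simp_all)
qed


definition BODY :: "nat \<Rightarrow> nat list \<Rightarrow> com" where
  "BODY x ys = Ops [CLR 8] ;; CHECKS x ys ;; Ops [CLR 11, INC 11] ;; IfNZ 8 (Ops [CLR 11]) ;;
    IfNZ 11 (Ops [CPY 6 24, CLR 12] ;; APPENDS ys ;; Ops (FLD 4 x 8 @ [CPY 9 12]) ;;
      While 4 (Ops [DEC 4, DEC 9]) ;;
      IfNZ 9 (Ops (CPY 3 x # replicate 8 (INC 3) @ [STOREI 3 12, INC 3, CPY 6 3, CPY 5 24, CPY 7 12]) ;;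
        MEMCPY))"

definition body_time :: "nat \<Rightarrow> nat \<Rightarrow> nat" where
  "body_time k n = k * (80 * n + 160 + k * (60 * n + 126)) + k * (13 * n + 23) + 13 * n + 60"

lemma wp_BODY:
  assumes m: "m 2 = 0" and b: "m 24 = buf"
    and pre: "\<forall>y\<in>set (x # ys). 25 \<le> y \<and> y < buf \<and> small_key n m (m y) \<and> 25 \<le> m y \<and>
      m (m y + 8) \<le> n \<and> m y + 9 + n \<le> buf"
  defines "cat \<equiv> concat (map (\<lambda>y. rlist m (m y)) ys)"
  assumes cat: "ok m (m x) (map m ys) \<Longrightarrow> length cat \<le> n"
  shows "wp (BODY x ys) (body_time (length ys) n) (\<lambda>m'. m' 2 = 0 \<and>
    agree (tmp \<union> {m x + 8..<m x + 9 + n} \<union> {buf..}) m m' \<and>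
    (if ok m (m x) (map m ys) \<and> m (m x + 8) < length cat then rlist m' (m x) = cat
     else agree (tmp \<union> {buf..}) m m')) m"
proof -
  define k where "k = length ys"
  define p where "p = m x"
  define ck where "ck \<longleftrightarrow> ok m p (map m ys)"
  define Q where "Q = (\<lambda>m'. m' 2 = 0 \<and> agree (tmp \<union> {p + 8..<p + 9 + n} \<union> {buf..}) m m' \<and>
    (if ck \<and> m (p + 8) < length cat then rlist m' p = cat else agree (tmp \<union> {buf..}) m m'))"
  have px: "25 \<le> x" "x < buf" "25 \<le> p" "m (p + 8) \<le> n" "p + 9 + n \<le> buf"
    using pre by (simp_all add: p_def)
  have pre13: "\<forall>y\<in>set (x # ys). 13 \<le> y \<and> small_key n m (m y)"
  proof
    fix y assume "y \<in> set (x # ys)"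
    from bspec[OF pre this] show "13 \<le> y \<and> small_key n m (m y)" by simp
  qed
  have m13: "\<forall>q\<in>set (p # map m ys). 13 \<le> q"
    using pre13 small_keyD(1) unfolding p_def by (metis (no_types, lifting) image_iff list.set(2) list.set_map insert_iff)
  have keep: "m' 2 = 0 \<and> m' 24 = buf \<and> (\<forall>y\<in>set (x # ys). m' y = m y \<and> small_key n m' (m y) \<and>
      m' (m y + 8) = m (m y + 8) \<and> rlist m' (m y) = rlist m (m y))" if a: "agree tmp m m'" for m'
  proof -
    have "m' y = m y \<and> small_key n m' (m y) \<and> m' (m y + 8) = m (m y + 8) \<and> rlist m' (m y) = rlist m (m y)"
      if "y \<in> set (x # ys)" for y
      using bspec[OF pre that] agree_tmp[OF a] agree_tmp_small_key[OF a] agree_tmp_rlist[OF a] by simp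
    moreover have "m' 2 = 0" "m' 24 = buf" using m b agree_tmp[OF a, of 24] agree_tmp2[OF a] by simp_all
    ultimately show ?thesis by blast
  qed
  have s1: "wp (Ops [CLR 8]) 1 (\<lambda>m'. agree tmp m m' \<and> m' 8 = 0) m"
    by (rule wp_Ops) (simp_all add: agree_def tmp_def)
  have s2: "wp (CHECKS x ys) (k * (80 * n + 160 + k * (60 * n + 126)))
      (\<lambda>m'. agree tmp m m' \<and> (m' 8 = 0 \<longleftrightarrow> ck)) m1" if m1: "agree tmp m m1 \<and> m1 8 = 0" for m1
  proof -
    note kp = keep[OF conjunct1[OF m1]]
    show ?thesis unfolding k_def
    proof (rule wp_conseq[OF wp_CHECKS[where n = n]])
      fix m' assume *: "agree tmp m1 m' \<and> (m' 8 = 0 \<longleftrightarrow> m1 8 = 0 \<and> ok m1 (m1 x) (map m1 ys))"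
      have "agree tmp m m'" by (rule agree_trans[OF conjunct1[OF m1] conjunct1[OF *]]) simp_all
      moreover have mp: "map m1 ys = map m ys" and "m1 x = p" using kp by (simp_all add: p_def)
      moreover have "ok m1 p (map m ys) \<longleftrightarrow> ck"
        unfolding ck_def by (rule ok_agree[OF conjunct1[OF m1] m13])
      ultimately show "agree tmp m m' \<and> (m' 8 = 0 \<longleftrightarrow> ck)" using *[unfolded mp] m1 by simp
    qed (use kp pre13 in simp_all)
  qed
  have s3: "wp (Ops [CLR 11, INC 11]) 2 (\<lambda>m'. agree tmp m m' \<and> (m' 8 = 0 \<longleftrightarrow> ck) \<and> m' 11 = 1) m1"
    if "agree tmp m m1 \<and> (m1 8 = 0 \<longleftrightarrow> ck)" for m1
    by (rule wp_Ops) (use that in \<open>simp_all add: agree_def tmp_def\<close>)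
  have s4: "wp (IfNZ 8 (Ops [CLR 11])) (Suc 1) (\<lambda>m'. agree tmp m m' \<and> (m' 11 = 0 \<longleftrightarrow> \<not> ck)) m1"
    if "agree tmp m m1 \<and> (m1 8 = 0 \<longleftrightarrow> ck) \<and> m1 11 = 1" for m1
    by (intro wp_IfNZ wp_Ops) (use that in \<open>simp_all add: agree_def tmp_def\<close>)
  define lc where "lc = length cat"
  have t1: "wp (Ops [CPY 6 24, CLR 12]) 2 (\<lambda>m'. agree tmp m m' \<and> m' 6 = buf \<and> m' 12 = 0) m1"
    if "agree tmp m m1" for m1
    by (rule wp_Ops) (use that keep[OF that] in \<open>simp_all add: agree_def tmp_def\<close>)
  have t2: "wp (APPENDS ys) (k * (13 * n + 23))
      (\<lambda>m'. agree (tmp \<union> {buf..}) m m' \<and> m' 2 = 0 \<and> m' 12 = lc \<and> (\<forall>i<lc. m' (buf + i) = cat ! i)) m1"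
    if m1: "agree tmp m m1 \<and> m1 6 = buf \<and> m1 12 = 0" for m1
  proof -
    note kp = keep[OF conjunct1[OF m1]]
    have rl: "map (\<lambda>y. rlist m1 (m1 y)) ys = map (\<lambda>y. rlist m (m y)) ys" using kp by simp
    have "wp (APPENDS ys) (length ys * (13 * n + 23)) (\<lambda>m'. agree (tmp \<union> {m1 6..}) m1 m' \<and> m' 2 = 0 \<and>
        m' 6 = m1 6 + length cat \<and> m' 12 = m1 12 + length cat \<and>
        (\<forall>i<length cat. m' (m1 6 + i) = cat ! i)) m1"
      unfolding cat_def rl[symmetric]
    proof (rule wp_APPENDS)
      show "\<forall>y\<in>set ys. 13 \<le> y \<and> 13 \<le> m1 y \<and> m1 (m1 y + 8) \<le> n \<and>
          m1 y + 9 + m1 (m1 y + 8) \<le> m1 6 \<and> y < m1 6"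
      proof
        fix y assume y: "y \<in> set ys"
        then have "m1 y = m y" "m1 (m y + 8) = m (m y + 8)" using kp by simp_all
        then show "13 \<le> y \<and> 13 \<le> m1 y \<and> m1 (m1 y + 8) \<le> n \<and>
          m1 y + 9 + m1 (m1 y + 8) \<le> m1 6 \<and> y < m1 6"
          using bspec[OF pre, of y] y m1 by simp
      qed
    qed (use kp m1 px in simp_all)
    then show ?thesis
    proof (rule wp_conseq)
      fix m' assume *: "agree (tmp \<union> {m1 6..}) m1 m' \<and> m' 2 = 0 \<and>
        m' 6 = m1 6 + length cat \<and> m' 12 = m1 12 + length cat \<and>
        (\<forall>i<length cat. m' (m1 6 + i) = cat ! i)"
      have "agree (tmp \<union> {buf..}) m m'"
        by (rule agree_trans[OF conjunct1[OF m1] conjunct1[OF *]]) (use m1 in simp_all)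
      then show "agree (tmp \<union> {buf..}) m m' \<and> m' 2 = 0 \<and> m' 12 = lc \<and> (\<forall>i<lc. m' (buf + i) = cat ! i)"
        using * m1 by (simp add: lc_def)
    qed (simp add: k_def)
  qed
  have low: "m1 z = m z" if "agree (tmp \<union> {buf..}) m m1" "13 \<le> z" "z < buf" for m1 z
    by (rule agreeD[OF that(1)]) (use that in \<open>simp add: tmp_def\<close>)
  have t3: "wp (Ops (FLD 4 x 8 @ [CPY 9 12])) 11 (\<lambda>m'. agree (tmp \<union> {buf..}) m m' \<and> m' 2 = 0 \<and>
      m' 12 = lc \<and> (\<forall>i<lc. m' (buf + i) = cat ! i) \<and> m' 9 = lc \<and> m' 4 = m (p + 8)) m1"
    if m1: "agree (tmp \<union> {buf..}) m m1 \<and> m1 2 = 0 \<and> m1 12 = lc \<and> (\<forall>i<lc. m1 (buf + i) = cat ! i)" for m1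
  proof (rule wp_Ops)
    have x: "m1 x = p" "m1 (p + 8) = m (p + 8)" using low[OF conjunct1[OF m1]] px by (simp_all add: p_def)
    then have f: "fold eff (FLD 4 x 8 @ [CPY 9 12]) m1 = m1(4 := m (p + 8), 9 := lc)"
      using px m1 by (simp add: fold_FLD)
    show "agree (tmp \<union> {buf..}) m (fold eff (FLD 4 x 8 @ [CPY 9 12]) m1) \<and>
      fold eff (FLD 4 x 8 @ [CPY 9 12]) m1 2 = 0 \<and> fold eff (FLD 4 x 8 @ [CPY 9 12]) m1 12 = lc \<and>
      (\<forall>i<lc. fold eff (FLD 4 x 8 @ [CPY 9 12]) m1 (buf + i) = cat ! i) \<and>
      fold eff (FLD 4 x 8 @ [CPY 9 12]) m1 9 = lc \<and> fold eff (FLD 4 x 8 @ [CPY 9 12]) m1 4 = m (p + 8)"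
      unfolding f using m1 px by (simp add: agree_def tmp_def)
  qed (simp_all add: jump_free_FLD length_FLD)
  have t4: "wp (While 4 (Ops [DEC 4, DEC 9])) (5 * n + 1) (\<lambda>m'. agree (tmp \<union> {buf..}) m m' \<and> m' 2 = 0 \<and>
      m' 12 = lc \<and> (\<forall>i<lc. m' (buf + i) = cat ! i) \<and> m' 9 = lc - m (p + 8)) m1"
    if m1: "agree (tmp \<union> {buf..}) m m1 \<and> m1 2 = 0 \<and> m1 12 = lc \<and> (\<forall>i<lc. m1 (buf + i) = cat ! i) \<and>
      m1 9 = lc \<and> m1 4 = m (p + 8)" for m1
    by (rule wp_conseq[OF wp_drain_DEC]) (use m1 px in \<open>simp_all add: agree_def tmp_def\<close>)
  have t5: "wp (Ops (CPY 3 x # replicate 8 (INC 3) @ [STOREI 3 12, INC 3, CPY 6 3, CPY 5 24, CPY 7 12]) ;; MEMCPY)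
      (8 * n + 15) Q m1"
    if m1: "agree (tmp \<union> {buf..}) m m1 \<and> m1 2 = 0 \<and> m1 12 = lc \<and> (\<forall>i<lc. m1 (buf + i) = cat ! i) \<and>
      m1 9 = lc - m (p + 8)" and nz: "m1 9 \<noteq> 0" and ck for m1
  proof -
    have lcn: "lc \<le> n" using cat \<open>ck\<close> by (simp add: lc_def ck_def p_def)
    have x: "m1 x = p" "m1 24 = buf" using low[OF conjunct1[OF m1], of x] low[OF conjunct1[OF m1], of 24] px b
      by (simp_all add: p_def)
    define m2 where "m2 = m1(3 := p + 9, p + 8 := lc, 6 := p + 9, 5 := buf, 7 := lc)"
    have f: "fold eff (CPY 3 x # replicate 8 (INC 3) @ [STOREI 3 12, INC 3, CPY 6 3, CPY 5 24, CPY 7 12]) m1 = m2"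
      using x m1 px by (simp add: fold_INC m2_def fun_eq_iff del: fold_replicate)
    have a2: "agree (tmp \<union> {p + 8..<p + 9 + n} \<union> {buf..}) m m2"
      using m1 by (simp add: agree_def m2_def tmp_def)
    have u1: "wp (Ops (CPY 3 x # replicate 8 (INC 3) @ [STOREI 3 12, INC 3, CPY 6 3, CPY 5 24, CPY 7 12])) 14
        (\<lambda>m'. m' = m2) m1"
      by (rule wp_Ops) (simp_all only: f, simp_all add: jump_free_replicate)
    have u2: "wp MEMCPY (8 * n + 1) Q m'" if "m' = m2" for m'
      unfolding that
    proof (rule wp_conseq[OF wp_MEMCPY[where s = buf and d = "p + 9" and n = lc]])
      fix m' assume *: "agree ({3, 5, 6, 7} \<union> {p + 9..<p + 9 + lc}) m2 m' \<and> m' 2 = 0 \<and>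
        m' 6 = p + 9 + lc \<and> (\<forall>i<lc. m' (p + 9 + i) = m2 (buf + i))"
      have sub: "{3, 5, 6, 7} \<union> {p + 9..<p + 9 + lc} \<subseteq> tmp \<union> {p + 8..<p + 9 + n} \<union> {buf..}"
        using lcn by (auto simp: tmp_def)
      have "agree (tmp \<union> {p + 8..<p + 9 + n} \<union> {buf..}) m m'"
        by (rule agree_trans[OF a2 conjunct1[OF *] _ sub]) simp
      moreover have "m' (p + 8) = lc"
      proof -
        have "m' (p + 8) = m2 (p + 8)" by (rule agreeD[OF conjunct1[OF *]]) (use px in simp)
        also have "\<dots> = lc" using px by (simp add: m2_def)
        finally show ?thesis .
      qed
      moreover have "m' (p + 9 + i) = cat ! i" if "i < lc" for i
      proof -
        have "m2 (buf + i) = m1 (buf + i)" using px by (simp add: m2_def)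
        then show ?thesis using * m1 that by simp
      qed
      ultimately have "rlist m' p = cat" "agree (tmp \<union> {p + 8..<p + 9 + n} \<union> {buf..}) m m'" "m' 2 = 0"
        using * by (auto simp: rlist_def lc_def intro!: nth_equalityI)
      moreover have "m (p + 8) < length cat" using nz m1 by (simp add: lc_def)
      ultimately show "Q m'" using \<open>ck\<close> by (simp add: Q_def)
    qed (use lcn px m1 in \<open>simp_all add: m2_def\<close>)
    show ?thesis by (rule wp_SeqI[OF u1], erule u2) simp
  qed
  have t6: "wp (IfNZ 9 (Ops (CPY 3 x # replicate 8 (INC 3) @ [STOREI 3 12, INC 3, CPY 6 3, CPY 5 24, CPY 7 12]) ;; MEMCPY))
      (Suc (8 * n + 15)) Q m1"
    if m1: "agree (tmp \<union> {buf..}) m m1 \<and> m1 2 = 0 \<and> m1 12 = lc \<and> (\<forall>i<lc. m1 (buf + i) = cat ! i) \<and>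
      m1 9 = lc - m (p + 8)" and ck for m1
  proof (rule wp_IfNZ)
    assume "m1 9 = 0"
    then have "\<not> m (p + 8) < length cat" using m1 by (simp add: lc_def)
    moreover have "agree (tmp \<union> {p + 8..<p + 9 + n} \<union> {buf..}) m m1"
      by (rule agree_mono[OF conjunct1[OF m1]]) auto
    ultimately show "Q m1" using m1 by (simp add: Q_def)
  next
    assume "m1 9 \<noteq> 0"
    then show "wp (Ops (CPY 3 x # replicate 8 (INC 3) @ [STOREI 3 12, INC 3, CPY 6 3, CPY 5 24, CPY 7 12]) ;; MEMCPY)
      (8 * n + 15) Q m1" by (rule t5[OF m1 _ \<open>ck\<close>])
  qed
  have s5: "wp (IfNZ 11 (Ops [CPY 6 24, CLR 12] ;; APPENDS ys ;; Ops (FLD 4 x 8 @ [CPY 9 12]) ;;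
      While 4 (Ops [DEC 4, DEC 9]) ;;
      IfNZ 9 (Ops (CPY 3 x # replicate 8 (INC 3) @ [STOREI 3 12, INC 3, CPY 6 3, CPY 5 24, CPY 7 12]) ;; MEMCPY)))
      (Suc (k * (13 * n + 23) + 13 * n + 50)) Q m1"
    if m1: "agree tmp m m1 \<and> (m1 11 = 0 \<longleftrightarrow> \<not> ck)" for m1
  proof (rule wp_IfNZ)
    assume "m1 11 = 0"
    moreover have "agree (tmp \<union> {p + 8..<p + 9 + n} \<union> {buf..}) m m1" "agree (tmp \<union> {buf..}) m m1"
      by (rule agree_mono[OF conjunct1[OF m1]], auto)+
    ultimately show "Q m1" using m1 keep[OF conjunct1[OF m1]] by (simp add: Q_def)
  next
    assume "m1 11 \<noteq> 0"
    then have ck using m1 by simp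
    show "wp (Ops [CPY 6 24, CLR 12] ;; APPENDS ys ;; Ops (FLD 4 x 8 @ [CPY 9 12]) ;;
      While 4 (Ops [DEC 4, DEC 9]) ;;
      IfNZ 9 (Ops (CPY 3 x # replicate 8 (INC 3) @ [STOREI 3 12, INC 3, CPY 6 3, CPY 5 24, CPY 7 12]) ;; MEMCPY))
      (k * (13 * n + 23) + 13 * n + 50) Q m1"
      by (rule wp_SeqI[OF t1[OF conjunct1[OF m1]]], rule wp_SeqI[OF t2], assumption, rule wp_SeqI[OF t3],
          assumption, rule wp_SeqI[OF t4], assumption, erule t6[OF _ \<open>ck\<close>], (rule le_refl)+) simp
  qed
  have "wp (BODY x ys) (body_time (length ys) n) Q m" unfolding BODY_def
    by (rule wp_SeqI[OF s1], rule wp_SeqI[OF s2], assumption, rule wp_SeqI[OF s3], assumption,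
        rule wp_SeqI[OF s4], assumption, erule s5, (rule le_refl)+) (simp add: body_time_def k_def)
  then show ?thesis unfolding Q_def ck_def p_def .
qed

section \<open>Nested loops and the dynamic program\<close>

definition xr :: "nat \<Rightarrow> nat" where "xr i = 60 + 2 * i"
definition cr :: "nat \<Rightarrow> nat" where "cr i = 61 + 2 * i"

lemma xr_simps [simp]:
  "xr i = xr j \<longleftrightarrow> i = j" "cr i = cr j \<longleftrightarrow> i = j" "xr i \<noteq> cr j" "cr j \<noteq> xr i"
  "r < 60 \<Longrightarrow> xr i \<noteq> r" "r < 60 \<Longrightarrow> r \<noteq> xr i" "r < 60 \<Longrightarrow> cr i \<noteq> r" "r < 60 \<Longrightarrow> r \<noteq> cr i"
  "60 \<le> xr i" "60 \<le> cr i"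
  unfolding xr_def cr_def by presburger+

definition ctl :: "nat list \<Rightarrow> nat set" where
  "ctl is = {3} \<union> xr ` set is \<union> cr ` set is"

definition LOOP :: "nat \<Rightarrow> nat \<Rightarrow> nat \<Rightarrow> nat \<Rightarrow> com \<Rightarrow> com" where
  "LOOP start cnt stride i body = Ops [CPY (xr i) start, CPY (cr i) cnt] ;;
     While (cr i) (Ops [DEC (cr i)] ;; body ;; ADD (xr i) stride)"

fun NEST :: "nat \<Rightarrow> nat \<Rightarrow> nat \<Rightarrow> nat list \<Rightarrow> com \<Rightarrow> com" where
  "NEST start cnt stride [] body = body"
| "NEST start cnt stride (i # is) body = LOOP start cnt stride i (NEST start cnt stride is body)"

fun nest_time :: "nat \<Rightarrow> nat \<Rightarrow> nat \<Rightarrow> nat \<Rightarrow> nat" where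
  "nest_time n h T 0 = T"
| "nest_time n h T (Suc k) = 3 + n * (nest_time n h T k + 5 * h + 6)"

text \<open>The list \<open>H\<close> records the index tuples that have been processed so far.\<close>

lemma wp_NEST:
  fixes J :: "nat list list \<Rightarrow> mem \<Rightarrow> bool" and s h n :: nat
  defines "vs \<equiv> map (\<lambda>j. s + j * h) [0..<n]"
  assumes r: "start < 60" "cnt < 60" "stride < 60" "start \<noteq> 3" "cnt \<noteq> 3" "stride \<noteq> 3"
    and "distinct is"
    and "\<And>H m. J H m \<Longrightarrow> m 2 = 0 \<and> m start = s \<and> m cnt = n \<and> m stride = h"
    and "\<And>H m m'. J H m \<Longrightarrow> agree (ctl is) m m' \<Longrightarrow> J H m'"
    and "\<And>H m. J H m \<Longrightarrow> \<forall>i\<in>set is. m (xr i) \<in> set vs \<Longrightarrow>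
      wp body T (\<lambda>m'. J (H @ [map (\<lambda>i. m (xr i)) is]) m' \<and>
        (\<forall>i\<in>set is. m' (xr i) = m (xr i) \<and> m' (cr i) = m (cr i))) m"
    and "J H m"
  shows "wp (NEST start cnt stride is body) (nest_time n h T (length is))
    (J (H @ product_lists (replicate (length is) vs))) m"
  using assms(8-12)
proof (induction "is" arbitrary: J H m)
  case Nil
  from Nil.prems(4)[OF Nil.prems(5)] show ?case by (auto elim: wp_conseq)
next
  case (Cons i ks)
  let ?P = "product_lists (replicate (length ks) vs)"
  let ?t = "nest_time n h T (length ks)"
  note glob = Cons.prems(2) and stable = Cons.prems(3) and body = Cons.prems(4)
  have i: "i \<notin> set ks" "distinct ks" using Cons.prems(1) by auto
  define I where "I = (\<lambda>j m'. J (H @ concat (map (\<lambda>v. map (Cons v) ?P) (take j vs))) m' \<and>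
    m' (cr i) = n - j \<and> m' (xr i) = s + j * h)"
  have s1: "wp (Ops [CPY (xr i) start, CPY (cr i) cnt]) 2 (I 0) m"
  proof (rule wp_Ops)
    let ?m = "fold eff [CPY (xr i) start, CPY (cr i) cnt] m"
    have "agree (ctl (i # ks)) m ?m" by (simp add: agree_def ctl_def)
    then have "J H ?m" using stable Cons.prems(5) by blast
    then show "I 0 ?m" using glob[OF Cons.prems(5)] r by (simp add: I_def)
  qed simp_all
  have step: "wp (Ops [DEC (cr i)] ;; NEST start cnt stride ks body ;; ADD (xr i) stride) (?t + 5 * h + 3)
      (\<lambda>m'. I (Suc j) (m'(2 := 0))) m1" if j: "j < n" and I: "I j m1" for j m1
  proof -
    define v where "v = s + j * h"
    define H1 where "H1 = H @ concat (map (\<lambda>v. map (Cons v) ?P) (take j vs))"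
    define J' where "J' = (\<lambda>H' m'. J (H1 @ map (Cons v) H') m' \<and> m' (xr i) = v \<and> m' (cr i) = n - Suc j)"
    have v: "v \<in> set vs" "vs ! j = v" "j < length vs" using j by (auto simp: v_def vs_def)
    have J1: "J H1 m1" "m1 (xr i) = v" "m1 (cr i) = n - j" using I by (simp_all add: I_def H1_def v_def)
    have u1: "wp (Ops [DEC (cr i)]) 1 (J' []) m1"
    proof (rule wp_Ops)
      let ?m = "fold eff [DEC (cr i)] m1"
      have "agree (ctl (i # ks)) m1 ?m" by (simp add: agree_def ctl_def)
      then have "J H1 ?m" using stable J1(1) by blast
      then show "J' [] ?m" using J1 by (simp add: J'_def)
    qed simp_all
    have u2: "wp (NEST start cnt stride ks body) ?t (J' ([] @ ?P)) m2" if "J' [] m2" for m2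
    proof (rule Cons.IH)
      show "m 2 = 0 \<and> m start = s \<and> m cnt = n \<and> m stride = h" if "J' H' m" for H' m
        using that glob[of "H1 @ map (Cons v) H'" m] by (simp add: J'_def)
      show "J' H' m'" if J': "J' H' m" and a: "agree (ctl ks) m m'" for H' m m'
      proof -
        have "agree (ctl (i # ks)) m m'" by (rule agree_mono[OF a]) (auto simp: ctl_def)
        then have "J (H1 @ map (Cons v) H') m'" using J' stable unfolding J'_def by blast
        moreover have "m' (xr i) = m (xr i)" "m' (cr i) = m (cr i)"
          by (rule agreeD[OF a]; use i in \<open>auto simp: ctl_def\<close>)+
        ultimately show ?thesis using J' by (simp add: J'_def)
      qed
      show "wp body T (\<lambda>m'. J' (H' @ [map (\<lambda>i. m (xr i)) ks]) m' \<and>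
          (\<forall>i\<in>set ks. m' (xr i) = m (xr i) \<and> m' (cr i) = m (cr i))) m"
        if J': "J' H' m" and ran: "\<forall>i\<in>set ks. m (xr i) \<in> set vs" for H' m
      proof -
        have "J (H1 @ map (Cons v) H') m" "\<forall>k\<in>set (i # ks). m (xr k) \<in> set vs"
          using J' ran v by (simp_all add: J'_def)
        from body[OF this] show ?thesis
          using J' by (elim wp_conseq) (auto simp: J'_def)
      qed
    qed (use that i in simp_all)
    have u3: "wp (ADD (xr i) stride) (5 * h + 2) (\<lambda>m'. I (Suc j) (m'(2 := 0))) m2" if J': "J' ([] @ ?P) m2" for m2
    proof -
      have J2: "J (H1 @ map (Cons v) ?P) m2" "m2 (xr i) = v" "m2 (cr i) = n - Suc j"
        using J' by (simp_all add: J'_def)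
      note g = glob[OF J2(1)]
      show ?thesis
      proof (rule wp_conseq[OF wp_ADD[where T = "5 * h + 2"]])
        fix m' assume m': "m' = m2(3 := 0, xr i := m2 (xr i) + m2 stride)"
        have "agree (ctl (i # ks)) m2 (m'(2 := 0))" using g by (simp add: agree_def ctl_def m')
        then have "J (H1 @ map (Cons v) ?P) (m'(2 := 0))" using stable J2(1) by blast
        moreover have "H1 @ map (Cons v) ?P =
            H @ concat (map (\<lambda>v. map (Cons v) ?P) (take (Suc j) vs))"
          using v by (simp add: H1_def take_Suc_conv_app_nth)
        ultimately show "I (Suc j) (m'(2 := 0))"
          using J2 g by (simp add: I_def m' v_def)
      qed (use g r in simp_all)
    qed
    show ?thesis by (rule wp_SeqI[OF u1], rule wp_SeqI[OF u2], assumption, erule u3, rule le_refl) simp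
  qed
  have guard: "m1 (cr i) = 0 \<longleftrightarrow> j = n" if "j \<le> n" "I j m1" for j m1
    using that by (auto simp: I_def)
  have s2: "wp (While (cr i) (Ops [DEC (cr i)] ;; NEST start cnt stride ks body ;; ADD (xr i) stride))
      (n * (?t + 5 * h + 3 + 3) + 1) (I n) m1" if "I 0 m1" for m1
    by (rule wp_While[where I = I]) (use that step guard in auto)
  have "wp (NEST start cnt stride (i # ks) body) (nest_time n h T (length (i # ks))) (I n) m"
    unfolding NEST.simps LOOP_def by (rule wp_SeqI[OF s1], erule s2) simp
  then show ?case
  proof (rule wp_conseq)
    fix m' assume "I n m'"
    moreover have "take n vs = vs" by (simp add: vs_def)
    ultimately show "J (H @ product_lists (replicate (length (i # ks)) vs)) m'" by (simp add: I_def)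
  qed simp
qed

definition ROUND :: "nat \<Rightarrow> com" where
  "ROUND D = NEST 21 22 23 [0..<Suc D] (BODY (xr 0) (map xr [1..<Suc D]))"

definition ROUNDS :: "nat \<Rightarrow> com" where
  "ROUNDS D = Ops [CPY 31 20] ;; While 31 (Ops [DEC 31] ;; ROUND D)"

locale db =
  fixes \<sigma> \<tau> :: "nat list" and N B Q D :: nat
  assumes perm: "is_perm \<sigma>" "is_perm \<tau>" and N: "N = length \<sigma> + length \<tau> + 2"
    and D: "1 \<le> D" and B: "62 + 2 * D \<le> B"
begin

definition h :: nat where "h = N + 9"
definition recs :: "nat set" where "recs = {B + j * h | j. j < Q}"
definition buf :: nat where "buf = B + Q * h"

definition db_inv :: "mem \<Rightarrow> bool" where
  "db_inv m \<longleftrightarrow> m 2 = 0 \<and> m 20 = N \<and> m 21 = B \<and> m 22 = Q \<and> m 23 = h \<and> m 24 = buf \<and>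
    (\<forall>p\<in>recs. small_key N m p \<and> valid \<sigma> \<tau> (rkey m p) (rlist m p))"

definition round_rel :: "mem \<Rightarrow> mem \<Rightarrow> bool" where
  "round_rel m m' \<longleftrightarrow> (\<forall>p\<in>recs. rkey m' p = rkey m p \<and> m (p + 8) \<le> m' (p + 8) \<and>
    (\<forall>cs. set cs \<subseteq> recs \<and> length cs = D \<and> ok m p cs \<longrightarrow> (\<Sum>c\<leftarrow>cs. m (c + 8)) \<le> m' (p + 8)))"

lemma recs_bounds: "p \<in> recs \<Longrightarrow> B \<le> p \<and> p + h \<le> buf"
proof -
  assume "p \<in> recs"
  then obtain j where j: "p = B + j * h" "j < Q" unfolding recs_def by blast
  have "Suc j * h \<le> Q * h" using j(2) by (intro mult_le_mono1) simp
  then show ?thesis using j by (simp add: buf_def)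
qed

lemma recs_disjoint: "p \<in> recs \<Longrightarrow> q \<in> recs \<Longrightarrow> p < q \<Longrightarrow> p + h \<le> q"
proof -
  assume "p \<in> recs" "q \<in> recs" "p < q"
  then obtain i j where j: "p = B + i * h" "q = B + j * h" by (auto simp: recs_def)
  with \<open>p < q\<close> have "i < j" by simp
  then have "Suc i * h \<le> j * h" by (intro mult_le_mono1) simp
  then show ?thesis using j by simp
qed

lemma db_len:
  assumes "db_inv m" "p \<in> recs"
  shows "m (p + 8) \<le> N"
proof -
  have "valid \<sigma> \<tau> (rkey m p) (rlist m p)" using assms by (simp add: db_inv_def)
  from valid_length[OF this] have "m (p + 8) \<le> length \<sigma>" by simp
  also have "\<dots> \<le> N" by (simp add: N)
  finally show ?thesis .
qed

lemma valid_concat_recs: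
  assumes "db_inv m" "set cs \<subseteq> recs" "ok m p cs"
  shows "valid \<sigma> \<tau> (rkey m p) (concat (map (rlist m) cs))"
proof (rule valid_concat[where Ks = "map (rkey m) cs"])
  show "valid \<sigma> \<tau> (map (rkey m) cs ! i) (map (rlist m) cs ! i)" if "i < length (map (rkey m) cs)" for i
  proof -
    have "cs ! i \<in> recs" using assms(2) that by (auto simp: subset_iff)
    then show ?thesis using assms(1) that by (simp add: db_inv_def)
  qed
  show "sorted_wrt compat (map (rkey m) cs)" using assms(3) unfolding ok_def by blast
  show "contains (rkey m p) L" if "L \<in> set (map (rkey m) cs)" for L
    using assms(3) that unfolding ok_def by auto
qed simp

lemma rec_keep:
  assumes "agree (X \<union> {p + 8..<p + 9 + N} \<union> {buf..}) m m'" "X \<subseteq> {..<B}" "p \<in> recs" "q \<in> recs"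
  shows "rkey m' q = rkey m q \<and> (\<forall>k<8. m' (q + k) = m (q + k)) \<and>
    (q \<noteq> p \<longrightarrow> (\<forall>x. q \<le> x \<and> x < q + h \<longrightarrow> m' x = m x))"
proof -
  have q: "B \<le> q" "q + h \<le> buf" and p: "B \<le> p" "p + h \<le> buf" using recs_bounds assms by auto
  have hN: "h = N + 9" by (simp add: h_def)
  have *: "m' x = m x" if "q \<le> x" "x < q + h" "q \<noteq> p \<or> x < q + 8" for x
  proof -
    have "\<not> (p + 8 \<le> x \<and> x < p + 9 + N)"
      using that recs_disjoint[OF assms(3,4)] recs_disjoint[OF assms(4,3)] hN by (cases "p < q"; cases "q < p") auto
    moreover have "x \<notin> X" using assms(2) q that by auto
    ultimately show ?thesis using agreeD[OF assms(1), of x] that q by auto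
  qed
  have "m' (q + k) = m (q + k)" if "k < 8" for k using * that hN by simp
  then show ?thesis using * by (auto simp: rkey_def)
qed

definition round_hist :: "mem \<Rightarrow> nat list list \<Rightarrow> mem \<Rightarrow> bool" where
  "round_hist m0 H m \<longleftrightarrow> db_inv m \<and> m 31 = m0 31 \<and>
    (\<forall>p\<in>recs. rkey m p = rkey m0 p \<and> m0 (p + 8) \<le> m (p + 8)) \<and>
    (\<forall>v\<in>set H. hd v \<in> recs \<and> set (tl v) \<subseteq> recs \<and> (ok m0 (hd v) (tl v) \<longrightarrow> (\<Sum>c\<leftarrow>tl v. m0 (c + 8)) \<le> m (hd v + 8)))"

lemma db_inv_agree:
  assumes "db_inv m" "agree X m m'" "X \<subseteq> {..<B} - {2, 20, 21, 22, 23, 24}"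
  shows "db_inv m'"
proof -
  have k: "m' x = m x" if "x \<in> {2, 20, 21, 22, 23, 24} \<or> B \<le> x" for x
    by (rule agreeD[OF assms(2)]) (use that assms(3) in auto)
  have "rkey m' p = rkey m p" "rlist m' p = rlist m p" "small_key N m' p \<longleftrightarrow> small_key N m p"
    if "p \<in> recs" for p
    using k recs_bounds[OF that] by (auto simp: rkey_def rlist_def small_key_def)
  then show ?thesis using assms(1) k by (simp add: db_inv_def)
qed

lemma wp_round_body:
  assumes J: "round_hist m0 H m" and ran: "\<forall>i\<in>set [0..<Suc D]. m (xr i) \<in> recs"
  shows "wp (BODY (xr 0) (map xr [1..<Suc D])) (body_time D N)
    (\<lambda>m'. round_hist m0 (H @ [map (\<lambda>i. m (xr i)) [0..<Suc D]]) m' \<and>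
      (\<forall>i\<in>set [0..<Suc D]. m' (xr i) = m (xr i) \<and> m' (cr i) = m (cr i))) m"
proof -
  note [simp del] = upt_Suc
  let ?x = "xr 0" and ?ys = "map xr [1..<Suc D]"
  let ?p = "m ?x" and ?cs = "map m ?ys"
  let ?cat = "concat (map (\<lambda>y. rlist m (m y)) ?ys)"
  have inv: "db_inv m" using J by (simp add: round_hist_def)
  have pr: "?p \<in> recs" and csr: "set ?cs \<subseteq> recs" using ran by auto
  have xb: "xr i < B" "cr i < B" if "i < Suc D" for i using that B by (auto simp: xr_def cr_def)
  have Bbuf: "B \<le> buf" by (simp add: buf_def)
  have v: "valid \<sigma> \<tau> (rkey m q) (rlist m q)" "small_key N m q" if "q \<in> recs" for q
    using inv that by (simp_all add: db_inv_def)
  have vcat: "valid \<sigma> \<tau> (rkey m ?p) ?cat" if o: "ok m ?p ?cs"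
    using valid_concat_recs[OF inv csr o] by (simp add: o_def)
  have "wp (BODY ?x ?ys) (body_time (length ?ys) N) (\<lambda>m'. m' 2 = 0 \<and>
    agree (tmp \<union> {?p + 8..<?p + 9 + N} \<union> {buf..}) m m' \<and>
    (if ok m ?p ?cs \<and> m (?p + 8) < length ?cat then rlist m' ?p = ?cat
     else agree (tmp \<union> {buf..}) m m')) m"
  proof (rule wp_BODY)
    show "\<forall>y\<in>set (?x # ?ys). 25 \<le> y \<and> y < buf \<and> small_key N m (m y) \<and> 25 \<le> m y \<and>
      m (m y + 8) \<le> N \<and> m y + 9 + N \<le> buf"
    proof
      fix y assume "y \<in> set (?x # ?ys)"
      then obtain i where i: "y = xr i" "i < Suc D" by auto
      then have "m y \<in> recs" using bspec[OF ran, of i] by (simp del: upt_Suc)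
      then show "25 \<le> y \<and> y < buf \<and> small_key N m (m y) \<and> 25 \<le> m y \<and>
        m (m y + 8) \<le> N \<and> m y + 9 + N \<le> buf"
        using recs_bounds[of "m y"] v(2) db_len[OF inv] i xb[OF i(2)] Bbuf B by (simp add: h_def xr_def)
    qed
    show "length ?cat \<le> N" if "ok m ?p ?cs"
      using valid_length[OF vcat[OF that]] N by simp
  qed (use inv in \<open>simp_all add: db_inv_def\<close>)
  then show ?thesis
  proof (rule wp_conseq)
    fix m' assume *: "m' 2 = 0 \<and> agree (tmp \<union> {?p + 8..<?p + 9 + N} \<union> {buf..}) m m' \<and>
      (if ok m ?p ?cs \<and> m (?p + 8) < length ?cat then rlist m' ?p = ?cat
       else agree (tmp \<union> {buf..}) m m')"
    then have a: "agree (tmp \<union> {?p + 8..<?p + 9 + N} \<union> {buf..}) m m'" by simp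
    have low: "m' x = m x" if "13 \<le> x" "x < B" for x
      by (rule agreeD[OF a]) (use that recs_bounds[OF pr] Bbuf in \<open>auto simp: tmp_def\<close>)
    have tB: "tmp \<subseteq> {..<B}" using B by (auto simp: tmp_def)
    note rk = rec_keep[OF a tB pr]
    have key: "rkey m' q = rkey m q" and sk: "small_key N m' q" if "q \<in> recs" for q
      using rk[OF that] v(2)[OF that] by (simp_all add: small_key_def)
    have other: "rlist m' q = rlist m q \<and> m' (q + 8) = m (q + 8)" if "q \<in> recs" "q \<noteq> ?p" for q
    proof -
      have k: "\<forall>x. q \<le> x \<and> x < q + h \<longrightarrow> m' x = m x" using rk[OF that(1)] that(2) by blast
      then have "m' (q + 8) = m (q + 8)" by (simp add: h_def)
      moreover have "m' (q + 9 + i) = m (q + 9 + i)" if "i < m (q + 8)" for i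
        using k db_len[OF inv \<open>q \<in> recs\<close>] that by (simp add: h_def)
      ultimately show ?thesis by (simp add: rlist_def)
    qed
    have par: "valid \<sigma> \<tau> (rkey m' ?p) (rlist m' ?p) \<and> m (?p + 8) \<le> m' (?p + 8) \<and>
        (ok m ?p ?cs \<longrightarrow> length ?cat \<le> m' (?p + 8))"
    proof (cases "ok m ?p ?cs \<and> m (?p + 8) < length ?cat")
      case True
      then have r: "rlist m' ?p = ?cat" using * by simp
      then have "m' (?p + 8) = length ?cat" using length_rlist[of m' ?p] by simp
      then show ?thesis using True vcat r key[OF pr] by simp
    next
      case False
      then have a': "agree (tmp \<union> {buf..}) m m'" using * by simp
      have k: "m' x = m x" if "?p \<le> x" "x < ?p + h" for x
        by (rule agreeD[OF a']) (use that recs_bounds[OF pr] B in \<open>auto simp: tmp_def\<close>)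
      have "m' (?p + 8) = m (?p + 8)" using k by (simp add: h_def)
      moreover have "m' (?p + 9 + i) = m (?p + 9 + i)" if "i < m (?p + 8)" for i
        using k db_len[OF inv pr] that by (simp add: h_def)
      ultimately have "rlist m' ?p = rlist m ?p" "m' (?p + 8) = m (?p + 8)" by (simp_all add: rlist_def)
      then show ?thesis using False v(1)[OF pr] key[OF pr] by (simp add: not_less)
    qed
    have mono: "m (q + 8) \<le> m' (q + 8)" "valid \<sigma> \<tau> (rkey m' q) (rlist m' q)" if "q \<in> recs" for q
      using par other[OF that] key[OF that] v(1)[OF that] by (cases "q = ?p"; simp)+
    have glob: "m' x = m x" if "x \<in> {20, 21, 22, 23, 24, 31}" for x using low that B by auto
    have db': "db_inv m'"
      using inv mono(2) sk glob * by (simp add: db_inv_def)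
    have m0: "rkey m q = rkey m0 q" "m0 (q + 8) \<le> m (q + 8)" if "q \<in> recs" for q
      using J that by (simp_all add: round_hist_def)
    have ok0: "ok m0 ?p ?cs \<longleftrightarrow> ok m ?p ?cs"
    proof -
      have k: "rkey m0 q = rkey m q" if "q \<in> set ?cs" for q
        using m0(1)[OF subsetD[OF csr that]] by simp
      then have mp: "map (rkey m0) ?cs = map (rkey m) ?cs" by (intro map_cong refl)
      have "(\<forall>q\<in>set ?cs. contains (rkey m0 ?p) (rkey m0 q)) \<longleftrightarrow>
          (\<forall>q\<in>set ?cs. contains (rkey m ?p) (rkey m q))"
        by (rule ball_cong[OF refl]) (simp only: k m0(1)[OF pr])
      then show ?thesis unfolding ok_def mp by (rule arg_cong2[OF _ refl])
    qed
    have len: "(\<Sum>c\<leftarrow>?cs. m0 (c + 8)) \<le> length ?cat"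
    proof -
      have "(\<Sum>c\<leftarrow>?cs. m0 (c + 8)) \<le> (\<Sum>c\<leftarrow>?cs. m (c + 8))"
        using m0(2) csr by (intro sum_list_mono) auto
      then show ?thesis by (simp add: length_concat o_def)
    qed
    have tup: "map (\<lambda>i. m (xr i)) [0..<Suc D] = ?p # ?cs"
      by (simp add: upt_rec[of 0] o_def del: upt_Suc)
    have "round_hist m0 (H @ [map (\<lambda>i. m (xr i)) [0..<Suc D]]) m'"
      unfolding round_hist_def tup
    proof (intro conjI ballI)
      show "db_inv m'" by (rule db')
      show "m' 31 = m0 31" using glob[of 31] J by (simp add: round_hist_def)
      show "rkey m' q = rkey m0 q" "m0 (q + 8) \<le> m' (q + 8)" if "q \<in> recs" for q
        using key[OF that] m0[OF that] mono(1)[OF that] by simp_all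
      fix w assume "w \<in> set (H @ [?p # ?cs])"
      then consider "w \<in> set H" | "w = ?p # ?cs" by auto
      then have "hd w \<in> recs \<and> set (tl w) \<subseteq> recs \<and>
        (ok m0 (hd w) (tl w) \<longrightarrow> (\<Sum>c\<leftarrow>tl w. m0 (c + 8)) \<le> m' (hd w + 8))"
      proof cases
        case 1
        then have "hd w \<in> recs \<and> set (tl w) \<subseteq> recs \<and>
          (ok m0 (hd w) (tl w) \<longrightarrow> (\<Sum>c\<leftarrow>tl w. m0 (c + 8)) \<le> m (hd w + 8))"
          using J by (simp add: round_hist_def)
        then show ?thesis using mono(1) by (meson le_trans)
      next
        case 2
        have "ok m0 ?p ?cs \<longrightarrow> (\<Sum>c\<leftarrow>?cs. m0 (c + 8)) \<le> m' (?p + 8)"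
          using par ok0 len le_trans by blast
        then show ?thesis unfolding 2 list.sel using pr csr by (intro conjI)
      qed
      then show "hd w \<in> recs" "set (tl w) \<subseteq> recs"
        "ok m0 (hd w) (tl w) \<longrightarrow> (\<Sum>c\<leftarrow>tl w. m0 (c + 8)) \<le> m' (hd w + 8)" by blast+
    qed
    moreover have "m' (xr i) = m (xr i) \<and> m' (cr i) = m (cr i)" if "i < Suc D" for i
      using low[of "xr i"] low[of "cr i"] xb[OF that] by (simp add: xr_def cr_def)
    ultimately show "round_hist m0 (H @ [map (\<lambda>i. m (xr i)) [0..<Suc D]]) m' \<and>
      (\<forall>i\<in>set [0..<Suc D]. m' (xr i) = m (xr i) \<and> m' (cr i) = m (cr i))" by simp
  qed simp
qed

lemma wp_ROUND:
  assumes "db_inv m"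
  shows "wp (ROUND D) (nest_time Q h (body_time D N) (Suc D))
    (\<lambda>m'. db_inv m' \<and> round_rel m m' \<and> m' 31 = m 31) m"
proof -
  define vs where "vs = map (\<lambda>j. B + j * h) [0..<Q]"
  have vs: "set vs = recs" by (auto simp: vs_def recs_def)
  have ctl: "ctl [0..<Suc D] \<subseteq> {..<B} - {2, 20, 21, 22, 23, 24} - {31}"
    using B by (auto simp: ctl_def xr_def cr_def)
  have "wp (NEST 21 22 23 [0..<Suc D] (BODY (xr 0) (map xr [1..<Suc D])))
    (nest_time Q h (body_time D N) (length [0..<Suc D]))
    (round_hist m ([] @ product_lists (replicate (length [0..<Suc D]) vs))) m"
    unfolding vs_def
  proof (rule wp_NEST)
    show "round_hist m H m2" if J: "round_hist m H m1" and a: "agree (ctl [0..<Suc D]) m1 m2" for H m1 m2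
    proof -
      have "db_inv m2" by (rule db_inv_agree[OF _ a]) (use J ctl in \<open>auto simp: round_hist_def\<close>)
      moreover have "m2 x = m1 x" if "B \<le> x \<or> x = 31" for x
        by (rule agreeD[OF a]) (use that ctl in auto)
      moreover from this have "rkey m2 p = rkey m1 p" "m2 (p + 8) = m1 (p + 8)" if "p \<in> recs" for p
        using recs_bounds[OF that] by (simp_all add: rkey_def)
      ultimately show ?thesis using J by (simp add: round_hist_def)
    qed
    show "wp (BODY (xr 0) (map xr [1..<Suc D])) (body_time D N)
      (\<lambda>m'. round_hist m (H @ [map (\<lambda>i. m1 (xr i)) [0..<Suc D]]) m' \<and>
        (\<forall>i\<in>set [0..<Suc D]. m' (xr i) = m1 (xr i) \<and> m' (cr i) = m1 (cr i))) m1"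
      if "round_hist m H m1" "\<forall>i\<in>set [0..<Suc D]. m1 (xr i) \<in> set (map (\<lambda>j. B + j * h) [0..<Q])" for H m1
      using wp_round_body[OF that(1)] that(2) vs unfolding vs_def by simp
  qed (use assms in \<open>auto simp: round_hist_def db_inv_def\<close>)
  then show ?thesis unfolding ROUND_def
  proof (rule wp_conseq)
    fix m' assume "round_hist m ([] @ product_lists (replicate (length [0..<Suc D]) vs)) m'"
    note * = this[unfolded length_upt diff_zero append_Nil]
    have "(\<Sum>c\<leftarrow>cs. m (c + 8)) \<le> m' (p + 8)"
      if "p \<in> recs" "set cs \<subseteq> recs" "length cs = D" "ok m p cs" for p cs
    proof -
      have "p # cs \<in> set (product_lists (replicate (Suc D) vs))"
        unfolding product_lists_set using that vs by (auto simp: list_all2_conv_all_nth nth_Cons split: nat.split)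
      then have "ok m (hd (p # cs)) (tl (p # cs)) \<longrightarrow> (\<Sum>c\<leftarrow>tl (p # cs). m (c + 8)) \<le> m' (hd (p # cs) + 8)"
        using * unfolding round_hist_def by blast
      then show ?thesis using that(4) by simp
    qed
    then show "db_inv m' \<and> round_rel m m' \<and> m' 31 = m 31"
      using * unfolding round_hist_def round_rel_def by simp
  qed simp
qed

definition rounds_time :: nat where
  "rounds_time = N * (nest_time Q h (body_time D N) (Suc D) + 4) + 2"

lemma wp_ROUNDS:
  assumes inv: "db_inv m"
  shows "wp (ROUNDS D) rounds_time (\<lambda>m'. db_inv m' \<and>
    (\<exists>ms. ms 0 = m \<and> ms N = m' \<and> (\<forall>r<N. round_rel (ms r) (ms (Suc r))))) m"
proof -
  let ?t = "nest_time Q h (body_time D N) (Suc D)"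
  have loc: "round_rel m1 m2 \<longleftrightarrow> round_rel m1' m2'"
    if "agree {2, 31} m1 m1'" "agree {2, 31} m2 m2'" for m1 m2 m1' m2'
  proof -
    have k: "m1' x = m1 x" "m2' x = m2 x" if "B \<le> x" for x
      using agreeD[OF \<open>agree {2, 31} m1 m1'\<close>, of x] agreeD[OF \<open>agree {2, 31} m2 m2'\<close>, of x] that B by auto
    have kk: "rkey m1' p = rkey m1 p \<and> rkey m2' p = rkey m2 p \<and> m1' (p + 8) = m1 (p + 8) \<and> m2' (p + 8) = m2 (p + 8)"
      if "p \<in> recs" for p using k recs_bounds[OF that] by (simp add: rkey_def)
    have "ok m1' p cs \<longleftrightarrow> ok m1 p cs" "(\<Sum>c\<leftarrow>cs. m1' (c + 8)) = (\<Sum>c\<leftarrow>cs. m1 (c + 8))"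
      if "p \<in> recs" "set cs \<subseteq> recs" for p cs
    proof -
      have mp: "map (rkey m1') cs = map (rkey m1) cs" using kk that by (auto simp: subset_iff)
      show "ok m1' p cs \<longleftrightarrow> ok m1 p cs" unfolding ok_def mp using kk that by (auto simp: subset_iff)
      have "map (\<lambda>c. m1' (c + 8)) cs = map (\<lambda>c. m1 (c + 8)) cs" using kk that by (auto simp: subset_iff)
      then show "(\<Sum>c\<leftarrow>cs. m1' (c + 8)) = (\<Sum>c\<leftarrow>cs. m1 (c + 8))" by metis
    qed
    then show ?thesis unfolding round_rel_def using kk by (intro ball_cong) (simp_all cong: conj_cong)
  qed
  define I where "I = (\<lambda>j m'. m' 31 = N - j \<and> db_inv m' \<and>
    (\<exists>ms. ms 0 = m \<and> ms j = m' \<and> (\<forall>r<j. round_rel (ms r) (ms (Suc r)))))"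
  define I' where "I' = (\<lambda>j m'. m' 31 = N - j \<and> db_inv m' \<and>
    (\<exists>ms. ms 0 = m \<and> agree {2, 31} (ms j) m' \<and> (\<forall>r<j. round_rel (ms r) (ms (Suc r)))))"
  have s1: "wp (Ops [CPY 31 20]) 1 (I' 0) m"
  proof (rule wp_Ops)
    have a: "agree {31} m (m(31 := N))" by (simp add: agree_def)
    have "db_inv (m(31 := N))" by (rule db_inv_agree[OF inv a]) (use B in auto)
    moreover have "agree {2, 31} m (m(31 := N))" by (simp add: agree_def)
    moreover have "m 20 = N" using inv by (simp add: db_inv_def)
    ultimately show "I' 0 (fold eff [CPY 31 20] m)" unfolding I'_def by (auto intro!: exI[of _ "\<lambda>_. m"])
  qed simp_all
  have step: "wp (Ops [DEC 31] ;; ROUND D) (?t + 1) (\<lambda>m'. I' (Suc j) (m'(2 := 0))) m1"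
    if j: "j < N" and I: "I' j m1" for j m1
  proof -
    let ?m = "m1(31 := N - Suc j)"
    have i1: "m1 31 = N - j" "db_inv m1" using I by (simp_all add: I'_def)
    obtain ms where ms: "ms 0 = m" "agree {2, 31} (ms j) m1" "\<forall>r<j. round_rel (ms r) (ms (Suc r))"
      using I unfolding I'_def by blast
    have u1: "wp (Ops [DEC 31]) 1 (\<lambda>m'. m' = ?m) m1" by (rule wp_Ops) (use i1 in simp_all)
    have a: "agree {31} m1 ?m" by (simp add: agree_def)
    have inv': "db_inv ?m" by (rule db_inv_agree[OF i1(2) a]) (use B in auto)
    have u2: "wp (ROUND D) ?t (\<lambda>m'. I' (Suc j) (m'(2 := 0))) m2" if "m2 = ?m" for m2
      unfolding that
    proof (rule wp_conseq[OF wp_ROUND[OF inv']])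
      fix m' assume *: "db_inv m' \<and> round_rel ?m m' \<and> m' 31 = ?m 31"
      then have "m' 2 = 0" by (simp add: db_inv_def)
      then have e: "m'(2 := 0) = m'" by (simp add: fun_eq_iff)
      have "agree {2, 31} (ms j) ?m" using ms(2) by (simp add: agree_def)
      then have "round_rel (ms j) m'" using * loc[of "ms j" ?m m' m'] by simp
      then have "\<forall>r<Suc j. round_rel ((ms(Suc j := m')) r) ((ms(Suc j := m')) (Suc r))"
        using ms(3) by (auto simp: less_Suc_eq)
      moreover have "(ms(Suc j := m')) 0 = m" "agree {2, 31} ((ms(Suc j := m')) (Suc j)) m'"
        using ms(1) by simp_all
      ultimately have "\<exists>ms. ms 0 = m \<and> agree {2, 31} (ms (Suc j)) m' \<and>
          (\<forall>r<Suc j. round_rel (ms r) (ms (Suc r)))" by (intro exI[of _ "ms(Suc j := m')"] conjI)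
      then show "I' (Suc j) (m'(2 := 0))" unfolding e I'_def using * by simp
    qed simp
    show ?thesis by (rule wp_SeqI[OF u1], erule u2) simp
  qed
  have guard: "m1 31 = 0 \<longleftrightarrow> j = N" if "j \<le> N" "I' j m1" for j m1
    using that by (auto simp: I'_def)
  have s2: "wp (While 31 (Ops [DEC 31] ;; ROUND D)) (N * (?t + 1 + 3) + 1) (I' N) m1" if "I' 0 m1" for m1
    by (rule wp_While[where I = I']) (use that step guard in auto)
  have "wp (ROUNDS D) rounds_time (I' N) m"
    unfolding ROUNDS_def rounds_time_def by (rule wp_SeqI[OF s1], erule s2) simp
  then show ?thesis
  proof (rule wp_conseq)
    fix m' assume I: "I' N m'"
    then obtain ms where ms: "ms 0 = m" "agree {2, 31} (ms N) m'" "\<forall>r<N. round_rel (ms r) (ms (Suc r))"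
      unfolding I'_def by blast
    have "round_rel ((ms(N := m')) r) ((ms(N := m')) (Suc r))" if "r < N" for r
      using ms(3) that loc[of "ms r" "ms r" "ms (Suc r)" m'] ms(2) by auto
    moreover have "(ms(N := m')) 0 = m" using ms(1) N by simp
    moreover have "(ms(N := m')) N = m'" by simp
    ultimately show "db_inv m' \<and> (\<exists>ms. ms 0 = m \<and> ms N = m' \<and> (\<forall>r<N. round_rel (ms r) (ms (Suc r))))"
      using I unfolding I'_def by blast
  qed simp
qed

text \<open>The base record carries a key containing all other keys.\<close>

lemma ROUNDS_correct:
  assumes inv: "db_inv m" and dec: "decomposable D \<sigma> {0..<length \<sigma>}" and Q: "0 < Q"
    and univ: "rkey m B = [0, N, 0, N, 0, N, 0, N]"
    and keys: "\<And>K. length K = 8 \<Longrightarrow> set K \<subseteq> {..<N} \<Longrightarrow> \<exists>p\<in>recs. rkey m p = K"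
    and units: "\<And>i j. i < length \<sigma> \<Longrightarrow> j < length \<tau> \<Longrightarrow>
      \<exists>p\<in>recs. rkey m p = tight \<sigma> \<tau> [(i, j)] \<and> 1 \<le> m (p + 8)"
  shows "wp (ROUNDS D) rounds_time (\<lambda>m'. db_inv m' \<and> valid \<sigma> \<tau> (rkey m' B) (rlist m' B) \<and>
    longest_common_pattern (ranks (rlist m' B)) \<sigma> \<tau>) m"
proof (rule wp_conseq[OF wp_ROUNDS[OF inv]])
  fix m' assume *: "db_inv m' \<and> (\<exists>ms. ms 0 = m \<and> ms N = m' \<and> (\<forall>r<N. round_rel (ms r) (ms (Suc r))))"
  then obtain ms where ms: "ms 0 = m" "ms N = m'" "\<And>r. r < N \<Longrightarrow> round_rel (ms r) (ms (Suc r))" by blast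
  have Bq: "B \<in> recs" using Q by (auto simp: recs_def intro!: exI[of _ 0])
  have key: "rkey (ms r) p = rkey m p" if "r \<le> N" "p \<in> recs" for r p
    using that(1)
  proof (induction r)
    case (Suc r)
    then show ?case using ms(3)[of r] that(2) by (simp add: round_rel_def)
  qed (simp add: ms)
  interpret rounds \<sigma> \<tau> D recs "rkey m" "\<lambda>r p. ms r (p + 8)" N
  proof
    show "ms r (p + 8) \<le> ms (Suc r) (p + 8)" if "r < N" "p \<in> recs" for r p
      using ms(3)[OF that(1)] that(2) by (simp add: round_rel_def)
    show "(\<Sum>c\<leftarrow>cs. ms r (c + 8)) \<le> ms (Suc r) (p + 8)"
      if r: "r < N" and p: "p \<in> recs" and cs: "set cs \<subseteq> recs" "length cs = D"
        and c: "\<forall>c\<in>set cs. contains (rkey m p) (rkey m c)" and s: "sorted_wrt compat (map (rkey m) cs)"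
      for r p cs
    proof -
      have k: "rkey (ms r) c = rkey m c" if "c \<in> recs" for c using key r that by simp
      then have mp: "map (rkey (ms r)) cs = map (rkey m) cs" using cs by (auto simp: subset_iff)
      have "ok (ms r) p cs" unfolding ok_def mp using c s k p cs by (auto simp: subset_iff)
      then show ?thesis using ms(3)[OF r] p cs by (simp add: round_rel_def)
    qed
    show "\<exists>p\<in>recs. rkey m p = K" if "length K = 8" "set K \<subseteq> {..length \<sigma> + length \<tau> + 1}" for K
      using keys[OF that(1)] that(2) N by (simp add: subset_iff less_Suc_eq_le)
    show "\<exists>p\<in>recs. rkey m p = tight \<sigma> \<tau> [(i, j)] \<and> 1 \<le> ms 0 (p + 8)"
      if "i < length \<sigma>" "j < length \<tau>" for i j
      using units[OF that] ms(1) by simp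
  qed (use D perm in simp_all)
  have v: "valid \<sigma> \<tau> (rkey m' B) (rlist m' B)" using * Bq by (simp add: db_inv_def)
  moreover have "longest_common_pattern (ranks (rlist m' B)) \<sigma> \<tau>"
  proof (rule longest_common_pattern_ranks[OF perm v])
    fix ps assume ps: "match \<sigma> \<tau> ps"
    show "length ps \<le> length (rlist m' B)"
    proof (cases "ps = []")
      case False
      have "fst ` set ps \<subseteq> {0..<length \<sigma>}" using ps by (auto simp: match_def)
      moreover have "contains (rkey m B) (tight \<sigma> \<tau> ps)"
      proof -
        have l: "length (tight \<sigma> \<tau> ps) = 8" by (simp add: tight_def)
        have "tight \<sigma> \<tau> ps ! k \<le> N" if "k < 8" for k
          using subsetD[OF tight_bounded[OF ps False] nth_mem[of k "tight \<sigma> \<tau> ps"]] that l N by simp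
        then show ?thesis unfolding univ contains_def by (simp add: eval_nat_numeral)
      qed
      ultimately have "length ps \<le> ms N (B + 8)"
        using complete_containing[OF dec _ ps False _ _ Bq] N by simp
      then show ?thesis using ms(2) by simp
    qed simp
  qed
  ultimately show "db_inv m' \<and> valid \<sigma> \<tau> (rkey m' B) (rlist m' B) \<and>
    longest_common_pattern (ranks (rlist m' B)) \<sigma> \<tau>" using * by simp
qed simp

end

section \<open>The initial table\<close>

definition MKREC :: "nat list \<Rightarrow> com" where
  "MKREC rs = Ops (CPY 6 37 # concat (map (\<lambda>r. [STOREI 6 r, INC 6]) rs)) ;; ADD 37 23 ;; Ops [INC 22]"

lemma fold_store:
  "\<forall>r\<in>set rs. r < m q \<and> r \<noteq> q \<Longrightarrow> q < m q \<Longrightarrow>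
    fold eff (concat (map (\<lambda>r. [STOREI q r, INC q]) rs)) m =
    (\<lambda>x. if x = q then m q + length rs
         else if m q \<le> x \<and> x < m q + length rs then m (rs ! (x - m q)) else m x)"
proof (induction rs arbitrary: m)
  case (Cons r rs)
  let ?m = "m(m q := m r, q := Suc (m q))"
  have m6: "q < m q" "r < m q" "r \<noteq> q" and rs: "\<And>s. s \<in> set rs \<Longrightarrow> s < m q \<and> s \<noteq> q"
    using Cons.prems by simp_all
  have "eff (INC q) (eff (STOREI q r) m) = ?m" using m6(1) by (simp add: fun_eq_iff)
  then have "fold eff (concat (map (\<lambda>r. [STOREI q r, INC q]) (r # rs))) m =
    fold eff (concat (map (\<lambda>r. [STOREI q r, INC q]) rs)) ?m"
    by (simp del: eff.simps)
  also have "\<dots> = (\<lambda>x. if x = q then Suc (m q) + length rs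
         else if Suc (m q) \<le> x \<and> x < Suc (m q) + length rs then ?m (rs ! (x - Suc (m q))) else ?m x)"
  proof -
    have "s < ?m q \<and> s \<noteq> q" if "s \<in> set rs" for s using rs[OF that] by simp
    then have A: "\<forall>s\<in>set rs. s < ?m q \<and> s \<noteq> q" "q < ?m q" "?m q = Suc (m q)"
      using m6 by simp_all
    from Cons.IH[of ?m, OF A(1,2)] show ?thesis unfolding A(3) .
  qed
  also have "\<dots> = (\<lambda>x. if x = q then m q + length (r # rs)
         else if m q \<le> x \<and> x < m q + length (r # rs) then m ((r # rs) ! (x - m q)) else m x)"
  proof
    fix x
    consider "x = q" | "x \<noteq> q" "x = m q" | "x \<noteq> q" "Suc (m q) \<le> x" "x < Suc (m q) + length rs"
      | "x \<noteq> q" "x < m q \<or> Suc (m q) + length rs \<le> x" by linarith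
    then show "(if x = q then Suc (m q) + length rs
         else if Suc (m q) \<le> x \<and> x < Suc (m q) + length rs then ?m (rs ! (x - Suc (m q))) else ?m x) =
       (if x = q then m q + length (r # rs)
         else if m q \<le> x \<and> x < m q + length (r # rs) then m ((r # rs) ! (x - m q)) else m x)"
    proof cases
      case 3
      then have "rs ! (x - Suc (m q)) \<in> set rs" by (intro nth_mem) linarith
      from rs[OF this] have "?m (rs ! (x - Suc (m q))) = m (rs ! (x - Suc (m q)))" by simp
      moreover have "(r # rs) ! (x - m q) = rs ! (x - Suc (m q))"
        using 3 by (metis Suc_diff_le diff_Suc_Suc nth_Cons_Suc)
      ultimately show ?thesis using 3 by auto
    qed (use m6 in auto)
  qed
  finally show ?case .
qed auto

lemma jump_free_store: "list_all jump_free (concat (map (\<lambda>r. [STOREI q r, INC q]) rs))"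
  "length (concat (map (\<lambda>r. [STOREI q r, INC q]) rs)) = 2 * length rs"
  by (induction rs) auto

definition UNIT :: com where
  "UNIT = Ops [CPY 4 25] ;; ADD 4 (xr 0) ;;
     Ops [LOADI 33 4, CPY 38 33, INC 38, CPY 39 (xr 0), INC 39, CPY 4 26] ;; ADD 4 (xr 1) ;;
     Ops [LOADI 36 4, CPY 40 36, INC 40, CPY 41 (xr 1), INC 41] ;;
     MKREC [33, 38, xr 0, 39, 36, 40, xr 1, 41, 30, xr 0]"

definition INIT :: com where
  "INIT = Ops ([CLR 29, CLR 30, INC 30, CPY 23 20] @ replicate 9 (INC 23) @ [CLR 22, CPY 21 26]) ;;
     ADD 21 20 ;; Ops [CPY 37 21] ;;
     MKREC [29, 20, 29, 20, 29, 20, 29, 20] ;;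
     NEST 29 20 30 [0..<8] (MKREC (map xr [0..<8])) ;;
     NEST 30 27 30 [0] (NEST 30 28 30 [1] UNIT) ;;
     Ops [CPY 24 37]"

locale init =
  fixes \<sigma> \<tau> :: "nat list" and N B D IS IT :: nat
  assumes perm: "is_perm \<sigma>" "is_perm \<tau>" and N: "N = length \<sigma> + length \<tau> + 2"
    and D: "1 \<le> D" and IS: "80 + 2 * D \<le> IS" "IS + N \<le> IT" and B: "B = IT + N"
begin

definition bs :: nat where "bs = N + 9"

lemma bs_ge: "11 \<le> bs"
  unfolding bs_def using N by simp

definition ready :: "mem \<Rightarrow> bool" where
  "ready m \<longleftrightarrow> m 2 = 0 \<and> m 20 = N \<and> m 25 = IS \<and> m 26 = IT \<and> m 27 = length \<sigma> \<and> m 28 = length \<tau> \<and>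
    (\<forall>i<length \<sigma>. m (IS + \<sigma> ! i) = i) \<and> (\<forall>j<length \<tau>. m (IT + \<tau> ! j) = j) \<and> (\<forall>x\<ge>B. m x = 0)"

definition init_inv :: "nat list list \<Rightarrow> mem \<Rightarrow> bool" where
  "init_inv L m \<longleftrightarrow> m 2 = 0 \<and> m 20 = N \<and> m 21 = B \<and> m 22 = length L \<and> m 23 = bs \<and> m 25 = IS \<and> m 26 = IT \<and>
    m 27 = length \<sigma> \<and> m 28 = length \<tau> \<and> m 29 = 0 \<and> m 30 = 1 \<and> m 37 = B + length L * bs \<and>
    (\<forall>i<length \<sigma>. m (IS + \<sigma> ! i) = i) \<and> (\<forall>j<length \<tau>. m (IT + \<tau> ! j) = j) \<and>
    (\<forall>j<length L. length (L ! j) \<le> bs \<and> (\<forall>k<bs. m (B + j * bs + k) = (if k < length (L ! j) then L ! j ! k else 0))) \<and>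
    (\<forall>x\<ge>B + length L * bs. m x = 0)"

definition fixed_regs :: "nat set" where
  "fixed_regs = {2, 20, 21, 22, 23, 25, 26, 27, 28, 29, 30, 37}"

lemma init_inv_agree:
  assumes "init_inv L m" "agree X m m'" "X \<subseteq> {..<80} - fixed_regs"
  shows "init_inv L m'"
proof -
  have k: "m' x = m x" if "x \<in> fixed_regs \<or> 80 \<le> x" for x
    by (rule agreeD[OF assms(2)]) (use that assms(3) in auto)
  have "m' 2 = m 2" "m' 20 = m 20" "m' 21 = m 21" "m' 22 = m 22" "m' 23 = m 23" "m' 25 = m 25"
    "m' 26 = m 26" "m' 27 = m 27" "m' 28 = m 28" "m' 29 = m 29" "m' 30 = m 30" "m' 37 = m 37"
    by (rule k; simp add: fixed_regs_def)+
  moreover have "m' (IS + x) = m (IS + x)" "m' (IT + x) = m (IT + x)" "m' (B + x) = m (B + x)" for x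
    using k IS B by simp_all
  moreover have "m' x = m x" if "B + y \<le> x" for x y using k that IS B by simp
  ultimately show ?thesis using assms(1) unfolding init_inv_def by (simp add: add.assoc)
qed

lemma wp_MKREC:
  assumes inv: "init_inv L m" and rs: "\<forall>r\<in>set rs. r < 80 \<and> r \<noteq> 6" "length rs \<le> bs" "length rs \<le> 10"
  shows "wp (MKREC rs) (5 * bs + 24) (\<lambda>m'. init_inv (L @ [map m rs]) m' \<and>
    agree ({3, 6, 22, 37} \<union> {B..}) m m') m"
proof -
  define w where "w = B + length L * bs"
  have w: "80 \<le> w" "B \<le> w" "80 \<le> B" using IS B by (simp_all add: w_def)
  have m: "m 37 = w" "m 22 = length L" "m 23 = bs" "m 2 = 0" "\<forall>x\<ge>w. m x = 0"
    using inv by (simp_all add: init_inv_def w_def)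
  define m1 where "m1 = (\<lambda>x. if x = 6 then w + length rs
    else if w \<le> x \<and> x < w + length rs then m (rs ! (x - w)) else m x)"
  have f: "fold eff (CPY 6 37 # concat (map (\<lambda>r. [STOREI 6 r, INC 6]) rs)) m = m1"
  proof -
    have "fold eff (CPY 6 37 # concat (map (\<lambda>r. [STOREI 6 r, INC 6]) rs)) m =
      fold eff (concat (map (\<lambda>r. [STOREI 6 r, INC 6]) rs)) (m(6 := w))" using m by simp
    also have "\<dots> = (\<lambda>x. if x = 6 then w + length rs
      else if w \<le> x \<and> x < w + length rs then (m(6 := w)) (rs ! (x - w)) else (m(6 := w)) x)"
      using fold_store[of rs "m(6 := w)" 6] rs w by force
    also have "\<dots> = m1"
    proof
      fix x
      have "rs ! (x - w) \<noteq> 6" if "w \<le> x" "x < w + length rs"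
        using rs(1) nth_mem[of "x - w" rs] that by force
      then show "(if x = 6 then w + length rs
        else if w \<le> x \<and> x < w + length rs then (m(6 := w)) (rs ! (x - w)) else (m(6 := w)) x) = m1 x"
        by (simp add: m1_def)
    qed
    finally show ?thesis .
  qed
  have s1: "wp (Ops (CPY 6 37 # concat (map (\<lambda>r. [STOREI 6 r, INC 6]) rs))) 21 (\<lambda>m'. m' = m1) m"
    by (rule wp_Ops) (simp_all only: f, use rs jump_free_store in simp_all)
  have low: "m1 x = m x" if "x < 80" "x \<noteq> 6" for x using that w by (simp add: m1_def)
  define m2 where "m2 = m1(3 := 0, 37 := w + bs)"
  have s2: "wp (ADD 37 23) (5 * bs + 2) (\<lambda>m'. m' = m2) m'" if "m' = m1" for m'
    unfolding that
    by (rule wp_conseq[OF wp_ADD[where T = "5 * bs + 2"]]) (use m low in \<open>simp_all add: m2_def\<close>)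
  define m3 where "m3 = m2(22 := Suc (length L))"
  have s3: "wp (Ops [INC 22]) 1 (\<lambda>m'. init_inv (L @ [map m rs]) m' \<and>
      agree ({3, 6, 22, 37} \<union> {B..}) m m') m'" if "m' = m2" for m'
    unfolding that
  proof (rule wp_Ops)
    have f: "fold eff [INC 22] m2 = m3" using m low[of 22] by (simp add: m3_def m2_def)
    have out: "m3 x = m x" if "x \<notin> {3, 6, 22, 37}" "x < w \<or> w + length rs \<le> x" for x
      using that by (auto simp: m3_def m2_def m1_def)
    have inw: "m3 (w + k) = m (rs ! k)" if "k < length rs" for k
      using that w by (simp add: m3_def m2_def m1_def)
    have ag: "agree ({3, 6, 22, 37} \<union> {B..}) m m3"
      unfolding agree_def using out w by auto
    have reg: "m3 r = m r" if "r \<in> {2, 20, 21, 23, 25, 26, 27, 28, 29, 30}" for r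
      using out[of r] that w by auto
    have arr: "m3 (IS + \<sigma> ! i) = i" if "i < length \<sigma>" for i
    proof -
      have "\<sigma> ! i \<in> set \<sigma>" using that by simp
      then have "\<sigma> ! i \<le> length \<sigma>" using perm(1) by (simp add: is_perm_def)
      then have "m3 (IS + \<sigma> ! i) = m (IS + \<sigma> ! i)" using out IS B N w by simp
      then show ?thesis using inv that by (simp add: init_inv_def)
    qed
    have arr': "m3 (IT + \<tau> ! j) = j" if "j < length \<tau>" for j
    proof -
      have "\<tau> ! j \<in> set \<tau>" using that by simp
      then have "\<tau> ! j \<le> length \<tau>" using perm(2) by (simp add: is_perm_def)
      then have "m3 (IT + \<tau> ! j) = m (IT + \<tau> ! j)" using out IS B N w by simp
      then show ?thesis using inv that by (simp add: init_inv_def)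
    qed
    have cells: "length ((L @ [map m rs]) ! j) \<le> bs \<and> (\<forall>k<bs. m3 (B + j * bs + k) =
        (if k < length ((L @ [map m rs]) ! j) then (L @ [map m rs]) ! j ! k else 0))"
      if "j < length (L @ [map m rs])" for j
    proof (cases "j < length L")
      case True
      have "m3 (B + j * bs + k) = m (B + j * bs + k)" if "k < bs" for k
      proof -
        have "Suc j * bs \<le> length L * bs" using True by (intro mult_le_mono1) simp
        then have "B + j * bs + k < w" using that by (simp add: w_def)
        then show ?thesis using out w by simp
      qed
      then show ?thesis using inv True by (simp add: init_inv_def nth_append)
    next
      case False
      then have j: "j = length L" using that by simp
      have "m3 (w + k) = (if k < length rs then m (rs ! k) else 0)" if "k < bs" for k
        using inw out[of "w + k"] m(5) w by (cases "k < length rs") auto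
      then show ?thesis using rs unfolding j by (simp add: w_def)
    qed
    have fresh: "m3 x = 0" if "w + bs \<le> x" for x
      using out[of x] m(5) that rs w by auto
    have "m3 2 = m 2" "m3 20 = m 20" "m3 21 = m 21" "m3 23 = m 23" "m3 25 = m 25"
      "m3 26 = m 26" "m3 27 = m 27" "m3 28 = m 28" "m3 29 = m 29" "m3 30 = m 30"
      by (rule reg; simp)+
    moreover have "m3 22 = length (L @ [map m rs])" "m3 37 = B + length (L @ [map m rs]) * bs"
      by (simp_all add: m3_def m2_def w_def)
    moreover have "\<forall>x\<ge>B + length (L @ [map m rs]) * bs. m3 x = 0" using fresh by (simp add: w_def add.assoc add.commute)
    ultimately have "init_inv (L @ [map m rs]) m3"
      unfolding init_inv_def using inv[unfolded init_inv_def] arr arr' cells by metis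
    with ag show "init_inv (L @ [map m rs]) (fold eff [INC 22] m2) \<and>
      agree ({3, 6, 22, 37} \<union> {B..}) m (fold eff [INC 22] m2)" unfolding f by blast
  qed simp_all
  show ?thesis unfolding MKREC_def
    by (rule wp_SeqI[OF s1], rule wp_SeqI[OF s2], assumption, erule s3, rule le_refl) simp
qed

definition pos :: "nat list \<Rightarrow> nat \<Rightarrow> nat" where
  "pos xs v = (THE i. i < length xs \<and> xs ! i = v)"

lemma pos_nth:
  assumes "is_perm xs" "i < length xs"
  shows "pos xs (xs ! i) = i"
  unfolding pos_def
  by (rule the_equality) (use assms in \<open>auto simp: is_perm_def nth_eq_iff_index_eq\<close>)

lemma perm_obtain:
  assumes "is_perm xs" "1 \<le> v" "v \<le> length xs"
  obtains i where "i < length xs" "xs ! i = v"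
proof -
  have "v \<in> set xs" using assms by (simp add: is_perm_def)
  then show thesis using that by (auto simp: in_set_conv_nth)
qed

definition unit_rec :: "nat \<Rightarrow> nat \<Rightarrow> nat list" where
  "unit_rec v u = [pos \<sigma> v, Suc (pos \<sigma> v), v, Suc v, pos \<tau> u, Suc (pos \<tau> u), u, Suc u, 1, v]"

lemma wp_UNIT:
  assumes inv: "init_inv L m" and v: "m (xr 0) = v" "1 \<le> v" "v \<le> length \<sigma>"
    and u: "m (xr 1) = u" "1 \<le> u" "u \<le> length \<tau>"
  shows "wp UNIT (15 * N + 5 * bs + 50) (\<lambda>m'. init_inv (L @ [unit_rec v u]) m' \<and>
    m' (xr 0) = m (xr 0) \<and> m' (cr 0) = m (cr 0) \<and> m' (xr 1) = m (xr 1) \<and> m' (cr 1) = m (cr 1)) m"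
proof -
  obtain i where i: "i < length \<sigma>" "\<sigma> ! i = v" using perm_obtain[OF perm(1) v(2,3)] .
  obtain j where j: "j < length \<tau>" "\<tau> ! j = u" using perm_obtain[OF perm(2) u(2,3)] .
  have pi: "pos \<sigma> v = i" "pos \<tau> u = j" using pos_nth perm i j by auto
  have m: "m 2 = 0" "m 25 = IS" "m 26 = IT" "m 30 = 1" using inv by (simp_all add: init_inv_def)
  have "m (IS + \<sigma> ! i) = i" "m (IT + \<tau> ! j) = j" using inv i(1) j(1) by (auto simp: init_inv_def)
  then have mi: "m (IS + v) = i" "m (IT + u) = j" using i j by simp_all
  have lt: "xr 0 < 80" "xr 1 < 80" "cr 0 < 80" "cr 1 < 80" by (simp_all add: xr_def cr_def)
  define m1 where "m1 = m(4 := IS)"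
  define m2 where "m2 = m(3 := 0, 4 := IS + v)"
  define m3 where "m3 = m(3 := 0, 4 := IT, 33 := i, 38 := Suc i, 39 := Suc v)"
  define m4 where "m4 = m(3 := 0, 4 := IT + u, 33 := i, 38 := Suc i, 39 := Suc v)"
  define m5 where "m5 = m(3 := 0, 4 := IT + u, 33 := i, 38 := Suc i, 39 := Suc v,
    36 := j, 40 := Suc j, 41 := Suc u)"
  have s1: "wp (Ops [CPY 4 25]) 1 (\<lambda>m'. m' = m1) m" by (rule wp_Ops) (simp_all add: m1_def m)
  have s2: "wp (ADD 4 (xr 0)) (5 * N + 2) (\<lambda>m'. m' = m2) m'" if "m' = m1" for m'
    unfolding that
    by (rule wp_conseq[OF wp_ADD[where T = "5 * N + 2"]]) (use m v N in \<open>simp_all add: m1_def m2_def fun_eq_iff\<close>)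
  have s3: "wp (Ops [LOADI 33 4, CPY 38 33, INC 38, CPY 39 (xr 0), INC 39, CPY 4 26]) 6 (\<lambda>m'. m' = m3) m'"
    if "m' = m2" for m'
    unfolding that
    by (rule wp_Ops) (use m v mi IS in \<open>simp_all add: m2_def m3_def fun_eq_iff\<close>)
  have s4: "wp (ADD 4 (xr 1)) (5 * N + 2) (\<lambda>m'. m' = m4) m'" if "m' = m3" for m'
    unfolding that
    by (rule wp_conseq[OF wp_ADD[where T = "5 * N + 2"]]) (use m u N in \<open>simp_all add: m3_def m4_def fun_eq_iff\<close>)
  have s5: "wp (Ops [LOADI 36 4, CPY 40 36, INC 40, CPY 41 (xr 1), INC 41]) 5 (\<lambda>m'. m' = m5) m'"
    if "m' = m4" for m'
    unfolding that
    by (rule wp_Ops) (use m u mi IS in \<open>simp_all add: m4_def m5_def fun_eq_iff\<close>)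
  let ?rs = "[33, 38, xr 0, 39, 36, 40, xr 1, 41, 30, xr 0]"
  have a5: "agree {3, 4, 33, 36, 38, 39, 40, 41} m m5" by (simp add: agree_def m5_def)
  have inv5: "init_inv L m5" by (rule init_inv_agree[OF inv a5]) (simp add: fixed_regs_def)
  have vals: "map m5 ?rs = unit_rec v u"
    using v u m by (simp add: m5_def unit_rec_def pi)
  have s6: "wp (MKREC ?rs) (5 * bs + 24) (\<lambda>m'. init_inv (L @ [unit_rec v u]) m' \<and>
    m' (xr 0) = m (xr 0) \<and> m' (cr 0) = m (cr 0) \<and> m' (xr 1) = m (xr 1) \<and> m' (cr 1) = m (cr 1)) m'"
    if "m' = m5" for m'
    unfolding that
  proof (rule wp_conseq[OF wp_MKREC[OF inv5, of ?rs]])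
    fix m' assume *: "init_inv (L @ [map m5 ?rs]) m' \<and> agree ({3, 6, 22, 37} \<union> {B..}) m5 m'"
    have "m' x = m x" if "x \<in> {xr 0, cr 0, xr 1, cr 1}" for x
    proof -
      have "60 \<le> x" "x < 80" using that lt by auto
      then have "m' x = m5 x" using IS B by (intro agreeD[OF conjunct2[OF *]]) auto
      also have "\<dots> = m x" using \<open>60 \<le> x\<close> by (simp add: m5_def)
      finally show ?thesis .
    qed
    then show "init_inv (L @ [unit_rec v u]) m' \<and>
      m' (xr 0) = m (xr 0) \<and> m' (cr 0) = m (cr 0) \<and> m' (xr 1) = m (xr 1) \<and> m' (cr 1) = m (cr 1)"
      using * unfolding vals by simp
  qed (use lt bs_ge in simp_all)
  show ?thesis unfolding UNIT_def
    by (rule wp_SeqI[OF s1], rule wp_SeqI[OF s2], assumption, rule wp_SeqI[OF s3], assumption,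
        rule wp_SeqI[OF s4], assumption, rule wp_SeqI[OF s5], assumption, erule s6, (rule le_refl)+) simp
qed

lemma ctl_fixed: "set is \<subseteq> {..<8} \<Longrightarrow> ctl is \<subseteq> {..<80} - fixed_regs"
  by (auto simp: ctl_def fixed_regs_def xr_def cr_def)

definition all_keys :: "nat list list" where
  "all_keys = product_lists (replicate 8 (map (\<lambda>j. 0 + j * 1) [0..<N]))"

definition all_units :: "nat list list" where
  "all_units = concat (map (\<lambda>v. map (unit_rec v) [1..<Suc (length \<tau>)]) [1..<Suc (length \<sigma>)])"

lemma wp_KEYS:
  assumes "init_inv L m"
  shows "wp (NEST 29 20 30 [0..<8] (MKREC (map xr [0..<8]))) (nest_time N 1 (5 * bs + 24) 8)
    (init_inv (L @ all_keys)) m"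
proof -
  let ?vs = "map (\<lambda>j. 0 + j * 1) [0..<N]"
  have lt: "xr i < 80" "cr i < 80" if "i < 8" for i using that by (simp_all add: xr_def cr_def)
  have "wp (NEST 29 20 30 [0..<8] (MKREC (map xr [0..<8]))) (nest_time N 1 (5 * bs + 24) (length [0..<8]))
    ((\<lambda>H. init_inv (L @ H)) ([] @ product_lists (replicate (length [0..<8]) ?vs))) m"
  proof (rule wp_NEST[where J = "\<lambda>H. init_inv (L @ H)"])
    show "init_inv (L @ H) m2" if "init_inv (L @ H) m1" "agree (ctl [0..<8]) m1 m2" for H m1 m2
      by (rule init_inv_agree[OF that ctl_fixed]) auto
    show "wp (MKREC (map xr [0..<8])) (5 * bs + 24) (\<lambda>m'. init_inv (L @ H @ [map (\<lambda>i. m1 (xr i)) [0..<8]]) m' \<and>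
        (\<forall>i\<in>set [0..<8]. m' (xr i) = m1 (xr i) \<and> m' (cr i) = m1 (cr i))) m1"
      if J: "init_inv (L @ H) m1" for H m1
    proof (rule wp_conseq[OF wp_MKREC[OF J]])
      fix m' assume *: "init_inv ((L @ H) @ [map m1 (map xr [0..<8])]) m' \<and>
        agree ({3, 6, 22, 37} \<union> {B..}) m1 m'"
      have "m' x = m1 x" if "60 \<le> x" "x < 80" for x
        by (rule agreeD[OF conjunct2[OF *]]) (use that IS B in auto)
      then show "init_inv (L @ H @ [map (\<lambda>i. m1 (xr i)) [0..<8]]) m' \<and>
        (\<forall>i\<in>set [0..<8]. m' (xr i) = m1 (xr i) \<and> m' (cr i) = m1 (cr i))"
        using * lt by (simp add: o_def)
    qed (use lt bs_ge in auto)
  qed (use assms in \<open>auto simp: init_inv_def\<close>)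
  then show ?thesis by (simp add: all_keys_def)
qed

lemma wp_UNITS:
  assumes "init_inv L m"
  shows "wp (NEST 30 27 30 [0] (NEST 30 28 30 [1] UNIT))
    (nest_time (length \<sigma>) 1 (nest_time (length \<tau>) 1 (15 * N + 5 * bs + 50) 1) 1)
    (init_inv (L @ all_units)) m"
proof -
  let ?vs = "map (\<lambda>j. 1 + j * 1) [0..<length \<sigma>]" and ?us = "map (\<lambda>j. 1 + j * 1) [0..<length \<tau>]"
  have vs: "map (\<lambda>j. 1 + j * 1) [0..<n] = [1..<Suc n]" for n
    by (intro nth_equalityI) (simp_all del: upt_Suc)
  have sing: "product_lists (replicate (length [i]) xs) = map (\<lambda>x. [x]) xs" for i :: nat and xs :: "nat list"
    by (simp add: concat_map_singleton)
  define J where "J = (\<lambda>H :: nat list list. init_inv (L @ concat (map (\<lambda>t. map (unit_rec (hd t)) [1..<Suc (length \<tau>)]) H)))"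
  let ?t = "nest_time (length \<tau>) 1 (15 * N + 5 * bs + 50) 1"
  have inner: "wp (NEST 30 28 30 [1] UNIT) ?t (\<lambda>m'. J (H @ [map (\<lambda>i. m1 (xr i)) [0]]) m' \<and>
      (\<forall>i\<in>set [0]. m' (xr i) = m1 (xr i) \<and> m' (cr i) = m1 (cr i))) m1"
    if J: "J H m1" and ran: "m1 (xr 0) \<in> set ?vs" for H m1
  proof -
    define v where "v = m1 (xr 0)"
    define L1 where "L1 = L @ concat (map (\<lambda>t. map (unit_rec (hd t)) [1..<Suc (length \<tau>)]) H)"
    define J' where "J' = (\<lambda>(H' :: nat list list) m'. init_inv (L1 @ map (\<lambda>t. unit_rec v (hd t)) H') m' \<and>
      m' (xr 0) = v \<and> m' (cr 0) = m1 (cr 0))"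
    have v: "1 \<le> v" "v \<le> length \<sigma>" using ran by (auto simp: v_def)
    have "wp (NEST 30 28 30 [1] UNIT) (nest_time (length \<tau>) 1 (15 * N + 5 * bs + 50) (length [1 :: nat]))
      (J' ([] @ product_lists (replicate (length [1 :: nat]) ?us))) m1"
    proof (rule wp_NEST)
      show "m 2 = 0 \<and> m 30 = 1 \<and> m 28 = length \<tau> \<and> m 30 = 1" if "J' H' m" for H' m
        using that by (simp add: J'_def init_inv_def)
      show "J' H' m3" if "J' H' m2" and a: "agree (ctl [1]) m2 m3" for H' m2 m3
      proof -
        have "init_inv (L1 @ map (\<lambda>t. unit_rec v (hd t)) H') m3"
          by (rule init_inv_agree[OF _ a ctl_fixed]) (use that in \<open>auto simp: J'_def\<close>)
        moreover have "m3 (xr 0) = m2 (xr 0)" "m3 (cr 0) = m2 (cr 0)"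
          by (rule agreeD[OF a]; simp add: ctl_def)+
        ultimately show ?thesis using that(1) by (simp add: J'_def)
      qed
      show "wp UNIT (15 * N + 5 * bs + 50) (\<lambda>m'. J' (H' @ [map (\<lambda>i. m2 (xr i)) [1]]) m' \<and>
          (\<forall>i\<in>set [1]. m' (xr i) = m2 (xr i) \<and> m' (cr i) = m2 (cr i))) m2"
        if J': "J' H' m2" and "\<forall>i\<in>set [1]. m2 (xr i) \<in> set ?us" for H' m2
      proof -
        have u: "1 \<le> m2 (xr 1)" "m2 (xr 1) \<le> length \<tau>" using that(2) by auto
        have i: "init_inv (L1 @ map (\<lambda>t. unit_rec v (hd t)) H') m2" "m2 (xr 0) = v" "m2 (cr 0) = m1 (cr 0)"
          using J' by (simp_all add: J'_def)
        show ?thesis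
          by (rule wp_conseq[OF wp_UNIT[OF i(1,2) v refl u]]) (use i in \<open>simp_all add: J'_def\<close>)
      qed
      show "J' [] m1" using J by (simp add: J'_def J_def L1_def v_def)
    qed simp_all
    then show ?thesis unfolding sing vs
      by (rule wp_conseq) (simp_all add: J'_def J_def L1_def v_def o_def del: upt_Suc)
  qed
  have "wp (NEST 30 27 30 [0] (NEST 30 28 30 [1] UNIT)) (nest_time (length \<sigma>) 1 ?t (length [0 :: nat]))
    (J ([] @ product_lists (replicate (length [0 :: nat]) ?vs))) m"
  proof (rule wp_NEST)
    show "m 2 = 0 \<and> m 30 = 1 \<and> m 27 = length \<sigma> \<and> m 30 = 1" if "J H m" for H m
      using that by (simp add: J_def init_inv_def)
    show "J H m2" if "J H m1" "agree (ctl [0]) m1 m2" for H m1 m2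
      unfolding J_def by (rule init_inv_agree[OF that(1)[unfolded J_def] that(2) ctl_fixed]) simp
    show "J [] m" using assms by (simp add: J_def)
    show "wp (NEST 30 28 30 [1] UNIT) ?t (\<lambda>m'. J (H @ [map (\<lambda>i. m1 (xr i)) [0]]) m' \<and>
      (\<forall>i\<in>set [0]. m' (xr i) = m1 (xr i) \<and> m' (cr i) = m1 (cr i))) m1"
      if "J H m1" "\<forall>i\<in>set [0]. m1 (xr i) \<in> set ?vs" for H m1
      using inner[OF that(1)] that(2) by simp
  qed simp_all
  then show ?thesis unfolding sing vs
    by (rule wp_conseq) (simp_all add: J_def all_units_def o_def del: upt_Suc)
qed

definition all_recs :: "nat list list" where
  "all_recs = [0, N, 0, N, 0, N, 0, N] # all_keys @ all_units"

definition init_time :: nat where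
  "init_time = 15 + 5 * N + 2 + 1 + (5 * bs + 24) + nest_time N 1 (5 * bs + 24) 8 +
    nest_time (length \<sigma>) 1 (nest_time (length \<tau>) 1 (15 * N + 5 * bs + 50) 1) 1 + 1"

lemma wp_INIT:
  assumes "ready m"
  shows "wp INIT init_time (\<lambda>m'. init_inv all_recs m' \<and> m' 24 = B + length all_recs * bs) m"
proof -
  have m: "m 2 = 0" "m 20 = N" "m 25 = IS" "m 26 = IT" "m 27 = length \<sigma>" "m 28 = length \<tau>"
    "\<forall>i<length \<sigma>. m (IS + \<sigma> ! i) = i" "\<forall>j<length \<tau>. m (IT + \<tau> ! j) = j" "\<forall>x\<ge>B. m x = 0"
    using assms by (simp_all add: ready_def)
  define m1 where "m1 = m(29 := 0, 30 := 1, 23 := bs, 22 := 0, 21 := IT)"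
  define m2 where "m2 = m(29 := 0, 30 := 1, 23 := bs, 22 := 0, 3 := 0, 21 := B)"
  define m3 where "m3 = m(29 := 0, 30 := 1, 23 := bs, 22 := 0, 3 := 0, 21 := B, 37 := B)"
  have s1: "wp (Ops ([CLR 29, CLR 30, INC 30, CPY 23 20] @ replicate 9 (INC 23) @ [CLR 22, CPY 21 26])) 15
      (\<lambda>m'. m' = m1) m"
    by (rule wp_Ops) (simp_all add: jump_free_replicate fold_INC m m1_def bs_def fun_eq_iff del: fold_replicate)
  have s2: "wp (ADD 21 20) (5 * N + 2) (\<lambda>m'. m' = m2) m'" if "m' = m1" for m'
    unfolding that
    by (rule wp_conseq[OF wp_ADD[where T = "5 * N + 2"]]) (use m B in \<open>simp_all add: m1_def m2_def fun_eq_iff\<close>)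
  have s3: "wp (Ops [CPY 37 21]) 1 (\<lambda>m'. m' = m3) m'" if "m' = m2" for m'
    unfolding that by (rule wp_Ops) (simp_all add: m2_def m3_def)
  have inv3: "init_inv [] m3"
  proof -
    have "m3 x = m x" if "80 \<le> x" for x using that by (simp add: m3_def)
    then have "m3 (IS + x) = m (IS + x)" "m3 (IT + x) = m (IT + x)" "B \<le> y \<Longrightarrow> m3 y = m y" for x y
      using IS B by simp_all
    then show ?thesis using m by (simp add: init_inv_def m3_def)
  qed
  let ?rs = "[29, 20, 29, 20, 29, 20, 29, 20]"
  have s4: "wp (MKREC ?rs) (5 * bs + 24) (init_inv [[0, N, 0, N, 0, N, 0, N]]) m'" if "m' = m3" for m'
    unfolding that
  proof (rule wp_conseq[OF wp_MKREC[OF inv3]])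
    fix m' assume "init_inv ([] @ [map m3 ?rs]) m' \<and> agree ({3, 6, 22, 37} \<union> {B..}) m3 m'"
    moreover have "map m3 ?rs = [0, N, 0, N, 0, N, 0, N]" using m by (simp add: m3_def)
    ultimately show "init_inv [[0, N, 0, N, 0, N, 0, N]] m'" by simp
  qed (use bs_ge in simp_all)
  have s7: "wp (Ops [CPY 24 37]) 1 (\<lambda>m'. init_inv all_recs m' \<and> m' 24 = B + length all_recs * bs) m'"
    if i: "init_inv (([[0, N, 0, N, 0, N, 0, N]] @ all_keys) @ all_units) m'" for m'
  proof (rule wp_Ops)
    have L: "([[0, N, 0, N, 0, N, 0, N]] @ all_keys) @ all_units = all_recs" by (simp add: all_recs_def)
    note i' = i[unfolded L]
    have "agree {24} m' (m'(24 := m' 37))" by (simp add: agree_def)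
    then have "init_inv all_recs (m'(24 := m' 37))"
      by (rule init_inv_agree[OF i']) (simp add: fixed_regs_def)
    moreover have "m' 37 = B + length all_recs * bs" using i' by (simp add: init_inv_def)
    ultimately show "init_inv all_recs (fold eff [CPY 24 37] m') \<and>
      fold eff [CPY 24 37] m' 24 = B + length all_recs * bs" by simp
  qed simp_all
  show ?thesis unfolding INIT_def
    by (rule wp_SeqI[OF s1], rule wp_SeqI[OF s2], assumption, rule wp_SeqI[OF s3], assumption,
        rule wp_SeqI[OF s4], assumption, rule wp_SeqI[OF wp_KEYS], assumption,
        rule wp_SeqI[OF wp_UNITS], assumption, erule s7, (rule le_refl)+) (simp add: init_time_def)
qed

lemma length_all_recs: "length all_recs = 1 + N ^ 8 + length \<sigma> * length \<tau>"
proof -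
  have "length all_keys = N ^ 8"
  proof -
    have "foldr (*) (map length (replicate k xs)) 1 = length xs ^ k" for k and xs :: "nat list"
      by (induction k) (auto simp del: map_replicate)
    from this[of 8] show ?thesis by (simp only: all_keys_def length_product_lists length_map length_upt diff_zero)
  qed
  moreover have "length all_units = length \<sigma> * length \<tau>"
    by (simp add: all_units_def length_concat o_def sum_list_triv del: upt_Suc)
  ultimately show ?thesis by (simp add: all_recs_def)
qed

lemma unit_tight:
  assumes "i < length \<sigma>" "j < length \<tau>"
  shows "take 8 (unit_rec (\<sigma> ! i) (\<tau> ! j)) = tight \<sigma> \<tau> [(i, j)]"
  using pos_nth[OF perm(1) assms(1)] pos_nth[OF perm(2) assms(2)]
  by (simp add: unit_rec_def tight_def)

sublocale db \<sigma> \<tau> N B "length all_recs" D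
  rewrites "db.h N = bs"
proof -
  show "db \<sigma> \<tau> N B D" by unfold_locales (use perm N D IS B in auto)
  show "db.h N = bs" by (simp add: db.h_def[OF \<open>db \<sigma> \<tau> N B D\<close>] bs_def)
qed

lemma all_recs_cases:
  assumes "l \<in> set all_recs"
  obtains "l = [0, N, 0, N, 0, N, 0, N]"
  | "l \<in> set all_keys" "length l = 8" "set l \<subseteq> {..<N}"
  | i j where "i < length \<sigma>" "j < length \<tau>" "l = unit_rec (\<sigma> ! i) (\<tau> ! j)"
proof -
  consider "l = [0, N, 0, N, 0, N, 0, N]" | "l \<in> set all_keys" | "l \<in> set all_units"
    using assms by (auto simp: all_recs_def)
  then show thesis
  proof cases
    case 2
    then have "list_all2 (\<lambda>x ys. x \<in> set ys) l (replicate 8 (map (\<lambda>j. 0 + j * 1) [0..<N]))"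
      by (simp only: all_keys_def product_lists_set mem_Collect_eq)
    then have l: "length l = 8" "\<And>i. i < 8 \<Longrightarrow> l ! i < N"
      by (auto simp: list_all2_conv_all_nth)
    then have "set l \<subseteq> {..<N}" by (auto simp: set_conv_nth)
    with 2 l(1) show thesis using that(2) by blast
  next
    case 3
    then obtain v u where "1 \<le> v" "v \<le> length \<sigma>" "1 \<le> u" "u \<le> length \<tau>" "l = unit_rec v u"
      by (auto simp: all_units_def less_Suc_eq_le simp del: upt_Suc)
    then show thesis using that(3) perm_obtain[OF perm(1), of v] perm_obtain[OF perm(2), of u] by metis
  qed (use that in blast)
qed

lemma init_db:
  assumes inv: "init_inv all_recs m" and b: "m 24 = B + length all_recs * bs"
  shows "db_inv m" "rkey m B = [0, N, 0, N, 0, N, 0, N]"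
    "\<And>K. length K = 8 \<Longrightarrow> set K \<subseteq> {..<N} \<Longrightarrow> \<exists>p\<in>recs. rkey m p = K"
    "\<And>i j. i < length \<sigma> \<Longrightarrow> j < length \<tau> \<Longrightarrow> \<exists>p\<in>recs. rkey m p = tight \<sigma> \<tau> [(i, j)] \<and> 1 \<le> m (p + 8)"
proof -
  have bs: "10 < bs" using bs_ge by simp
  have cell: "m (B + j * bs + k) = (if k < length (all_recs ! j) then all_recs ! j ! k else 0)"
    if "j < length all_recs" "k < bs" for j k
    using inv that by (simp add: init_inv_def)
  have len: "8 \<le> length l" if "l \<in> set all_recs" for l
    using that by (cases rule: all_recs_cases) (auto simp: unit_rec_def)
  have key: "rkey m (B + j * bs) = take 8 (all_recs ! j)" if "j < length all_recs" for j
    using cell[OF that] bs len[of "all_recs ! j"] that by (intro nth_equalityI) (auto simp: rkey_def)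
  have ex: "\<exists>p\<in>recs. rkey m p = take 8 l \<and> m (p + 8) = (if 8 < length l then l ! 8 else 0)"
    if l: "l \<in> set all_recs" for l
  proof -
    from l obtain j where j: "j < length all_recs" "all_recs ! j = l" unfolding in_set_conv_nth by blast
    then have "B + j * bs \<in> recs" by (auto simp: recs_def)
    moreover have "rkey m (B + j * bs) = take 8 l" using key j by simp
    moreover have "m (B + j * bs + 8) = (if 8 < length l then l ! 8 else 0)" using cell[OF j(1), of 8] bs j by simp
    ultimately show ?thesis by blast
  qed
  have "small_key N m p \<and> valid \<sigma> \<tau> (rkey m p) (rlist m p)" if p: "p \<in> recs" for p
  proof -
    obtain j where j: "j < length all_recs" "p = B + j * bs" using p by (auto simp: recs_def)
    let ?l = "all_recs ! j"
    have l: "?l \<in> set all_recs" using j by simp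
    note k = key[OF j(1), folded j(2)]
    have c: "m (p + k) = (if k < length ?l then ?l ! k else 0)" if "k < bs" for k using cell[OF j(1) that] j by simp
    have "13 \<le> p" using j IS B by simp
    from l show ?thesis
    proof (cases rule: all_recs_cases)
      case 1
      have "set ?l \<subseteq> {..N}" unfolding 1 by auto
      then have "m (p + k) \<le> N" if "k < 8" for k using c[of k] that bs by (auto dest: nth_mem)
      moreover have "m (p + 8) = 0" using c[of 8] bs by (simp add: 1)
      ultimately show ?thesis using \<open>13 \<le> p\<close> by (simp add: small_key_def rlist_def valid_Nil)
    next
      case 2
      have "m (p + k) \<le> N" if "k < 8" for k using c[of k] that bs 2(2) subsetD[OF 2(3) nth_mem[of k ?l]] by simp
      moreover have "m (p + 8) = 0" using c[of 8] bs 2 by simp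
      ultimately show ?thesis using \<open>13 \<le> p\<close> by (simp add: small_key_def rlist_def valid_Nil)
    next
      case (3 i i')
      have pt: "\<sigma> ! i \<le> length \<sigma>" "\<tau> ! i' \<le> length \<tau>"
        using nth_mem[OF 3(1)] nth_mem[OF 3(2)] perm by (auto simp: is_perm_def)
      have t: "rkey m p = tight \<sigma> \<tau> [(i, i')]" using k 3 unit_tight by simp
      have sub: "set (unit_rec (\<sigma> ! i) (\<tau> ! i')) \<subseteq> {..N}"
        using pt 3(1,2) pos_nth[OF perm(1) 3(1)] pos_nth[OF perm(2) 3(2)] N by (simp add: unit_rec_def)
      then have "m (p + k) \<le> N" if "k < 8" for k
        using c[of k] that bs 3(3) subsetD[OF sub nth_mem[of k "unit_rec (\<sigma> ! i) (\<tau> ! i')"]]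
        by (simp add: unit_rec_def)
      moreover have "m (p + 8) = 1" "m (p + 9) = \<sigma> ! i"
        using c[of 8] c[of 9] bs 3(3) by (simp_all add: unit_rec_def eval_nat_numeral)
      then have "rlist m p = [\<sigma> ! i]" by (simp add: rlist_def)
      moreover have "valid \<sigma> \<tau> (tight \<sigma> \<tau> [(i, i')]) [\<sigma> ! i]"
        unfolding valid_def match_def in_box_def tight_nth using 3(1,2) by (intro exI[of _ "[(i, i')]"]) simp
      ultimately show ?thesis using \<open>13 \<le> p\<close> t by (simp add: small_key_def)
    qed
  qed
  then show "db_inv m" using inv b by (simp add: db_inv_def init_inv_def buf_def)
  show "rkey m B = [0, N, 0, N, 0, N, 0, N]" using key[of 0] by (simp add: all_recs_def)
  show "\<exists>p\<in>recs. rkey m p = K" if "length K = 8" "set K \<subseteq> {..<N}" for K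
  proof -
    have "K \<in> set all_keys"
      unfolding all_keys_def product_lists_set using that
      by (auto simp: list_all2_conv_all_nth subset_iff)
    then have "K \<in> set all_recs" by (simp add: all_recs_def)
    from ex[OF this] show ?thesis using that(1) by auto
  qed
  show "\<exists>p\<in>recs. rkey m p = tight \<sigma> \<tau> [(i, j)] \<and> 1 \<le> m (p + 8)" if "i < length \<sigma>" "j < length \<tau>" for i j
  proof -
    have "\<sigma> ! i \<in> set \<sigma>" "\<tau> ! j \<in> set \<tau>" using that by auto
    then have m: "\<sigma> ! i \<in> set [1..<Suc (length \<sigma>)]" "\<tau> ! j \<in> set [1..<Suc (length \<tau>)]"
      using perm by (simp_all add: is_perm_def less_Suc_eq_le del: upt_Suc)
    have "unit_rec (\<sigma> ! i) (\<tau> ! j) \<in> set all_units"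
      unfolding all_units_def set_concat set_map
    proof (rule UnionI[OF imageI[OF imageI[OF m(1)]]])
      show "unit_rec (\<sigma> ! i) (\<tau> ! j) \<in> set (map (unit_rec (\<sigma> ! i)) [1..<Suc (length \<tau>)])"
        unfolding set_map by (rule imageI[OF m(2)])
    qed
    then have "unit_rec (\<sigma> ! i) (\<tau> ! j) \<in> set all_recs" by (simp add: all_recs_def)
    from ex[OF this] unit_tight[OF that] show ?thesis
      by (auto simp: unit_rec_def)
  qed
qed

lemma wp_INIT_ROUNDS:
  assumes "ready m" "decomposable D \<sigma> {0..<length \<sigma>}"
  shows "wp (INIT ;; ROUNDS D) (init_time + rounds_time) (\<lambda>m'. db_inv m' \<and>
    valid \<sigma> \<tau> (rkey m' B) (rlist m' B) \<and> longest_common_pattern (ranks (rlist m' B)) \<sigma> \<tau>) m"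
proof (rule wp_SeqI[OF wp_INIT[OF assms(1)]])
  fix m1 assume *: "init_inv all_recs m1 \<and> m1 24 = B + length all_recs * bs"
  note i = init_db[OF conjunct1[OF *] conjunct2[OF *]]
  show "wp (ROUNDS D) rounds_time (\<lambda>m'. db_inv m' \<and>
    valid \<sigma> \<tau> (rkey m' B) (rlist m' B) \<and> longest_common_pattern (ranks (rlist m' B)) \<sigma> \<tau>) m1"
    by (rule ROUNDS_correct[OF i(1) assms(2) _ i(2) i(3) i(4)]) (simp_all add: all_recs_def)
qed simp

end

section \<open>Freeing the registers\<close>

definition SCAN :: "nat \<Rightarrow> com" where
  "SCAN base = Ops [CLR 43, INC 43, LOADI 44 42] ;;
     While 44 (Ops [CPY 6 base] ;; ADD 6 44 ;; Ops [STOREI 6 43, INC 43, INC 42, LOADI 44 42])"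

text \<open>The first element of the permutation \<open>xs\<close> need not be known: position 0 is the default
  value of the array of positions.\<close>

lemma wp_SCAN:
  assumes perm: "is_perm xs" and N: "length xs < N" and n: "n = length xs - 1"
    and m: "m 2 = 0" "m 42 = p" "m base = A" "base < 60" "base \<notin> {2, 3, 6, 42, 43, 44}"
    and cells: "\<And>k. k < n \<Longrightarrow> m (p + k) = xs ! Suc k" "m (p + n) = 0"
    and zero: "\<And>v. v < N \<Longrightarrow> m (A + v) = 0" and p: "60 \<le> p" "p + n < A"
  shows "wp (SCAN base) (N * (5 * N + 12) + 4) (\<lambda>m'. agree ({3, 6, 42, 43, 44} \<union> {A..<A + N}) m m' \<and>
    m' 2 = 0 \<and> m' 43 = Suc n \<and> m' 42 = p + n \<and> (\<forall>i<length xs. m' (A + xs ! i) = i)) m"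
proof -
  define I where "I = (\<lambda>j m'. m' 2 = 0 \<and> m' 43 = Suc j \<and> m' 42 = p + j \<and> m' 44 = m (p + j) \<and>
    agree ({3, 6, 42, 43, 44} \<union> {A..<A + N}) m m' \<and>
    (\<forall>i. 1 \<le> i \<and> i \<le> j \<longrightarrow> m' (A + xs ! i) = i) \<and> (\<forall>v<N. v \<notin> (\<lambda>i. xs ! i) ` {1..j} \<longrightarrow> m' (A + v) = 0))"
  have val: "1 \<le> xs ! i" "xs ! i \<le> length xs" "xs ! i < N" if "i < length xs" for i
    using perm nth_mem[OF that] N by (auto simp: is_perm_def)
  have inj: "xs ! i = xs ! j \<longleftrightarrow> i = j" if "i < length xs" "j < length xs" for i j
    using perm that by (simp add: is_perm_def nth_eq_iff_index_eq)
  have s1: "wp (Ops [CLR 43, INC 43, LOADI 44 42]) 3 (I 0) m"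
    by (rule wp_Ops) (use m p zero in \<open>simp_all add: I_def agree_def\<close>)
  have step: "wp (Ops [CPY 6 base] ;; ADD 6 44 ;; Ops [STOREI 6 43, INC 43, INC 42, LOADI 44 42])
      (5 * N + 7) (\<lambda>m'. I (Suc j) (m'(2 := 0))) m1" if j: "j < n" and I: "I j m1" for j m1
  proof -
    define v where "v = xs ! Suc j"
    have Sj: "Suc j < length xs" using j n by simp
    note v = val[OF Sj, folded v_def]
    have ag: "agree ({3, 6, 42, 43, 44} \<union> {A..<A + N}) m m1" using I by (simp add: I_def)
    have r: "m1 2 = 0" "m1 43 = Suc j" "m1 42 = p + j" "m1 44 = v"
      using I cells(1)[OF j] by (simp_all add: I_def v_def)
    have old: "\<And>i. 1 \<le> i \<Longrightarrow> i \<le> j \<Longrightarrow> m1 (A + xs ! i) = i"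
      "\<And>u. u < N \<Longrightarrow> u \<notin> (\<lambda>i. xs ! i) ` {1..j} \<Longrightarrow> m1 (A + u) = 0"
      using I by (simp_all add: I_def)
    have mb: "m1 base = A" using agreeD[OF ag, of base] m p by simp
    define m2 where "m2 = m1(6 := A)"
    define m3 where "m3 = m1(3 := 0, 6 := A + v)"
    define m4 where "m4 = m1(3 := 0, 6 := A + v, A + v := Suc j, 43 := Suc (Suc j),
      42 := Suc (p + j), 44 := m (Suc (p + j)))"
    have u1: "wp (Ops [CPY 6 base]) 1 (\<lambda>m'. m' = m2) m1"
      by (rule wp_Ops) (simp_all add: m2_def mb)
    have u2: "wp (ADD 6 44) (5 * N + 2) (\<lambda>m'. m' = m3) m'" if "m' = m2" for m'
      unfolding that
      by (rule wp_conseq[OF wp_ADD[where T = "5 * N + 2"]]) (use r v in \<open>simp_all add: m2_def m3_def fun_eq_iff\<close>)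
    have nxt: "m1 (Suc (p + j)) = m (Suc (p + j))"
      by (rule agreeD[OF ag]) (use p j in auto)
    have f: "fold eff [STOREI 6 43, INC 43, INC 42, LOADI 44 42] m3 = m4"
      using r p j nxt by (simp add: m3_def m4_def fun_eq_iff)
    have I4: "I (Suc j) m4"
    proof -
      have "agree ({3, 6, 42, 43, 44} \<union> {A..<A + N}) m m4"
        unfolding agree_def
      proof (intro allI impI)
        fix x assume x: "x \<notin> {3, 6, 42, 43, 44} \<union> {A..<A + N}"
        then have "m4 x = m1 x" using v by (auto simp: m4_def)
        also have "m1 x = m x" by (rule agreeD[OF ag x])
        finally show "m4 x = m x" .
      qed
      moreover have "m4 (A + xs ! i) = i" if "1 \<le> i" "i \<le> Suc j" for i
      proof (cases "i = Suc j")
        case True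
        then show ?thesis using p by (simp add: m4_def v_def)
      next
        case False
        then have "xs ! i \<noteq> v" using inj[of i "Suc j"] Sj that by (simp add: v_def)
        then have "m4 (A + xs ! i) = m1 (A + xs ! i)" using p by (simp add: m4_def)
        then show ?thesis using old(1) that False by simp
      qed
      moreover have "m4 (A + u) = 0" if "u < N" "u \<notin> (\<lambda>i. xs ! i) ` {1..Suc j}" for u
      proof -
        have "u \<noteq> v" "u \<notin> (\<lambda>i. xs ! i) ` {1..j}" using that(2) by (auto simp: v_def)
        then show ?thesis using old(2)[OF that(1)] p by (simp add: m4_def)
      qed
      moreover have "m4 2 = 0" "m4 43 = Suc (Suc j)" "m4 42 = p + Suc j" "m4 44 = m (p + Suc j)"
        using r p by (simp_all add: m4_def)
      ultimately show ?thesis by (simp add: I_def)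
    qed
    then have "m4(2 := 0) = m4" by (simp add: I_def fun_eq_iff)
    then have u3: "wp (Ops [STOREI 6 43, INC 43, INC 42, LOADI 44 42]) 4 (\<lambda>m'. I (Suc j) (m'(2 := 0))) m'"
      if "m' = m3" for m'
      unfolding that by (intro wp_Ops) (simp_all only: f I4, simp_all)
    show ?thesis by (rule wp_SeqI[OF u1], rule wp_SeqI[OF u2], assumption, erule u3, (rule le_refl)+) simp
  qed
  have guard: "m1 44 = 0 \<longleftrightarrow> j = n" if "j \<le> n" "I j m1" for j m1
  proof -
    have "m1 44 = m (p + j)" using that by (simp add: I_def)
    moreover have "m (p + j) \<noteq> 0" if "j < n"
    proof -
      have "Suc j < length xs" using that n by simp
      from val(1)[OF this] show ?thesis using cells(1)[OF that] by simp
    qed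
    ultimately show ?thesis using cells(2) that(1) by (cases "j = n") auto
  qed
  have s2: "wp (While 44 (Ops [CPY 6 base] ;; ADD 6 44 ;; Ops [STOREI 6 43, INC 43, INC 42, LOADI 44 42]))
      (n * (5 * N + 7 + 3) + 1) (I n) m1" if "I 0 m1" for m1
    by (rule wp_While[where I = I]) (use that step guard in auto)
  have "wp (SCAN base) (N * (5 * N + 12) + 4) (I n) m" unfolding SCAN_def
  proof (rule wp_SeqI[OF s1], erule s2)
    have "n * (5 * N + 7 + 3) \<le> N * (5 * N + 12)" using n N by (intro mult_le_mono) auto
    then show "3 + (n * (5 * N + 7 + 3) + 1) \<le> N * (5 * N + 12) + 4" by simp
  qed
  then show ?thesis
  proof (rule wp_conseq)
    fix m' assume I: "I n m'"
    have "m' (A + xs ! i) = i" if "i < length xs" for i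
    proof (cases "i = 0")
      case True
      have "xs ! 0 \<noteq> xs ! x" if "x \<in> {1..n}" for x
      proof -
        have "0 < length xs" "x < length xs" "x \<noteq> 0" using that n by auto
        then show ?thesis using inj[of 0 x] by simp
      qed
      then have "xs ! 0 \<notin> (\<lambda>i. xs ! i) ` {1..n}" by blast
      moreover have "xs ! 0 < N" using val(3) that True by simp
      ultimately show ?thesis using I True by (simp add: I_def)
    next
      case False
      then show ?thesis using I that n by (simp add: I_def)
    qed
    then show "agree ({3, 6, 42, 43, 44} \<union> {A..<A + N}) m m' \<and>
      m' 2 = 0 \<and> m' 43 = Suc n \<and> m' 42 = p + n \<and> (\<forall>i<length xs. m' (A + xs ! i) = i)"
      using I by (simp add: I_def)
  qed simp
qed

text \<open>On entry every register may hold input. Two input cells are sacrificed: register 2, which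
  becomes the scratch register of jumps, and the first element of tau, which is replaced by a zero
  marking the end of sigma. Both can be recovered since they are the missing values of permutations.
  The copy of the input is shifted by \<open>N + K + 1\<close>.\<close>

definition SAVE :: "nat \<Rightarrow> com" where
  "SAVE K = Ops [CLR 2, INC 0, INC 0, STOREI 0 2] ;; While 0 (Ops [DEC 0, INC 1]) ;;
     Ops (replicate (K + 4) (INC 1)) ;; Ops (concat (map (\<lambda>r. [STOREI 1 r, INC 1]) [3..<Suc K])) ;;
     Ops ([CPY 20 1] @ replicate (2 * K + 2) (DEC 20) @ [CLR 5] @ replicate (K + 1) (INC 5) @ [CPY 6 1, CPY 7 20]) ;;
     MEMCPY"

definition PRELUDE :: "nat \<Rightarrow> com" where
  "PRELUDE K = SAVE K ;; Ops [CPY 25 6, CPY 26 6] ;; ADD 26 20 ;;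
     Ops (CPY 42 20 # replicate (K + 4) (INC 42)) ;; SCAN 25 ;;
     Ops [CPY 27 43, INC 42] ;; SCAN 26 ;;
     Ops [CPY 28 20, DEC 28, DEC 28] ;; SUB 28 27"

lemma fold_DEC: "fold eff (replicate k (DEC t)) m = m(t := m t - k)"
  by (induction k arbitrary: m) (auto simp: fun_eq_iff)

lemma wp_SAVE:
  assumes a: "1 \<le> length \<sigma>" and K: "80 \<le> K" and N: "N = length \<sigma> + length \<tau> + 2"
  defines "S \<equiv> N + K + 1" and "M \<equiv> (snd (init_config \<sigma> \<tau>))(2 + length \<sigma> := 0)"
  shows "wp (SAVE K) (13 * N + 7 * K + 30) (\<lambda>m'. m' 2 = 0 \<and> m' 20 = N \<and> m' 6 = S + K + 1 + N \<and>
    (\<forall>r. 3 \<le> r \<and> r \<le> K + N \<longrightarrow> m' (S + r) = M r) \<and> (\<forall>x\<ge>S + K + 1 + N. m' x = 0)) (snd (init_config \<sigma> \<tau>))"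
proof -
  let ?m = "snd (init_config \<sigma> \<tau>)"
  have m01: "?m 0 = length \<sigma>" "?m 1 = length \<tau>" by (simp_all add: init_config_def)
  have mN: "?m x = 0" if "N \<le> x" for x using that N by (simp add: init_config_def)
  have MN: "M x = 0" if "N \<le> x" for x using mN[OF that] by (simp add: M_def)
  define m1 where "m1 = M(2 := 0, 0 := length \<sigma> + 2)"
  define m2 where "m2 = M(2 := 0, 0 := 0, 1 := N)"
  define m3 where "m3 = M(2 := 0, 0 := 0, 1 := S + 3)"
  have s1: "wp (Ops [CLR 2, INC 0, INC 0, STOREI 0 2]) 4 (\<lambda>m'. m' = m1) ?m"
    by (rule wp_Ops) (use a in \<open>simp_all add: m01 m1_def M_def fun_eq_iff\<close>)
  have s2: "wp (While 0 (Ops [DEC 0, INC 1])) (5 * N + 1) (\<lambda>m'. m' = m2) m'" if "m' = m1" for m'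
    unfolding that
    by (rule wp_conseq[OF wp_drain_INC]) (use a m01 N in \<open>simp_all add: m1_def m2_def M_def fun_eq_iff\<close>)
  have s3: "wp (Ops (replicate (K + 4) (INC 1))) (K + 4) (\<lambda>m'. m' = m3) m'" if "m' = m2" for m'
    unfolding that
    by (rule wp_Ops)
      (simp_all add: jump_free_replicate fold_INC m2_def m3_def S_def fun_eq_iff del: fold_replicate replicate_Suc)
  let ?rs = "[3..<Suc K]"
  have lrs: "length ?rs = K - 2" "\<And>i. i < K - 2 \<Longrightarrow> ?rs ! i = 3 + i"
    by (simp_all del: upt_Suc)
  define m4 where "m4 = (\<lambda>x. if x = 1 then S + K + 1
    else if S + 3 \<le> x \<and> x < S + K + 1 then M (x - S) else m3 x)"
  have f4: "fold eff (concat (map (\<lambda>r. [STOREI 1 r, INC 1]) ?rs)) m3 = m4"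
  proof -
    have m31: "m3 1 = S + 3" and m31': "m3 (Suc 0) = S + 3" by (simp_all add: m3_def)
    have "fold eff (concat (map (\<lambda>r. [STOREI 1 r, INC 1]) ?rs)) m3 =
      (\<lambda>x. if x = 1 then m3 1 + length ?rs
         else if m3 1 \<le> x \<and> x < m3 1 + length ?rs then m3 (?rs ! (x - m3 1)) else m3 x)"
      by (rule fold_store) (auto simp: m31' S_def simp del: upt_Suc)
    also have "\<dots> = m4"
    proof
      fix x
      have "m3 (?rs ! (x - (S + 3))) = M (x - S)" if "S + 3 \<le> x" "x < S + K + 1"
      proof -
        have "?rs ! (x - (S + 3)) = x - S" using lrs(2)[of "x - (S + 3)"] that by simp
        moreover have "m3 y = M y" if "3 \<le> y" for y using that by (simp add: m3_def)
        ultimately show ?thesis using that by (simp del: upt_Suc)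
      qed
      then show "(if x = 1 then m3 1 + length ?rs
         else if m3 1 \<le> x \<and> x < m3 1 + length ?rs then m3 (?rs ! (x - m3 1)) else m3 x) = m4 x"
        unfolding m31 lrs(1) using K by (simp add: m4_def)
    qed
    finally show ?thesis .
  qed
  have s4: "wp (Ops (concat (map (\<lambda>r. [STOREI 1 r, INC 1]) ?rs))) (2 * K) (\<lambda>m'. m' = m4) m'" if "m' = m3" for m'
    unfolding that
  proof (rule wp_Ops)
    show "list_all jump_free (concat (map (\<lambda>r. [STOREI 1 r, INC 1]) ?rs))" by (simp add: list_all_iff del: upt_Suc)
    have "length (concat (map (\<lambda>r. [STOREI 1 r, INC 1]) rs)) = 2 * length rs" for rs :: "nat list"
      by (induction rs) auto
    then show "length (concat (map (\<lambda>r. [STOREI 1 r, INC 1]) ?rs)) \<le> 2 * K" using lrs(1) by simp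
  qed (simp only: f4)
  define m5 where "m5 = m4(20 := N, 5 := K + 1, 6 := S + K + 1, 7 := N)"
  have f5: "fold eff ([CPY 20 1] @ replicate (2 * K + 2) (DEC 20) @ [CLR 5] @ replicate (K + 1) (INC 5) @ [CPY 6 1, CPY 7 20]) m4 = m5"
  proof -
    have "m4 1 = S + K + 1" by (simp add: m4_def)
    then show ?thesis
      by (simp add: fold_DEC fold_INC m5_def S_def fun_eq_iff del: fold_replicate replicate_Suc replicate.simps)
  qed
  have s5: "wp (Ops ([CPY 20 1] @ replicate (2 * K + 2) (DEC 20) @ [CLR 5] @ replicate (K + 1) (INC 5) @ [CPY 6 1, CPY 7 20]))
      (3 * K + 7) (\<lambda>m'. m' = m5) m'" if "m' = m4" for m'
    unfolding that
  proof (rule wp_Ops)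
    show "list_all jump_free ([CPY 20 1] @ replicate (2 * K + 2) (DEC 20) @ [CLR 5] @ replicate (K + 1) (INC 5) @ [CPY 6 1, CPY 7 20])"
      unfolding list_all_append by (simp add: jump_free_replicate del: replicate_Suc)
  qed (simp_all only: f5, simp_all)
  have big: "m4 x = M x" if "K < x" "x < S + 3" for x
    using that K by (simp add: m4_def m3_def)
  have s6: "wp MEMCPY (8 * N + 1) (\<lambda>m'. m' 2 = 0 \<and> m' 20 = N \<and> m' 6 = S + K + 1 + N \<and>
    (\<forall>r. 3 \<le> r \<and> r \<le> K + N \<longrightarrow> m' (S + r) = M r) \<and> (\<forall>x\<ge>S + K + 1 + N. m' x = 0)) m'" if "m' = m5" for m'
    unfolding that
  proof (rule wp_conseq[OF wp_MEMCPY[where s = "K + 1" and d = "S + K + 1" and n = N]])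
    fix m' assume *: "agree ({3, 5, 6, 7} \<union> {S + K + 1..<S + K + 1 + N}) m5 m' \<and> m' 2 = 0 \<and>
      m' 6 = S + K + 1 + N \<and> (\<forall>i<N. m' (S + K + 1 + i) = m5 (K + 1 + i))"
    note ag = agreeD[OF conjunct1[OF *]]
    have "m' (S + r) = M r" if "3 \<le> r" "r \<le> K + N" for r
    proof (cases "r \<le> K")
      case True
      have "m' (S + r) = m5 (S + r)" by (rule ag) (use True K in \<open>simp add: S_def\<close>)
      also have "\<dots> = m4 (S + r)" using K by (simp add: m5_def S_def)
      also have "\<dots> = M r" using True that K by (simp add: m4_def S_def)
      finally show ?thesis .
    next
      case False
      then have "K + 1 \<le> r" by simp
      then obtain e where e: "r = K + 1 + e" using le_Suc_ex by blast
      then have "m' (S + K + 1 + e) = m5 (K + 1 + e)" using * that by simp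
      then have "m' (S + r) = m5 r" using e by (simp add: add.assoc)
      moreover have "m5 r = m4 r" using False K by (simp add: m5_def)
      moreover have "m4 r = M r" by (rule big) (use False that in \<open>simp_all add: S_def\<close>)
      ultimately show ?thesis by simp
    qed
    moreover have "m' x = 0" if "S + K + 1 + N \<le> x" for x
    proof -
      have "m' x = m5 x" by (rule ag) (use that K in \<open>simp add: S_def\<close>)
      also have "\<dots> = M x" using that K by (simp add: m5_def m4_def m3_def S_def)
      also have "\<dots> = 0" using that by (intro MN) (simp add: S_def)
      finally show ?thesis .
    qed
    moreover have "m' 20 = N"
    proof -
      have "m' 20 = m5 20" by (rule ag) (use K in \<open>simp add: S_def\<close>)
      then show ?thesis by (simp add: m5_def)
    qed
    ultimately show "m' 2 = 0 \<and> m' 20 = N \<and> m' 6 = S + K + 1 + N \<and>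
      (\<forall>r. 3 \<le> r \<and> r \<le> K + N \<longrightarrow> m' (S + r) = M r) \<and> (\<forall>x\<ge>S + K + 1 + N. m' x = 0)"
      using * by simp
  qed (use K in \<open>simp_all add: m5_def m4_def m3_def S_def\<close>)
  show ?thesis unfolding SAVE_def
    by (rule wp_SeqI[OF s1], rule wp_SeqI[OF s2], assumption, rule wp_SeqI[OF s3], assumption,
        rule wp_SeqI[OF s4], assumption, rule wp_SeqI[OF s5], assumption, erule s6, (rule le_refl)+) simp
qed

definition prelude_time :: "nat \<Rightarrow> nat \<Rightarrow> nat" where
  "prelude_time K N = 23 * N + 8 * K + 60 + 2 * (N * (5 * N + 12) + 4)"

lemma wp_PRELUDE:
  assumes perm: "is_perm \<sigma>" "is_perm \<tau>" and a: "1 \<le> length \<sigma>" and K: "80 + 2 * D \<le> K" and D: "1 \<le> D"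
  defines "N \<equiv> length \<sigma> + length \<tau> + 2"
  defines "IS \<equiv> 2 * N + 2 * K + 2"
  shows "wp (PRELUDE K) (prelude_time K N) (init.ready \<sigma> \<tau> N (IS + N + N) IS (IS + N)) (snd (init_config \<sigma> \<tau>))"
proof -
  interpret init \<sigma> \<tau> N "IS + N + N" D IS "IS + N"
    by unfold_locales (use perm D K in \<open>simp_all add: N_def IS_def\<close>)
  define S where "S = N + K + 1"
  define M where "M = (snd (init_config \<sigma> \<tau>))(2 + length \<sigma> := 0)"
  have K80: "80 \<le> K" using K by simp
  have S: "S + K + 1 + N = IS" by (simp add: S_def IS_def)
  have M1: "M (3 + k) = \<sigma> ! Suc k" if "k < length \<sigma> - 1" for k
  proof -
    have "Suc k < length \<sigma>" using that by simp
    then show ?thesis by (simp add: M_def init_config_def)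
  qed
  have M2: "M (2 + length \<sigma>) = 0" by (simp add: M_def)
  have M3: "M (3 + length \<sigma> + k) = \<tau> ! Suc k" if "k < length \<tau> - 1" for k
  proof -
    have "Suc k < length \<tau>" using that by simp
    then show ?thesis by (simp add: M_def init_config_def)
  qed
  have M4: "M x = 0" if "N \<le> x" for x using that by (simp add: M_def init_config_def N_def)
  define P where "P = (\<lambda>m'. m' 2 = 0 \<and> m' 20 = N \<and> (\<forall>r. 3 \<le> r \<and> r \<le> K + N \<longrightarrow> m' (S + r) = M r))"
  have PD: "m' 2 = 0" "m' 20 = N" if "P m'" for m'
    using that by (simp_all add: P_def)
  have P_agree: "P m'" if "P m" "agree X m m'" "X \<subseteq> {3..<20} \<union> {21..<80} \<union> {IS..}" for m m' X
  proof -
    have "m' x = m x" if "x = 2 \<or> x = 20 \<or> 80 \<le> x \<and> x < IS" for x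
    proof -
      have "x \<notin> {3..<20} \<union> {21..<80} \<union> {IS..}" using that K80 by (auto simp: IS_def)
      then show ?thesis using agreeD[OF \<open>agree X m m'\<close>, of x] \<open>X \<subseteq> _\<close> by blast
    qed
    moreover have "80 \<le> S + r \<and> S + r < IS" if "r \<le> K + N" for r
      using that K80 by (simp add: S_def IS_def)
    ultimately show ?thesis using \<open>P m\<close> by (simp add: P_def)
  qed
  have ISbig: "80 \<le> IS" using K80 by (simp add: IS_def)
  have s1: "wp (SAVE K) (13 * N + 7 * K + 30) (\<lambda>m'. P m' \<and> m' 6 = IS \<and> (\<forall>x\<ge>IS. m' x = 0)) (snd (init_config \<sigma> \<tau>))"
    using wp_SAVE[OF a K80 N_def[THEN meta_eq_to_obj_eq], folded S_def M_def]
    unfolding S by (rule wp_conseq) (simp_all add: P_def)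
  have s2: "wp (Ops [CPY 25 6, CPY 26 6]) 2 (\<lambda>m'. P m' \<and> m' 25 = IS \<and> m' 26 = IS \<and> (\<forall>x\<ge>IS. m' x = 0)) m"
    if m: "P m \<and> m 6 = IS \<and> (\<forall>x\<ge>IS. m x = 0)" for m
  proof (rule wp_Ops)
    have "agree {25, 26} m (fold eff [CPY 25 6, CPY 26 6] m)" by (simp add: agree_def)
    from P_agree[OF conjunct1[OF m] this] have "P (fold eff [CPY 25 6, CPY 26 6] m)" by simp
    then show "P (fold eff [CPY 25 6, CPY 26 6] m) \<and> fold eff [CPY 25 6, CPY 26 6] m 25 = IS \<and>
      fold eff [CPY 25 6, CPY 26 6] m 26 = IS \<and> (\<forall>x\<ge>IS. fold eff [CPY 25 6, CPY 26 6] m x = 0)"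
      using m ISbig by auto
  qed simp_all
  have s3: "wp (ADD 26 20) (5 * N + 2) (\<lambda>m'. P m' \<and> m' 25 = IS \<and> m' 26 = IS + N \<and> (\<forall>x\<ge>IS. m' x = 0)) m"
    if m: "P m \<and> m 25 = IS \<and> m 26 = IS \<and> (\<forall>x\<ge>IS. m x = 0)" for m
  proof (rule wp_conseq[OF wp_ADD[where T = "5 * N + 2"]])
    fix m' assume m': "m' = m(3 := 0, 26 := m 26 + m 20)"
    have "agree {3, 26} m m'" by (simp add: agree_def m')
    from P_agree[OF conjunct1[OF m] this] have "P m'" by simp
    then show "P m' \<and> m' 25 = IS \<and> m' 26 = IS + N \<and> (\<forall>x\<ge>IS. m' x = 0)"
      using m ISbig PD(2)[OF conjunct1[OF m]] by (auto simp: m')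
  qed (use PD[OF conjunct1[OF m]] in simp_all)
  have s4: "wp (Ops (CPY 42 20 # replicate (K + 4) (INC 42))) (K + 5)
      (\<lambda>m'. P m' \<and> m' 25 = IS \<and> m' 26 = IS + N \<and> (\<forall>x\<ge>IS. m' x = 0) \<and> m' 42 = S + 3) m"
    if m: "P m \<and> m 25 = IS \<and> m 26 = IS + N \<and> (\<forall>x\<ge>IS. m x = 0)" for m
  proof (rule wp_Ops)
    have f: "fold eff (CPY 42 20 # replicate (K + 4) (INC 42)) m = m(42 := S + 3)"
      using PD(2)[OF conjunct1[OF m]] by (simp add: fold_INC S_def fun_eq_iff del: fold_replicate replicate_Suc)
    have "agree {42} m (m(42 := S + 3))" by (simp add: agree_def)
    from P_agree[OF conjunct1[OF m] this] have "P (m(42 := S + 3))" by simp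
    then show "P (fold eff (CPY 42 20 # replicate (K + 4) (INC 42)) m) \<and>
      fold eff (CPY 42 20 # replicate (K + 4) (INC 42)) m 25 = IS \<and>
      fold eff (CPY 42 20 # replicate (K + 4) (INC 42)) m 26 = IS + N \<and>
      (\<forall>x\<ge>IS. fold eff (CPY 42 20 # replicate (K + 4) (INC 42)) m x = 0) \<and>
      fold eff (CPY 42 20 # replicate (K + 4) (INC 42)) m 42 = S + 3"
      unfolding f using m ISbig by auto
  qed (simp_all add: jump_free_replicate del: replicate_Suc)
  define n where "n = length \<sigma> - 1"
  have s5: "wp (SCAN 25) (N * (5 * N + 12) + 4) (\<lambda>m'. P m' \<and> m' 25 = IS \<and> m' 26 = IS + N \<and>
      (\<forall>x\<ge>IS + N. m' x = 0) \<and> m' 42 = S + 3 + n \<and> m' 43 = length \<sigma> \<and> (\<forall>i<length \<sigma>. m' (IS + \<sigma> ! i) = i)) m"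
    if m: "P m \<and> m 25 = IS \<and> m 26 = IS + N \<and> (\<forall>x\<ge>IS. m x = 0) \<and> m 42 = S + 3" for m
  proof (rule wp_conseq[OF wp_SCAN[where xs = \<sigma> and N = N and n = n and p = "S + 3" and A = IS]])
    have Mr: "m (S + r) = M r" if "3 \<le> r" "r \<le> K + N" for r using m that by (simp add: P_def)
    show "m (S + 3 + k) = \<sigma> ! Suc k" if "k < n" for k
      using Mr[of "3 + k"] M1[of k] that by (simp add: n_def N_def add.assoc)
    have e: "3 + n = 2 + length \<sigma>" using a by (simp add: n_def)
    have "m (S + (2 + length \<sigma>)) = M (2 + length \<sigma>)"
      by (rule Mr) (use a in \<open>simp_all add: N_def\<close>)
    then show "m (S + 3 + n) = 0" unfolding add.assoc e M2 .
    fix m' assume *: "agree ({3, 6, 42, 43, 44} \<union> {IS..<IS + N}) m m' \<and>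
      m' 2 = 0 \<and> m' 43 = Suc n \<and> m' 42 = S + 3 + n \<and> (\<forall>i<length \<sigma>. m' (IS + \<sigma> ! i) = i)"
    have "P m'" by (rule P_agree[OF conjunct1[OF m] conjunct1[OF *]]) auto
    moreover have "m' x = m x" if "x = 25 \<or> x = 26 \<or> IS + N \<le> x" for x
      by (rule agreeD[OF conjunct1[OF *]]) (use that ISbig in auto)
    moreover have "Suc n = length \<sigma>" using a by (simp add: n_def)
    ultimately show "P m' \<and> m' 25 = IS \<and> m' 26 = IS + N \<and>
      (\<forall>x\<ge>IS + N. m' x = 0) \<and> m' 42 = S + 3 + n \<and> m' 43 = length \<sigma> \<and> (\<forall>i<length \<sigma>. m' (IS + \<sigma> ! i) = i)"
      using * m by simp
  next
    show "m (IS + v) = 0" if "v < N" for v using m by simp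
    show "m 42 = S + 3" "m 25 = IS" using m by blast+
    show "m 2 = 0" using PD(1)[OF conjunct1[OF m]] .
    show "S + 3 + n < IS" using K80 by (simp add: n_def S_def IS_def N_def)
    show "60 \<le> S + 3" using K80 by (simp add: S_def)
  qed (use perm in \<open>simp_all add: n_def N_def\<close>)
  define Q where "Q = (\<lambda>m'. P m' \<and> m' 25 = IS \<and> m' 26 = IS + N \<and> m' 27 = length \<sigma> \<and>
    (\<forall>i<length \<sigma>. m' (IS + \<sigma> ! i) = i))"
  have Q_agree: "Q m'" if "Q m" "agree X m m'" "X \<subseteq> {3..<20} \<union> {28..<80} \<union> {IS + N..}" for m m' X
  proof -
    have "P m'" by (rule P_agree[OF _ that(2)]) (use that in \<open>auto simp: Q_def\<close>)
    moreover have "m' x = m x" if "x = 25 \<or> x = 26 \<or> x = 27 \<or> IS \<le> x \<and> x < IS + N" for x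
    proof -
      have "x \<notin> {3..<20} \<union> {28..<80} \<union> {IS + N..}" using that K80 by (auto simp: IS_def)
      then show ?thesis using agreeD[OF \<open>agree X m m'\<close>, of x] \<open>X \<subseteq> _\<close> by blast
    qed
    moreover have "IS + \<sigma> ! i < IS + N" if "i < length \<sigma>" for i
      using nth_mem[OF that] perm(1) by (auto simp: is_perm_def N_def)
    ultimately show ?thesis using \<open>Q m\<close> by (simp add: Q_def)
  qed
  have s6: "wp (Ops [CPY 27 43, INC 42]) 2 (\<lambda>m'. Q m' \<and> (\<forall>x\<ge>IS + N. m' x = 0) \<and> m' 42 = S + 3 + length \<sigma>) m"
    if m: "P m \<and> m 25 = IS \<and> m 26 = IS + N \<and>
      (\<forall>x\<ge>IS + N. m x = 0) \<and> m 42 = S + 3 + n \<and> m 43 = length \<sigma> \<and> (\<forall>i<length \<sigma>. m (IS + \<sigma> ! i) = i)" for m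
  proof (rule wp_Ops)
    define m' where "m' = fold eff [CPY 27 43, INC 42] m"
    have e: "length \<sigma> = Suc n" using a by (simp add: n_def)
    have m'_eq: "m' = m(27 := length \<sigma>, 42 := S + 3 + length \<sigma>)" using m by (simp add: m'_def e)
    have "agree {27, 42} m m'" by (simp add: agree_def m'_eq)
    from P_agree[OF conjunct1[OF m] this] have "P m'" by simp
    moreover have "m' x = m x" if "80 \<le> x" for x using that by (simp add: m'_eq)
    moreover note ISbig
    ultimately show "Q (fold eff [CPY 27 43, INC 42] m) \<and> (\<forall>x\<ge>IS + N. fold eff [CPY 27 43, INC 42] m x = 0) \<and>
      fold eff [CPY 27 43, INC 42] m 42 = S + 3 + length \<sigma>"
      unfolding m'_def[symmetric] using m by (simp add: Q_def) (simp add: m'_eq)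
  qed simp_all
  define n' where "n' = length \<tau> - 1"
  have s7: "wp (SCAN 26) (N * (5 * N + 12) + 4) (\<lambda>m'. Q m' \<and>
      (\<forall>x\<ge>IS + N + N. m' x = 0) \<and> (\<forall>j<length \<tau>. m' (IS + N + \<tau> ! j) = j)) m"
    if m: "Q m \<and> (\<forall>x\<ge>IS + N. m x = 0) \<and> m 42 = S + 3 + length \<sigma>" for m
  proof (rule wp_conseq[OF wp_SCAN[where xs = \<tau> and N = N and n = n' and p = "S + 3 + length \<sigma>" and A = "IS + N"]])
    have Mr: "m (S + r) = M r" if "3 \<le> r" "r \<le> K + N" for r using m that by (simp add: P_def Q_def)
    show "m (S + 3 + length \<sigma> + k) = \<tau> ! Suc k" if "k < n'" for k
      using Mr[of "3 + length \<sigma> + k"] M3[of k] that by (simp add: n'_def N_def add.assoc)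
    have "N \<le> 3 + length \<sigma> + n'" by (simp add: n'_def N_def)
    moreover have "3 + length \<sigma> + n' \<le> K + N" using K80 by (simp add: n'_def N_def)
    ultimately show "m (S + 3 + length \<sigma> + n') = 0"
      using Mr[of "3 + length \<sigma> + n'"] M4[of "3 + length \<sigma> + n'"] by (simp add: add.assoc)
    fix m' assume *: "agree ({3, 6, 42, 43, 44} \<union> {IS + N..<IS + N + N}) m m' \<and>
      m' 2 = 0 \<and> m' 43 = Suc n' \<and> m' 42 = S + 3 + length \<sigma> + n' \<and> (\<forall>i<length \<tau>. m' (IS + N + \<tau> ! i) = i)"
    have "Q m'" by (rule Q_agree[OF conjunct1[OF m] conjunct1[OF *]]) auto
    moreover have "m' x = m x" if "IS + N + N \<le> x" for x
      by (rule agreeD[OF conjunct1[OF *]]) (use that ISbig in auto)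
    ultimately show "Q m' \<and> (\<forall>x\<ge>IS + N + N. m' x = 0) \<and> (\<forall>j<length \<tau>. m' (IS + N + \<tau> ! j) = j)"
      using * m by simp
  next
    show "m (IS + N + v) = 0" if "v < N" for v using m by simp
    show "m 42 = S + 3 + length \<sigma>" "m 26 = IS + N" using m unfolding Q_def by blast+
    show "m 2 = 0" using PD(1)[of m] m by (simp add: Q_def)
    show "S + 3 + length \<sigma> + n' < IS + N" using K80 by (simp add: n'_def S_def IS_def N_def)
    show "60 \<le> S + 3 + length \<sigma>" using K80 by (simp add: S_def)
  qed (use perm in \<open>simp_all add: n'_def N_def\<close>)
  have s8: "wp (Ops [CPY 28 20, DEC 28, DEC 28]) 3 (\<lambda>m'. Q m' \<and> m' 28 = length \<sigma> + length \<tau> \<and>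
      (\<forall>x\<ge>IS + N + N. m' x = 0) \<and> (\<forall>j<length \<tau>. m' (IS + N + \<tau> ! j) = j)) m"
    if m: "Q m \<and> (\<forall>x\<ge>IS + N + N. m x = 0) \<and> (\<forall>j<length \<tau>. m (IS + N + \<tau> ! j) = j)" for m
  proof (rule wp_Ops)
    define m' where "m' = fold eff [CPY 28 20, DEC 28, DEC 28] m"
    have "m 20 = N" using m by (simp add: Q_def PD(2))
    then have m'_eq: "m' = m(28 := length \<sigma> + length \<tau>)" by (simp add: m'_def N_def fun_eq_iff)
    have "agree {28} m m'" by (simp add: agree_def m'_eq)
    from Q_agree[OF conjunct1[OF m] this] have "Q m'" by simp
    moreover have "m' x = m x" if "80 \<le> x" for x using that by (simp add: m'_eq)
    moreover note ISbig
    moreover have "m' 28 = length \<sigma> + length \<tau>" by (simp add: m'_eq)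
    ultimately show "Q (fold eff [CPY 28 20, DEC 28, DEC 28] m) \<and>
      fold eff [CPY 28 20, DEC 28, DEC 28] m 28 = length \<sigma> + length \<tau> \<and>
      (\<forall>x\<ge>IS + N + N. fold eff [CPY 28 20, DEC 28, DEC 28] m x = 0) \<and>
      (\<forall>j<length \<tau>. fold eff [CPY 28 20, DEC 28, DEC 28] m (IS + N + \<tau> ! j) = j)"
      unfolding m'_def[symmetric] using m by simp
  qed simp_all
  have s9: "wp (SUB 28 27) (5 * N + 2) ready m"
    if m: "Q m \<and> m 28 = length \<sigma> + length \<tau> \<and>
      (\<forall>x\<ge>IS + N + N. m x = 0) \<and> (\<forall>j<length \<tau>. m (IS + N + \<tau> ! j) = j)" for m
  proof (rule wp_conseq[OF wp_SUB[where T = "5 * N + 2"]])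
    fix m' assume m': "m' = m(3 := 0, 28 := m 28 - m 27)"
    have "agree {3, 28} m m'" by (simp add: agree_def m')
    from Q_agree[OF conjunct1[OF m] this] have "Q m'" by simp
    moreover have "m' x = m x" if "80 \<le> x" for x using that by (simp add: m')
    moreover note ISbig
    moreover have "m' 28 = length \<tau>" using m by (simp add: m' Q_def)
    ultimately show "ready m'" using m PD[of m'] by (simp add: ready_def Q_def)
  next
    show "m 2 = 0" using m by (simp add: Q_def PD(1))
    show "5 * m 27 + 2 \<le> 5 * N + 2" using m by (simp add: Q_def N_def)
  qed simp_all
  show ?thesis unfolding PRELUDE_def
    by (rule wp_SeqI[OF s1], rule wp_SeqI[OF s2], assumption, rule wp_SeqI[OF s3], assumption,
        rule wp_SeqI[OF s4], assumption, rule wp_SeqI[OF s5], assumption, rule wp_SeqI[OF s6], assumption,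
        rule wp_SeqI[OF s7], assumption, rule wp_SeqI[OF s8], assumption, erule s9, (rule le_refl)+)
      (simp add: prelude_time_def)
qed

section \<open>The output\<close>

definition RANKS :: com where
  "RANKS = Ops (CPY 50 24 # FLD 45 21 8 @ [STOREI 50 45, INC 50, CPY 46 21] @ replicate 9 (INC 46) @ [CPY 47 45]) ;;
     While 45 (Ops ([DEC 45, LOADI 48 46, CLR 49, CPY 51 47, CPY 52 21] @ replicate 9 (INC 52)) ;;
       While 51 (Ops [DEC 51, LOADI 53 52, INC 49] ;; SUB 53 48 ;; IfNZ 53 (Ops [DEC 49]) ;; Ops [INC 52]) ;;
       Ops [STOREI 50 49, INC 50, INC 46])"

definition OUTPUT :: "nat \<Rightarrow> com" where
  "OUTPUT K = RANKS ;;
     Ops ([CPY 5 24] @ replicate (K + 1) (INC 5) @ [CLR 6] @ replicate (K + 1) (INC 6) @ [CPY 7 47]) ;; MEMCPY ;;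
     Ops ([CPY 0 24] @ replicate K (INC 0) @ concat (map (\<lambda>r. [LOADI r 0, DEC 0]) (rev [1..<Suc K])) @ [LOADI 0 0])"

lemma wp_RANKS:
  assumes m: "m 2 = 0" "m 21 = B" "m 24 = buf" and B: "60 \<le> B" "B + 9 + length xs \<le> buf"
    and xs: "rlist m B = xs" "length xs \<le> N" "\<forall>x\<in>set xs. x \<le> N"
  shows "wp RANKS (N * (N * (5 * N + 15) + 30) + 40) (\<lambda>m'. m' 2 = 0 \<and> m' 24 = buf \<and> m' 47 = length xs \<and>
    m' buf = length xs \<and> (\<forall>i<length xs. m' (buf + 1 + i) = ranks xs ! i)) m"
proof -
  define k where "k = length xs"
  have k: "m (B + 8) = k" using xs(1) length_rlist[of m B] by (simp add: k_def)
  have mx: "m (B + 9 + i) = xs ! i" if "i < k" for i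
  proof -
    have "rlist m B ! i = m (B + 9 + i)" using that k by (simp add: rlist_def)
    then show ?thesis using xs(1) by simp
  qed
  have kb: "B + 9 + k \<le> buf" "k \<le> N" using B xs by (simp_all add: k_def)
  let ?rank = "\<lambda>j x. length (filter (\<lambda>y. y \<le> x) (take j xs))"
  have rk: "ranks xs ! i = ?rank k (xs ! i)" if "i < k" for i
    using that by (simp add: ranks_def k_def)
  define G where "G = (\<lambda>m'. m' 2 = 0 \<and> m' 21 = B \<and> m' 24 = buf \<and> m' 47 = k \<and> m' buf = k \<and>
    (\<forall>i<k. m' (B + 9 + i) = xs ! i))"
  have G_agree: "G m'" if "G m1" "agree X m1 m'" "X \<subseteq> {3, 45, 46, 48, 49, 50, 51, 52, 53} \<union> {buf<..}" for m1 m' X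
  proof -
    have *: "m' x = m1 x" if "x \<in> {2, 21, 24, 47} \<or> 60 \<le> x \<and> x \<le> buf" for x
      by (rule agreeD[OF \<open>agree X m1 m'\<close>]) (use that \<open>X \<subseteq> _\<close> B in auto)
    have "m' 2 = m1 2" "m' 21 = m1 21" "m' 24 = m1 24" "m' 47 = m1 47" "m' buf = m1 buf"
      using B by (auto intro!: *)
    moreover have "m' (B + 9 + i) = m1 (B + 9 + i)" if "i < k" for i
      using B kb that by (intro *) simp
    ultimately show ?thesis using \<open>G m1\<close> by (simp add: G_def)
  qed
  define I where "I = (\<lambda>j m'. G m' \<and> m' 45 = k - j \<and> m' 46 = B + 9 + j \<and> m' 50 = buf + 1 + j \<and>
    (\<forall>i<j. m' (buf + 1 + i) = ranks xs ! i))"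
  have s1: "wp (Ops (CPY 50 24 # FLD 45 21 8 @ [STOREI 50 45, INC 50, CPY 46 21] @ replicate 9 (INC 46) @ [CPY 47 45]))
      24 (I 0) m"
  proof (rule wp_Ops)
    have f: "fold eff (CPY 50 24 # FLD 45 21 8 @ [STOREI 50 45, INC 50, CPY 46 21] @ replicate 9 (INC 46) @ [CPY 47 45]) m =
      m(50 := buf, 45 := k, buf := k, 50 := Suc buf, 46 := B + 9, 47 := k)"
      using m B k by (simp add: fold_FLD fold_INC fun_eq_iff del: fold_replicate)
    have "G (m(50 := buf, 45 := k, buf := k, 50 := Suc buf, 46 := B + 9, 47 := k))"
      using m B kb mx by (simp add: G_def)
    then show "I 0 (fold eff (CPY 50 24 # FLD 45 21 8 @ [STOREI 50 45, INC 50, CPY 46 21] @ replicate 9 (INC 46) @ [CPY 47 45]) m)"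
      unfolding f using B by (simp add: I_def)
  qed (simp_all add: jump_free_FLD length_FLD jump_free_replicate)
  have step: "wp (Ops ([DEC 45, LOADI 48 46, CLR 49, CPY 51 47, CPY 52 21] @ replicate 9 (INC 52)) ;;
       While 51 (Ops [DEC 51, LOADI 53 52, INC 49] ;; SUB 53 48 ;; IfNZ 53 (Ops [DEC 49]) ;; Ops [INC 52]) ;;
       Ops [STOREI 50 49, INC 50, INC 46]) (N * (5 * N + 15) + 20) (\<lambda>m'. I (Suc j) (m'(2 := 0))) m1"
    if j: "j < k" and I: "I j m1" for j m1
  proof -
    define x where "x = xs ! j"
    have xN: "x \<le> N" using xs(3) j by (simp add: x_def k_def)
    define H where "H = (\<lambda>m'. G m' \<and> m' 45 = k - Suc j \<and> m' 46 = B + 9 + j \<and> m' 50 = buf + 1 + j \<and> m' 48 = x \<and>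
      (\<forall>i<j. m' (buf + 1 + i) = ranks xs ! i))"
    have H_agree: "H m'" if "H m2" "agree X m2 m'" "X \<subseteq> {3, 49, 51, 52, 53}" for m2 m' X
    proof -
      have "G m'" by (rule G_agree[OF _ that(2)]) (use that in \<open>auto simp: H_def\<close>)
      moreover have *: "m' y = m2 y" if "y \<in> {45, 46, 50, 48} \<or> buf < y" for y
        by (rule agreeD[OF \<open>agree X m2 m'\<close>]) (use that \<open>X \<subseteq> _\<close> B in auto)
      moreover have "m' (buf + 1 + i) = m2 (buf + 1 + i)" for i by (rule *) simp
      ultimately show ?thesis using \<open>H m2\<close> by (simp add: H_def)
    qed
    define L where "L = (\<lambda>i m'. H m' \<and> m' 51 = k - i \<and> m' 52 = B + 9 + i \<and> m' 49 = ?rank i x)"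
    have GI: "G m1" "m1 45 = k - j" "m1 46 = B + 9 + j" "m1 50 = buf + 1 + j"
      "\<forall>i<j. m1 (buf + 1 + i) = ranks xs ! i" using I by (simp_all add: I_def)
    have u1: "wp (Ops ([DEC 45, LOADI 48 46, CLR 49, CPY 51 47, CPY 52 21] @ replicate 9 (INC 52))) 14 (L 0) m1"
    proof (rule wp_Ops)
      define m2 where "m2 = m1(45 := k - Suc j, 48 := x, 49 := 0, 51 := k, 52 := B + 9)"
      have f: "fold eff ([DEC 45, LOADI 48 46, CLR 49, CPY 51 47, CPY 52 21] @ replicate 9 (INC 52)) m1 = m2"
        using GI(1-4) B j by (simp add: G_def m2_def x_def fold_INC fun_eq_iff del: fold_replicate)
      have "agree {45, 48, 49, 51, 52} m1 m2" by (simp add: agree_def m2_def)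
      from G_agree[OF GI(1) this] have "G m2" by simp
      moreover have "m2 y = m1 y" if "buf < y" for y using that B by (simp add: m2_def)
      moreover have "m2 45 = k - Suc j" "m2 46 = B + 9 + j" "m2 50 = buf + 1 + j" "m2 48 = x" "m2 51 = k"
        "m2 52 = B + 9" "m2 49 = 0" using GI by (simp_all add: m2_def)
      ultimately show "L 0 (fold eff ([DEC 45, LOADI 48 46, CLR 49, CPY 51 47, CPY 52 21] @ replicate 9 (INC 52)) m1)"
        unfolding f using GI(5) by (simp add: L_def H_def)
    qed (simp_all add: jump_free_replicate)
    have inner: "wp (Ops [DEC 51, LOADI 53 52, INC 49] ;; SUB 53 48 ;; IfNZ 53 (Ops [DEC 49]) ;; Ops [INC 52])
        (5 * N + 8) (\<lambda>m'. L (Suc i) (m'(2 := 0))) m2" if i: "i < k" and L: "L i m2" for i m2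
    proof -
      define y where "y = xs ! i"
      define r where "r = ?rank i x"
      have h: "H m2" "m2 51 = k - i" "m2 52 = B + 9 + i" "m2 49 = r" using L by (simp_all add: L_def r_def)
      then have g: "G m2" "m2 48 = x" by (simp_all add: H_def)
      then have z: "m2 2 = 0" "m2 (B + 9 + i) = y" using i by (simp_all add: G_def y_def)
      define m3 where "m3 = m2(51 := k - Suc i, 53 := y, 49 := Suc r)"
      define m4 where "m4 = m2(51 := k - Suc i, 49 := Suc r, 3 := 0, 53 := y - x)"
      define r' where "r' = (if y \<le> x then Suc r else r)"
      define m5 where "m5 = m2(51 := k - Suc i, 49 := r', 3 := 0, 53 := y - x)"
      define m6 where "m6 = m2(51 := k - Suc i, 49 := r', 3 := 0, 53 := y - x, 52 := B + 9 + Suc i)"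
      have v1: "wp (Ops [DEC 51, LOADI 53 52, INC 49]) 3 (\<lambda>m'. m' = m3) m2"
        by (rule wp_Ops) (use h z B in \<open>simp_all add: m3_def fun_eq_iff\<close>)
      have v2: "wp (SUB 53 48) (5 * N + 2) (\<lambda>m'. m' = m4) m'" if "m' = m3" for m'
        unfolding that
        by (rule wp_conseq[OF wp_SUB[where T = "5 * N + 2"]])
          (use z g xN in \<open>simp_all add: m3_def m4_def fun_eq_iff\<close>)
      have v3: "wp (IfNZ 53 (Ops [DEC 49])) (Suc 1) (\<lambda>m'. m' = m5) m'" if "m' = m4" for m'
        unfolding that
        by (intro wp_IfNZ wp_Ops) (simp_all add: m4_def m5_def r'_def fun_eq_iff)
      have v4: "wp (Ops [INC 52]) 1 (\<lambda>m'. L (Suc i) (m'(2 := 0))) m'" if "m' = m5" for m'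
        unfolding that
      proof (rule wp_Ops)
        have f: "fold eff [INC 52] m5 = m6" using h by (simp add: m5_def m6_def fun_eq_iff)
        have "agree {3, 49, 51, 52, 53} m2 m6" by (simp add: agree_def m6_def)
        from H_agree[OF h(1) this] have "H m6" by simp
        moreover have "?rank (Suc i) x = r'"
          using i by (simp add: take_Suc_conv_app_nth k_def r_def r'_def y_def)
        ultimately have "L (Suc i) m6" by (simp add: L_def m6_def)
        moreover have "m6(2 := 0) = m6" using z by (simp add: m6_def fun_eq_iff)
        ultimately show "L (Suc i) ((fold eff [INC 52] m5)(2 := 0))" unfolding f by simp
      qed simp_all
      show ?thesis by (rule wp_SeqI[OF v1], rule wp_SeqI[OF v2], assumption, rule wp_SeqI[OF v3], assumption,
          erule v4, (rule le_refl)+) simp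
    qed
    have guard: "m2 51 = 0 \<longleftrightarrow> i = k" if "i \<le> k" "L i m2" for i m2
      using that by (auto simp: L_def)
    have u2: "wp (While 51 (Ops [DEC 51, LOADI 53 52, INC 49] ;; SUB 53 48 ;; IfNZ 53 (Ops [DEC 49]) ;; Ops [INC 52]))
        (k * (5 * N + 8 + 3) + 1) (L k) m2" if "L 0 m2" for m2
      by (rule wp_While[where I = L]) (use that inner guard in auto)
    have u3: "wp (Ops [STOREI 50 49, INC 50, INC 46]) 3 (\<lambda>m'. I (Suc j) (m'(2 := 0))) m2" if L: "L k m2" for m2
    proof (rule wp_Ops)
      have h: "G m2" "m2 45 = k - Suc j" "m2 46 = B + 9 + j" "m2 50 = buf + 1 + j" "m2 49 = ?rank k x"
        "\<forall>i<j. m2 (buf + 1 + i) = ranks xs ! i" using L by (simp_all add: L_def H_def)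
      define m3 where "m3 = m2(buf + 1 + j := ?rank k x, 50 := buf + 1 + Suc j, 46 := B + 9 + Suc j)"
      have f: "fold eff [STOREI 50 49, INC 50, INC 46] m2 = m3"
        using h B by (simp add: m3_def fun_eq_iff)
      have "agree ({46, 50} \<union> {buf<..}) m2 m3" by (simp add: agree_def m3_def)
      from G_agree[OF h(1) this] have g: "G m3" by auto
      moreover have "m3 (buf + 1 + i) = ranks xs ! i" if "i < Suc j" for i
        using h(6) that rk[of j] j B by (cases "i = j") (auto simp: m3_def x_def)
      moreover have "m3 45 = k - Suc j" "m3 46 = B + 9 + Suc j" "m3 50 = buf + 1 + Suc j"
        using h B by (simp_all add: m3_def)
      ultimately have "I (Suc j) m3" by (simp add: I_def)
      moreover have "m3(2 := 0) = m3" using g by (simp add: G_def fun_eq_iff)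
      ultimately show "I (Suc j) ((fold eff [STOREI 50 49, INC 50, INC 46] m2)(2 := 0))" unfolding f by simp
    qed simp_all
    show ?thesis
    proof (rule wp_SeqI[OF u1], rule wp_SeqI[OF u2], assumption, erule u3, rule le_refl)
      have "k * (5 * N + 8 + 3) \<le> N * (5 * N + 15)" using kb by (intro mult_le_mono) auto
      then show "14 + (k * (5 * N + 8 + 3) + 1 + 3) \<le> N * (5 * N + 15) + 20" by simp
    qed
  qed
  have guard: "m1 45 = 0 \<longleftrightarrow> j = k" if "j \<le> k" "I j m1" for j m1
    using that by (auto simp: I_def)
  have s2: "wp (While 45 (Ops ([DEC 45, LOADI 48 46, CLR 49, CPY 51 47, CPY 52 21] @ replicate 9 (INC 52)) ;;
       While 51 (Ops [DEC 51, LOADI 53 52, INC 49] ;; SUB 53 48 ;; IfNZ 53 (Ops [DEC 49]) ;; Ops [INC 52]) ;;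
       Ops [STOREI 50 49, INC 50, INC 46])) (k * (N * (5 * N + 15) + 20 + 3) + 1) (I k) m1" if "I 0 m1" for m1
    by (rule wp_While[where I = I]) (use that step guard in auto)
  have "wp RANKS (N * (N * (5 * N + 15) + 30) + 40) (I k) m" unfolding RANKS_def
  proof (rule wp_SeqI[OF s1], erule s2)
    have "k * (N * (5 * N + 15) + 20 + 3) \<le> N * (N * (5 * N + 15) + 30)" using kb by (intro mult_le_mono) auto
    then show "24 + (k * (N * (5 * N + 15) + 20 + 3) + 1) \<le> N * (N * (5 * N + 15) + 30) + 40" by simp
  qed
  then show ?thesis by (rule wp_conseq) (simp_all add: I_def G_def k_def)
qed

lemma fold_load:
  "k < w \<Longrightarrow> m 0 = w + k \<Longrightarrow>
    fold eff (concat (map (\<lambda>r. [LOADI r 0, DEC 0]) (rev [1..<Suc k]))) m =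
    (\<lambda>x. if x = 0 then w else if x \<le> k then m (w + x) else m x)"
proof (induction k arbitrary: m)
  case (Suc k)
  define m1 where "m1 = m(Suc k := m (w + Suc k), 0 := w + k)"
  have "fold eff (concat (map (\<lambda>r. [LOADI r 0, DEC 0]) (rev [1..<Suc (Suc k)]))) m =
    fold eff (concat (map (\<lambda>r. [LOADI r 0, DEC 0]) (rev [1..<Suc k]))) m1"
    using Suc.prems by (simp add: m1_def)
  also have "\<dots> = (\<lambda>x. if x = 0 then w else if x \<le> k then m1 (w + x) else m1 x)"
    by (rule Suc.IH) (use Suc.prems in \<open>simp_all add: m1_def\<close>)
  also have "\<dots> = (\<lambda>x. if x = 0 then w else if x \<le> Suc k then m (w + x) else m x)"
    using Suc.prems by (auto simp: m1_def fun_eq_iff le_Suc_eq)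
  finally show ?case .
qed (auto simp: fun_eq_iff)

definition output_time :: "nat \<Rightarrow> nat \<Rightarrow> nat" where
  "output_time K N = N * (N * (5 * N + 15) + 30) + 8 * N + 10 * K + 60"

lemma wp_OUTPUT:
  assumes m: "m 2 = 0" "m 21 = B" "m 24 = buf" and B: "B + 9 + length xs \<le> buf" "K + N < B"
    and xs: "rlist m B = xs" "length xs \<le> N" "\<forall>x\<in>set xs. x \<le> N" and K: "80 \<le> K"
  shows "wp (OUTPUT K) (output_time K N) (\<lambda>m'. map (\<lambda>i. m' (Suc i)) [0..<m' 0] = ranks xs) m"
proof -
  define k where "k = length xs"
  have s1: "wp RANKS (N * (N * (5 * N + 15) + 30) + 40) (\<lambda>m'. m' 2 = 0 \<and> m' 24 = buf \<and> m' 47 = k \<and>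
    m' buf = k \<and> (\<forall>i<k. m' (buf + 1 + i) = ranks xs ! i)) m"
    unfolding k_def by (rule wp_RANKS[OF m _ B(1) xs]) (use B K in simp)
  let ?c2 = "[CPY 5 24] @ replicate (K + 1) (INC 5) @ [CLR 6] @ replicate (K + 1) (INC 6) @ [CPY 7 47]"
  define P where "P = (\<lambda>m'. m' 2 = 0 \<and> m' 24 = buf \<and> m' buf = k \<and> (\<forall>i<k. m' (buf + 1 + i) = ranks xs ! i))"
  have big: "K + N < buf" "k \<le> N" using B xs by (simp_all add: k_def)
  have s2: "wp (Ops ?c2) (2 * K + 5) (\<lambda>m'. P m' \<and> m' 5 = buf + K + 1 \<and> m' 6 = K + 1 \<and> m' 7 = k) m1"
    if m1: "m1 2 = 0 \<and> m1 24 = buf \<and> m1 47 = k \<and> m1 buf = k \<and> (\<forall>i<k. m1 (buf + 1 + i) = ranks xs ! i)" for m1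
  proof (rule wp_Ops)
    have f: "fold eff ?c2 m1 = m1(5 := buf + K + 1, 6 := K + 1, 7 := k)"
      using m1 by (simp add: fold_INC fun_eq_iff del: fold_replicate replicate_Suc replicate.simps)
    show "P (fold eff ?c2 m1) \<and> fold eff ?c2 m1 5 = buf + K + 1 \<and> fold eff ?c2 m1 6 = K + 1 \<and> fold eff ?c2 m1 7 = k"
      unfolding f using m1 big K by (simp add: P_def)
  qed (simp_all add: jump_free_replicate del: replicate_Suc)
  have s3: "wp MEMCPY (8 * N + 1) (\<lambda>m'. m' 24 = buf \<and> m' buf = k \<and> (\<forall>i<k. m' (buf + 1 + i) = ranks xs ! i) \<and>
      (\<forall>i<k. K \<le> i \<longrightarrow> m' (Suc i) = ranks xs ! i)) m1"
    if m1: "P m1 \<and> m1 5 = buf + K + 1 \<and> m1 6 = K + 1 \<and> m1 7 = k" for m1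
  proof (rule wp_conseq[OF wp_MEMCPY[where s = "buf + K + 1" and d = "K + 1" and n = k]])
    fix m' assume *: "agree ({3, 5, 6, 7} \<union> {K + 1..<K + 1 + k}) m1 m' \<and> m' 2 = 0 \<and>
      m' 6 = K + 1 + k \<and> (\<forall>i<k. m' (K + 1 + i) = m1 (buf + K + 1 + i))"
    have keep: "m' x = m1 x" if "x = 24 \<or> buf \<le> x" for x
      by (rule agreeD[OF conjunct1[OF *]]) (use that big K in auto)
    have "m' (Suc i) = ranks xs ! i" if "i < k" "K \<le> i" for i
    proof -
      obtain e where e: "i = K + e" using le_Suc_ex[OF \<open>K \<le> i\<close>] ..
      then have "m' (K + 1 + e) = m1 (buf + K + 1 + e)" using * that by simp
      then have "m' (Suc i) = m1 (buf + 1 + i)" using e by (simp add: add.commute add.left_commute)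
      then show ?thesis using m1 that by (simp add: P_def)
    qed
    then show "m' 24 = buf \<and> m' buf = k \<and> (\<forall>i<k. m' (buf + 1 + i) = ranks xs ! i) \<and>
      (\<forall>i<k. K \<le> i \<longrightarrow> m' (Suc i) = ranks xs ! i)"
      using keep m1 by (simp add: P_def)
  qed (use m1 big K in \<open>simp_all add: P_def\<close>)
  let ?c4 = "[CPY 0 24] @ replicate K (INC 0) @ concat (map (\<lambda>r. [LOADI r 0, DEC 0]) (rev [1..<Suc K])) @ [LOADI 0 0]"
  have s4: "wp (Ops ?c4) (3 * K + 2) (\<lambda>m'. map (\<lambda>i. m' (Suc i)) [0..<m' 0] = ranks xs) m1"
    if m1: "m1 24 = buf \<and> m1 buf = k \<and> (\<forall>i<k. m1 (buf + 1 + i) = ranks xs ! i) \<and>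
      (\<forall>i<k. K \<le> i \<longrightarrow> m1 (Suc i) = ranks xs ! i)" for m1
  proof (rule wp_Ops)
    define m2 where "m2 = (\<lambda>x. if x = 0 then buf else if x \<le> K then m1 (buf + x) else m1 x)"
    have "fold eff (concat (map (\<lambda>r. [LOADI r 0, DEC 0]) (rev [1..<Suc K]))) (m1(0 := buf + K)) = m2"
      using fold_load[of K buf "m1(0 := buf + K)"] big by (auto simp: m2_def fun_eq_iff simp del: upt_Suc)
    then have f: "fold eff ?c4 m1 = m2(0 := k)"
      using m1 big by (simp add: fold_INC m2_def del: fold_replicate upt_Suc)
    have "m2 (Suc i) = ranks xs ! i" if "i < k" for i
      using m1 that by (simp add: m2_def)
    then show "map (\<lambda>i. fold eff ?c4 m1 (Suc i)) [0..<fold eff ?c4 m1 0] = ranks xs"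
      unfolding f by (intro nth_equalityI) (simp_all add: ranks_def k_def)
    have "length (concat (map (\<lambda>r. [LOADI r 0, DEC 0]) rs)) = 2 * length rs" for rs :: "nat list"
      by (induction rs) auto
    then show "length ?c4 \<le> 3 * K + 2" by (simp del: upt_Suc)
    show "list_all jump_free ?c4"
      by (simp add: list_all_append jump_free_replicate) (simp add: list_all_iff)
  qed
  show ?thesis unfolding OUTPUT_def
    by (rule wp_SeqI[OF s1], rule wp_SeqI[OF s2], assumption, rule wp_SeqI[OF s3], assumption, erule s4,
        (rule le_refl)+) (simp add: output_time_def)
qed

section \<open>Polynomial running time\<close>

definition poly_bounded :: "(nat \<Rightarrow> nat) \<Rightarrow> bool" where
  "poly_bounded f \<longleftrightarrow> (\<exists>c k. \<forall>n. f n \<le> c * (n + 1) ^ k)"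

lemma poly_bounded_const: "poly_bounded (\<lambda>n. a)"
  unfolding poly_bounded_def by (intro exI[of _ a] exI[of _ 0]) simp

lemma poly_bounded_id: "poly_bounded (\<lambda>n. n)"
  unfolding poly_bounded_def by (intro exI[of _ 1]) simp

lemma poly_bounded_add:
  assumes "poly_bounded f" "poly_bounded g"
  shows "poly_bounded (\<lambda>n. f n + g n)"
proof -
  obtain c k c' k' where f: "\<And>n. f n \<le> c * (n + 1) ^ k" and g: "\<And>n. g n \<le> c' * (n + 1) ^ k'"
    using assms unfolding poly_bounded_def by blast
  have "f n + g n \<le> (c + c') * (n + 1) ^ (k + k')" for n
  proof -
    have "(n + 1) ^ k \<le> (n + 1) ^ (k + k')" "(n + 1) ^ k' \<le> (n + 1) ^ (k + k')"
      by (intro power_increasing; simp)+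
    then have "c * (n + 1) ^ k \<le> c * (n + 1) ^ (k + k')" "c' * (n + 1) ^ k' \<le> c' * (n + 1) ^ (k + k')"
      by simp_all
    then show ?thesis using f[of n] g[of n] unfolding add_mult_distrib by linarith
  qed
  then show ?thesis unfolding poly_bounded_def by blast
qed

lemma poly_bounded_mult:
  assumes "poly_bounded f" "poly_bounded g"
  shows "poly_bounded (\<lambda>n. f n * g n)"
proof -
  obtain c k c' k' where f: "\<And>n. f n \<le> c * (n + 1) ^ k" and g: "\<And>n. g n \<le> c' * (n + 1) ^ k'"
    using assms unfolding poly_bounded_def by blast
  have "f n * g n \<le> (c * c') * (n + 1) ^ (k + k')" for n
  proof -
    have "f n * g n \<le> (c * (n + 1) ^ k) * (c' * (n + 1) ^ k')" using f g by (rule mult_le_mono)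
    also have "\<dots> = (c * c') * (n + 1) ^ (k + k')" by (simp add: power_add mult_ac)
    finally show ?thesis .
  qed
  then show ?thesis unfolding poly_bounded_def by blast
qed

lemma poly_bounded_power: "poly_bounded f \<Longrightarrow> poly_bounded (\<lambda>n. f n ^ k)"
  by (induction k) (auto intro: poly_bounded_const poly_bounded_mult)

lemma poly_bounded_Suc: "poly_bounded f \<Longrightarrow> poly_bounded (\<lambda>n. Suc (f n))"
  using poly_bounded_add[of f "\<lambda>n. 1"] poly_bounded_const by simp

lemma poly_bounded_nest_time:
  assumes "poly_bounded f" "poly_bounded g" "poly_bounded t"
  shows "poly_bounded (\<lambda>n. nest_time (f n) (g n) (t n) k)"
  by (induction k) (auto intro!: assms poly_bounded_add poly_bounded_mult poly_bounded_const poly_bounded_Suc)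

lemma nest_time_mono:
  "n \<le> n' \<Longrightarrow> T \<le> T' \<Longrightarrow> nest_time n h T k \<le> nest_time n' h T' k"
  by (induction k) (auto intro!: add_mono mult_le_mono)

definition PROGRAM :: "nat \<Rightarrow> com" where
  "PROGRAM D = PRELUDE (80 + 2 * D) ;; (INIT ;; ROUNDS D) ;; OUTPUT (80 + 2 * D)"

definition program_time :: "nat \<Rightarrow> nat \<Rightarrow> nat" where
  "program_time D N = prelude_time (80 + 2 * D) N +
    (18 + 5 * N + (5 * (N + 9) + 24) + nest_time N 1 (5 * (N + 9) + 24) 8 +
      nest_time N 1 (nest_time N 1 (15 * N + 5 * (N + 9) + 50) 1) 1 + 1) +
    (N * (nest_time (1 + N ^ 8 + N * N) (N + 9) (body_time D N) (Suc D) + 4) + 2) +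
    output_time (80 + 2 * D) N"

lemma poly_bounded_program_time: "poly_bounded (program_time D)"
  unfolding program_time_def prelude_time_def output_time_def body_time_def
  by (intro poly_bounded_add poly_bounded_mult poly_bounded_const poly_bounded_id poly_bounded_power
      poly_bounded_nest_time)

lemma wp_PROGRAM:
  assumes perm: "is_perm \<sigma>" "is_perm \<tau>" and ne: "\<sigma> \<noteq> []" and D: "1 \<le> D"
    and dec: "decomposable D \<sigma> {0..<length \<sigma>}"
  shows "wp (PROGRAM D) (program_time D (length \<sigma> + length \<tau> + 2))
    (\<lambda>m. longest_common_pattern (map (\<lambda>i. m (Suc i)) [0..<m 0]) \<sigma> \<tau>) (snd (init_config \<sigma> \<tau>))"
proof -
  define N where "N = length \<sigma> + length \<tau> + 2"
  define K where "K = 80 + 2 * D"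
  define IS where "IS = 2 * N + 2 * K + 2"
  interpret init \<sigma> \<tau> N "IS + N + N" D IS "IS + N"
    by unfold_locales (use perm D in \<open>simp_all add: N_def IS_def K_def\<close>)
  have s1: "wp (PRELUDE K) (prelude_time K N) ready (snd (init_config \<sigma> \<tau>))"
    using wp_PRELUDE[OF perm _ _ D, of K] ne unfolding IS_def N_def K_def by (simp add: Suc_le_eq)
  have s2: "wp (INIT ;; ROUNDS D) (init_time + rounds_time) (\<lambda>m'. db_inv m' \<and>
    valid \<sigma> \<tau> (rkey m' (IS + N + N)) (rlist m' (IS + N + N)) \<and>
    longest_common_pattern (ranks (rlist m' (IS + N + N))) \<sigma> \<tau>) m" if "ready m" for m
    using wp_INIT_ROUNDS[OF that dec] .
  have s3: "wp (OUTPUT K) (output_time K N)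
      (\<lambda>m. longest_common_pattern (map (\<lambda>i. m (Suc i)) [0..<m 0]) \<sigma> \<tau>) m"
    if m: "db_inv m \<and> valid \<sigma> \<tau> (rkey m (IS + N + N)) (rlist m (IS + N + N)) \<and>
      longest_common_pattern (ranks (rlist m (IS + N + N))) \<sigma> \<tau>" for m
  proof -
    let ?xs = "rlist m (IS + N + N)"
    have v: "valid \<sigma> \<tau> (rkey m (IS + N + N)) ?xs" using m by blast
    have len: "length ?xs \<le> N" using valid_length[OF v] by (simp add: N_def)
    have bound: "\<forall>x\<in>set ?xs. x \<le> N"
    proof
      fix x assume "x \<in> set ?xs"
      moreover obtain ps where "match \<sigma> \<tau> ps" "?xs = map (\<lambda>p. \<sigma> ! fst p) ps"
        using v unfolding valid_def by blast
      ultimately have "x \<in> set \<sigma>" by (auto simp: match_def)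
      then show "x \<le> N" using perm(1) by (simp add: is_perm_def N_def)
    qed
    have r: "m 2 = 0" "m 21 = IS + N + N" "m 24 = buf" using m by (simp_all add: db_inv_def)
    have "0 < length all_recs" by (simp add: all_recs_def)
    then have "bs \<le> length all_recs * bs" by (cases "length all_recs") simp_all
    moreover have "9 + length ?xs \<le> bs" using len by (simp add: bs_def)
    ultimately have "IS + N + N + 9 + length ?xs \<le> buf" unfolding buf_def by linarith
    then have "wp (OUTPUT K) (output_time K N) (\<lambda>m'. map (\<lambda>i. m' (Suc i)) [0..<m' 0] = ranks ?xs) m"
      by (intro wp_OUTPUT[OF r _ _ refl len bound]) (simp_all add: IS_def K_def)
    then show ?thesis using m by (elim wp_conseq) simp_all
  qed
  have Q: "length all_recs \<le> 1 + N ^ 8 + N * N"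
    unfolding length_all_recs by (intro add_mono mult_le_mono) (simp_all add: N_def)
  have "init_time \<le> 18 + 5 * N + (5 * (N + 9) + 24) + nest_time N 1 (5 * (N + 9) + 24) 8 +
      nest_time N 1 (nest_time N 1 (15 * N + 5 * (N + 9) + 50) 1) 1 + 1"
  proof -
    have "nest_time (length \<sigma>) 1 (nest_time (length \<tau>) 1 (15 * N + 5 * bs + 50) 1) 1
      \<le> nest_time N 1 (nest_time N 1 (15 * N + 5 * (N + 9) + 50) 1) 1"
      by (intro nest_time_mono) (simp_all only: bs_def, simp_all add: N_def)
    then show ?thesis unfolding init_time_def bs_def by linarith
  qed
  moreover have "rounds_time \<le> N * (nest_time (1 + N ^ 8 + N * N) (N + 9) (body_time D N) (Suc D) + 4) + 2"
    unfolding rounds_time_def bs_def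
    by (intro add_mono mult_le_mono order.refl nest_time_mono Q)
  ultimately have T: "prelude_time K N + (init_time + rounds_time + output_time K N) \<le> program_time D N"
    unfolding program_time_def K_def by linarith
  show ?thesis unfolding PROGRAM_def K_def[symmetric] N_def[symmetric]
    by (rule wp_SeqI[OF s1], rule wp_SeqI[OF s2], assumption, erule s3, rule order.refl, rule T)
qed

lemma longest_common_pattern_Nil: "longest_common_pattern [] [] \<tau>"
  unfolding longest_common_pattern_def is_pattern_def is_perm_def order_iso_def
  by (auto intro: exI[of _ "{}"])

theorem theorem2:
  fixes d :: int
  shows "\<exists>(prog :: instr list) (c :: nat) (k :: nat).
           \<forall>\<sigma> \<tau>. class_R d \<sigma> \<and> is_perm \<tau> \<longrightarrow>
             (\<exists>t. t \<le> c * (length \<sigma> + length \<tau> + 1) ^ k \<and>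
                  halted prog (run prog t (init_config \<sigma> \<tau>)) \<and>
                  longest_common_pattern (output_of (run prog t (init_config \<sigma> \<tau>))) \<sigma> \<tau>)"
proof -
  define D where "D = max 2 (nat d)"
  define code where "code = compile 1 (PROGRAM D)"
  define prog where "prog = JZ 0 (Suc (length code)) # code"
  have "poly_bounded (\<lambda>n. Suc (program_time D (n + 2)))"
  proof -
    obtain c k where ck: "\<And>n. program_time D n \<le> c * (n + 1) ^ k"
      using poly_bounded_program_time unfolding poly_bounded_def by blast
    have "poly_bounded (\<lambda>n. Suc (c * (n + 2 + 1) ^ k))"
      by (intro poly_bounded_Suc poly_bounded_mult poly_bounded_const poly_bounded_power poly_bounded_add
          poly_bounded_id)
    then obtain c' k' where "\<And>n. Suc (c * (n + 2 + 1) ^ k) \<le> c' * (n + 1) ^ k'"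
      unfolding poly_bounded_def by blast
    then have "Suc (program_time D (n + 2)) \<le> c' * (n + 1) ^ k'" for n
      using ck[of "n + 2"] by (meson Suc_le_mono le_trans)
    then show ?thesis unfolding poly_bounded_def by blast
  qed
  then obtain c k where ck: "\<And>n. Suc (program_time D (n + 2)) \<le> c * (n + 1) ^ k"
    unfolding poly_bounded_def by blast
  have "\<exists>t. t \<le> c * (length \<sigma> + length \<tau> + 1) ^ k \<and> halted prog (run prog t (init_config \<sigma> \<tau>)) \<and>
      longest_common_pattern (output_of (run prog t (init_config \<sigma> \<tau>))) \<sigma> \<tau>"
    if R: "class_R d \<sigma>" and \<tau>: "is_perm \<tau>" for \<sigma> \<tau>
  proof -
    note bound = ck[of "length \<sigma> + length \<tau>"]
    let ?m = "snd (init_config \<sigma> \<tau>)"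
    have c0: "init_config \<sigma> \<tau> = (0, ?m)" and m0: "?m 0 = length \<sigma>" by (simp_all add: init_config_def)
    show ?thesis
    proof (cases "\<sigma> = []")
      case True
      then have "run prog 1 (init_config \<sigma> \<tau>) = (length prog, ?m)"
        using m0 by (subst c0) (simp add: run_def prog_def)
      moreover have "1 \<le> c * (length \<sigma> + length \<tau> + 1) ^ k" using bound by linarith
      ultimately show ?thesis using True m0 longest_common_pattern_Nil
        by (intro exI[of _ 1]) (simp add: halted_def output_of_def)
    next
      case False
      have perm: "is_perm \<sigma>" using R by (simp add: class_R_def)
      have D: "2 \<le> D" "d \<le> int D" "1 \<le> D" by (simp_all add: D_def)
      have dec: "decomposable D \<sigma> {0..<length \<sigma>}" by (rule class_R_decomposable[OF R False D(1,2)])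
      obtain t m where t: "t \<le> program_time D (length \<sigma> + length \<tau> + 2)" "big (PROGRAM D) ?m t m"
        and m: "longest_common_pattern (map (\<lambda>i. m (Suc i)) [0..<m 0]) \<sigma> \<tau>"
        using wp_PROGRAM[OF perm \<tau> False D(3) dec] unfolding wp_def by blast
      have "code_at prog 1 (compile 1 (PROGRAM D))"
        by (simp add: code_at_def prog_def code_def)
      from run_compile[OF t(2) this] have "run prog t (1, ?m) = (length prog, m)"
        by (simp add: prog_def code_def)
      moreover have "step prog (init_config \<sigma> \<tau>) = (1, ?m)"
        using m0 False by (subst c0) (simp add: prog_def)
      ultimately have "run prog (Suc t) (init_config \<sigma> \<tau>) = (length prog, m)" by (simp add: run_Suc)
      then show ?thesis using m t(1) bound
        by (intro exI[of _ "Suc t"]) (simp add: halted_def output_of_def)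
    qed
  qed
  then show ?thesis by blast
qed

end
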